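(* There is an absolute constant $c>0$ such that for every integer $n\ge 2$, any $A\subseteq S_n$ that contains no non-trivial 3AP satisfies $\mu(A)<n^{-c\log n}$.
   Context: $S_n$ is the symmetric group on $\{1,\dots,n\}$, $\mu(A)=|A|/n!$, and $\log$ is the natural logarithm. A triple $(x,y,z)$ of elements of a group is a 3AP if $xz=y^2$; it is non-trivial if $x,y,z$ are not all equal. $A$ contains no non-trivial 3AP if there is no non-trivial 3AP $(x,y,z)$ with $x,y,z\in A$. *)

theory Defs
  imports Complex_Main "HOL-Algebra.Sym_Groups"
begin

definition three_AP :: "('a, 'b) monoid_scheme \<Rightarrow> 'a \<Rightarrow> 'a \<Rightarrow> 'a \<Rightarrow> bool" where
  "three_AP G x y z \<longleftrightarrow>
     x \<in> carrier G \<and> y \<in> carrier G \<and> z \<in> carrier G \<and>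
     x \<otimes>\<^bsub>G\<^esub> z = y [^]\<^bsub>G\<^esub> (2::nat)"

definition nontrivial_three_AP :: "('a, 'b) monoid_scheme \<Rightarrow> 'a \<Rightarrow> 'a \<Rightarrow> 'a \<Rightarrow> bool" where
  "nontrivial_three_AP G x y z \<longleftrightarrow> three_AP G x y z \<and> \<not> (x = y \<and> y = z)"

definition three_AP_free :: "('a, 'b) monoid_scheme \<Rightarrow> 'a set \<Rightarrow> bool" where
  "three_AP_free G A \<longleftrightarrow>
     \<not> (\<exists>x\<in>A. \<exists>y\<in>A. \<exists>z\<in>A. nontrivial_three_AP G x y z)"

definition sym_density :: "nat \<Rightarrow> (nat \<Rightarrow> nat) set \<Rightarrow> real" where
  "sym_density n A = real (card A) / fact n"

end

(* Follow p^2 trajectories of length R of a permutation y, with distinct points, labelled by the plane over the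
   field with p elements. A tuple k in SL_2(p)^R turns y into Y = y o relabel y k by permuting, at each time j,
   the points reached at time j. If v is another tuple with v_0 = 0, then X = Y o relabel y v and
   Z = (relabel y v)^{-1} o Y satisfy XZ = Y^2, and since Y advances time by one, Z belongs to the tuple
   (- v_{i+1} + k_i)_i, in additive notation. So it suffices to find k, k + v and (- v_{i+1} + k_i)_i with v != 0 in a
   dense subset S of SL_2(p)^R. Pass to a fibre of S, fixing few coordinates, whose density cannot be
   increased much by fixing further coordinates. On this fibre the solutions are counted by a convolution.
   Its main term comes from the means; every other term gains a factor of about p^{-1/2} for each
   coordinate in which it has mean zero, because unipotent elements of SL_2(p) are conjugated by the torus into
   many different powers of themselves. Taking p and R to be powers of n, sets of density exp(-c (log n)^2)
   can be treated. *)

theory Submission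
  imports Defs "HOL-Analysis.L2_Norm" "HOL-Library.Function_Algebras" "HOL-Number_Theory.Number_Theory"
    "HOL-Combinatorics.Permutations" "HOL-Real_Asymp.Real_Asymp"
begin

section \<open>Convolution on finite groups\<close>

text \<open>The tuples \<open>k + v\<close> and \<open>\<lambda>i. - v (Suc i) + k i\<close>
  determine \<open>k\<close> only through sums of neighbouring coordinates, so one of the three
  functions in the convolution counts tuples with prescribed sums. It can be far larger than its
  mean: a run of free coordinates of \<open>k\<close> carries one sum more than unknowns, because
  both its ends are fixed. Runs of length at least 11 limit the damage to one factor
  \<open>card H\<close> for every ten sums. After a square root this is at most
  \<open>p powr (3 / 20)\<close> per coordinate, and the mixing gain of order
  \<open>p powr (- 1 / 2)\<close> absorbs it. Spreadness with exponent \<open>C\<close> costs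
  \<open>35 powr (3 / 2 * C)\<close> per coordinate, a small power of \<open>p\<close> as long as
  \<open>C\<close> is a small multiple of \<open>ln p\<close>. The densities that can be treated go
  down to \<open>(b / 4) powr - C\<close> with \<open>b\<close> a power of \<open>n\<close>, which
  is where the square of the logarithm comes from. Distinct trajectories exist for random starting
  points since few permutations have many points on short cycles.\<close>

lemma norm_bessel:
  fixes f :: "'x \<Rightarrow> complex" and e :: "'t \<Rightarrow> 'x \<Rightarrow> complex"
  assumes fin: "finite G" "finite T"
    and orth: "\<And>t t'. t \<in> T \<Longrightarrow> t' \<in> T \<Longrightarrow> t \<noteq> t' \<Longrightarrow> (\<Sum>x\<in>G. e t x * cnj (e t' x)) = 0"
    and len: "\<And>t. t \<in> T \<Longrightarrow> (\<Sum>x\<in>G. (cmod (e t x))\<^sup>2) = M" and M0: "M \<ge> 0"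
  shows "(\<Sum>t\<in>T. (cmod (\<Sum>x\<in>G. f x * cnj (e t x)))\<^sup>2) \<le> M * (\<Sum>x\<in>G. (cmod (f x))\<^sup>2)"
proof -
  define c where "c t = (\<Sum>x\<in>G. f x * cnj (e t x))" for t
  define s where "s x = (\<Sum>t\<in>T. c t * e t x)" for x
  define S where "S = (\<Sum>t\<in>T. (cmod (c t))\<^sup>2)"
  have fs: "(\<Sum>x\<in>G. f x * cnj (s x)) = of_real S"
  proof -
    have "(\<Sum>x\<in>G. f x * cnj (s x)) = (\<Sum>x\<in>G. \<Sum>t\<in>T. cnj (c t) * (f x * cnj (e t x)))"
      by (simp add: s_def sum_distrib_left mult_ac)
    also have "\<dots> = (\<Sum>t\<in>T. cnj (c t) * c t)"
      by (subst sum.swap) (simp add: c_def sum_distrib_left)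
    also have "\<dots> = of_real S"
      unfolding S_def of_real_sum
      by (intro sum.cong refl) (simp only: complex_norm_square mult.commute)
    finally show ?thesis .
  qed
  have ss: "(\<Sum>x\<in>G. s x * cnj (s x)) = of_real (M * S)"
  proof -
    have "(\<Sum>x\<in>G. s x * cnj (s x)) = (\<Sum>x\<in>G. \<Sum>t\<in>T. \<Sum>t'\<in>T. c t * cnj (c t') * (e t x * cnj (e t' x)))"
      by (simp add: s_def sum_product mult_ac)
    also have "\<dots> = (\<Sum>t\<in>T. \<Sum>t'\<in>T. c t * cnj (c t') * (\<Sum>x\<in>G. e t x * cnj (e t' x)))"
      by (subst sum.swap, intro sum.cong refl, subst sum.swap) (simp add: sum_distrib_left)
    also have "\<dots> = (\<Sum>t\<in>T. \<Sum>t'\<in>T. if t' = t then c t * cnj (c t) * of_real M else 0)"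
    proof (intro sum.cong refl)
      fix t t' assume t: "t \<in> T" "t' \<in> T"
      have "(\<Sum>x\<in>G. e t x * cnj (e t x)) = of_real (\<Sum>x\<in>G. (cmod (e t x))\<^sup>2)"
        unfolding of_real_sum by (intro sum.cong refl) (simp only: complex_norm_square)
      then show "c t * cnj (c t') * (\<Sum>x\<in>G. e t x * cnj (e t' x)) =
          (if t' = t then c t * cnj (c t) * of_real M else 0)"
        using orth[OF t] len[OF t(1)] by auto
    qed
    also have "\<dots> = (\<Sum>t\<in>T. c t * cnj (c t) * of_real M)"
      by (intro sum.cong refl) (simp add: fin)
    also have "\<dots> = of_real (M * S)"
      unfolding S_def of_real_sum of_real_mult sum_distrib_left
      by (intro sum.cong refl) (simp only: complex_norm_square mult.commute)
    finally show ?thesis .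
  qed
  define F where "F = (\<Sum>x\<in>G. (cmod (f x))\<^sup>2)"
  have ff: "(\<Sum>x\<in>G. f x * cnj (f x)) = of_real F"
    unfolding F_def of_real_sum by (intro sum.cong refl) (simp only: complex_norm_square)
  have sf: "(\<Sum>x\<in>G. s x * cnj (f x)) = of_real S"
    using arg_cong[OF fs, of cnj] by (simp add: mult.commute)
  have "complex_of_real (\<Sum>x\<in>G. (cmod (of_real M * f x - s x))\<^sup>2)
      = (\<Sum>x\<in>G. (of_real M * f x - s x) * cnj (of_real M * f x - s x))"
    unfolding of_real_sum by (intro sum.cong refl) (simp only: complex_norm_square)
  also have "\<dots> = of_real M * of_real M * (\<Sum>x\<in>G. f x * cnj (f x)) - of_real M * (\<Sum>x\<in>G. f x * cnj (s x))
      - of_real M * (\<Sum>x\<in>G. s x * cnj (f x)) + (\<Sum>x\<in>G. s x * cnj (s x))"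
  proof -
    have "(of_real M * f x - s x) * cnj (of_real M * f x - s x) = of_real M * of_real M * (f x * cnj (f x))
      - of_real M * (f x * cnj (s x)) - of_real M * (s x * cnj (f x)) + s x * cnj (s x)" for x
      by (simp add: algebra_simps)
    then show ?thesis
      by (simp only: sum.distrib sum_subtractf sum_distrib_left)
  qed
  also have "\<dots> = of_real (M * (M * F - S))"
    unfolding ff fs sf ss by (simp add: algebra_simps)
  finally have "(\<Sum>x\<in>G. (cmod (of_real M * f x - s x))\<^sup>2) = M * (M * F - S)"
    by (simp only: of_real_eq_iff)
  moreover have "(\<Sum>x\<in>G. (cmod (of_real M * f x - s x))\<^sup>2) \<ge> 0"
    by (intro sum_nonneg) simp
  ultimately have ge: "M * (M * F - S) \<ge> 0" by simp
  show ?thesis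
  proof (cases "M = 0")
    case True
    have "e t x = 0" if "t \<in> T" "x \<in> G" for t x
      using len[OF that(1)] that(2) fin(1) True by (simp add: sum_nonneg_eq_0_iff)
    then show ?thesis using True by simp
  next
    case False
    then have "S \<le> M * F" using ge M0 by (simp add: zero_le_mult_iff)
    then show ?thesis by (simp add: S_def F_def c_def)
  qed
qed

locale finite_add_subgroup =
  fixes G :: "'g::group_add set"
  assumes finite_carrier: "finite G" and zero_mem: "0 \<in> G"
    and add_mem: "x \<in> G \<Longrightarrow> y \<in> G \<Longrightarrow> x + y \<in> G"
    and uminus_mem: "x \<in> G \<Longrightarrow> - x \<in> G"
begin

lemma diff_mem: "x \<in> G \<Longrightarrow> y \<in> G \<Longrightarrow> x - y \<in> G"
  using add_mem[OF _ uminus_mem] by fastforce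

lemma sum_translate_right: "t \<in> G \<Longrightarrow> (\<Sum>x\<in>G. \<phi> (x + t)) = (\<Sum>x\<in>G. \<phi> x)"
  by (rule sum.reindex_bij_witness[of _ "\<lambda>x. x - t" "\<lambda>x. x + t"]) (auto simp: add_mem diff_mem)

lemma sum_translate_left: "t \<in> G \<Longrightarrow> (\<Sum>x\<in>G. \<phi> (t + x)) = (\<Sum>x\<in>G. \<phi> x)"
  by (rule sum.reindex_bij_witness[of _ "\<lambda>x. - t + x" "\<lambda>x. t + x"])
    (auto simp: add_mem uminus_mem add.assoc[symmetric])

lemma sum_reflect: "(\<Sum>x\<in>G. \<phi> (- x)) = (\<Sum>x\<in>G. \<phi> x)"
  by (rule sum.reindex_bij_witness[of _ "\<lambda>x. - x" "\<lambda>x. - x"]) (auto simp: uminus_mem)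

lemma sum_reflect_translate: "t \<in> G \<Longrightarrow> (\<Sum>x\<in>G. \<phi> (- x + t)) = (\<Sum>x\<in>G. \<phi> x)"
  using sum_reflect[of "\<lambda>x. \<phi> (x + t)"] sum_translate_right by simp

definition nrm :: "('g \<Rightarrow> complex) \<Rightarrow> real" where
  "nrm \<phi> = L2_set (\<lambda>x. cmod (\<phi> x)) G"

definition conv :: "('g \<Rightarrow> complex) \<Rightarrow> ('g \<Rightarrow> complex) \<Rightarrow> 'g \<Rightarrow> complex" where
  "conv f g x = (\<Sum>y\<in>G. f y * g (- y + x))"

lemma nrm_nonneg [simp]: "nrm \<phi> \<ge> 0"
  by (simp add: nrm_def)

lemma nrm_sq: "(nrm \<phi>)\<^sup>2 = (\<Sum>x\<in>G. (cmod (\<phi> x))\<^sup>2)"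
  by (simp add: nrm_def L2_set_def sum_nonneg)

lemma nrm_cong: "(\<And>x. x \<in> G \<Longrightarrow> \<phi> x = \<psi> x) \<Longrightarrow> nrm \<phi> = nrm \<psi>"
  unfolding nrm_def by (intro L2_set_cong) auto

lemma nrm_add: "nrm (\<lambda>x. \<phi> x + \<psi> x) \<le> nrm \<phi> + nrm \<psi>"
proof -
  have "nrm (\<lambda>x. \<phi> x + \<psi> x) \<le> L2_set (\<lambda>x. cmod (\<phi> x) + cmod (\<psi> x)) G"
    unfolding nrm_def by (intro L2_set_mono) (auto intro: norm_triangle_ineq)
  also have "\<dots> \<le> nrm \<phi> + nrm \<psi>"
    unfolding nrm_def by (rule L2_set_triangle_ineq)
  finally show ?thesis .
qed

lemma nrm_scale: "nrm (\<lambda>x. c * \<phi> x) = cmod c * nrm \<phi>"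
  unfolding nrm_def by (simp add: norm_mult L2_set_right_distrib)

lemma nrm_zero [simp]: "nrm (\<lambda>x. 0) = 0"
  by (simp add: nrm_def L2_set_def)

lemma nrm_sum: "finite K \<Longrightarrow> nrm (\<lambda>x. \<Sum>k\<in>K. \<phi> k x) \<le> (\<Sum>k\<in>K. nrm (\<phi> k))"
proof (induction K rule: finite_induct)
  case (insert k K)
  then show ?case using nrm_add[of "\<phi> k" "\<lambda>x. \<Sum>k\<in>K. \<phi> k x"] by simp
qed simp

lemma nrm_translate: "t \<in> G \<Longrightarrow> nrm (\<lambda>x. \<phi> (x + t)) = nrm \<phi>"
  unfolding nrm_def L2_set_def using sum_translate_right[of t "\<lambda>x. (cmod (\<phi> x))\<^sup>2"] by simp

lemma cmod_inner_le: "cmod (\<Sum>x\<in>G. \<phi> x * \<psi> x) \<le> nrm \<phi> * nrm \<psi>"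
proof -
  have "cmod (\<Sum>x\<in>G. \<phi> x * \<psi> x) \<le> (\<Sum>x\<in>G. \<bar>cmod (\<phi> x)\<bar> * \<bar>cmod (\<psi> x)\<bar>)"
    by (rule order_trans[OF norm_sum]) (simp add: norm_mult)
  also have "\<dots> \<le> nrm \<phi> * nrm \<psi>"
    unfolding nrm_def by (rule L2_set_mult_ineq)
  finally show ?thesis .
qed

lemma conv_add: "conv f (\<lambda>x. g x + h x) x = conv f g x + conv f h x"
  by (simp add: conv_def algebra_simps sum.distrib)

lemma conv_scale: "conv f (\<lambda>x. c * g x) x = c * conv f g x"
  by (simp add: conv_def algebra_simps sum_distrib_left)

lemma conv_sum: "conv f (\<lambda>x. \<Sum>k\<in>K. g k x) x = (\<Sum>k\<in>K. conv f (g k) x)"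
  unfolding conv_def by (subst sum.swap) (simp add: sum_distrib_left)

lemma conv_translate: "conv f (\<lambda>x. g (x + t)) x = conv f g (x + t)"
  by (simp add: conv_def add.assoc)

text \<open>The translates of \<open>g\<close> all have the same convolution norm with \<open>f\<close>, so if many of them are
  orthogonal, Bessel's inequality forces that common norm to be small.\<close>

lemma nrm_conv_orthogonal_translates:
  assumes T: "finite T" "\<And>t. t \<in> T \<Longrightarrow> D t \<in> G"
    and orth: "\<And>t t'. t \<in> T \<Longrightarrow> t' \<in> T \<Longrightarrow> t \<noteq> t' \<Longrightarrow> (\<Sum>x\<in>G. g (x + D t) * cnj (g (x + D t'))) = 0"
  shows "real (card T) * (nrm (conv f g))\<^sup>2 \<le> card G * (nrm f)\<^sup>2 * (nrm g)\<^sup>2"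
proof -
  have 1: "(\<Sum>t\<in>T. (cmod (conv f g (x + D t)))\<^sup>2) \<le> (nrm g)\<^sup>2 * (nrm f)\<^sup>2" if x: "x \<in> G" for x
  proof -
    have "(\<Sum>t\<in>T. (cmod (\<Sum>y\<in>G. f y * cnj (cnj (g (- y + x + D t)))))\<^sup>2) \<le> (nrm g)\<^sup>2 * (\<Sum>y\<in>G. (cmod (f y))\<^sup>2)"
    proof (rule norm_bessel[OF finite_carrier T(1)])
      fix t t' assume t: "t \<in> T" "t' \<in> T" "t \<noteq> t'"
      have "(\<Sum>y\<in>G. cnj (g (- y + x + D t)) * cnj (cnj (g (- y + x + D t'))))
         = (\<Sum>y\<in>G. cnj (g (y + D t)) * cnj (cnj (g (y + D t'))))"
        by (rule sum_reflect_translate[OF x])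
      also have "\<dots> = cnj (\<Sum>y\<in>G. g (y + D t) * cnj (g (y + D t')))"
        by (simp add: mult.commute)
      finally show "(\<Sum>y\<in>G. cnj (g (- y + x + D t)) * cnj (cnj (g (- y + x + D t')))) = 0"
        using orth[OF t] by simp
    next
      fix t assume t: "t \<in> T"
      have "(\<Sum>y\<in>G. (cmod (cnj (g (- y + x + D t))))\<^sup>2) = (\<Sum>y\<in>G. (cmod (g (y + D t)))\<^sup>2)"
        using sum_reflect_translate[OF x, of "\<lambda>y. (cmod (g (y + D t)))\<^sup>2"] by simp
      also have "\<dots> = (nrm g)\<^sup>2"
        using sum_translate_right[OF T(2)[OF t], of "\<lambda>y. (cmod (g y))\<^sup>2"] by (simp add: nrm_sq)
      finally show "(\<Sum>y\<in>G. (cmod (cnj (g (- y + x + D t))))\<^sup>2) = (nrm g)\<^sup>2" .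
    qed simp
    then show ?thesis by (simp add: conv_def add.assoc nrm_sq)
  qed
  have "real (card T) * (nrm (conv f g))\<^sup>2 = (\<Sum>t\<in>T. (nrm (conv f g))\<^sup>2)" by simp
  also have "\<dots> = (\<Sum>t\<in>T. \<Sum>x\<in>G. (cmod (conv f g (x + D t)))\<^sup>2)"
    using sum_translate_right[OF T(2), of _ "\<lambda>y. (cmod (conv f g y))\<^sup>2"]
    by (intro sum.cong refl) (simp add: nrm_sq)
  also have "\<dots> = (\<Sum>x\<in>G. \<Sum>t\<in>T. (cmod (conv f g (x + D t)))\<^sup>2)" by (rule sum.swap)
  also have "\<dots> \<le> (\<Sum>x\<in>G. (nrm g)\<^sup>2 * (nrm f)\<^sup>2)" by (intro sum_mono 1)
  finally show ?thesis by (simp add: mult_ac)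
qed

end

section \<open>Characters of a cyclic group of translations\<close>

definition root1 :: "nat \<Rightarrow> complex" where
  "root1 p = cis (2 * pi / real p)"

lemma root1_power: "root1 p ^ k = cis (2 * pi * real k / real p)"
proof -
  have "root1 p ^ k = cis (real k * (2 * pi / real p))"
    unfolding root1_def by (rule DeMoivre)
  then show ?thesis by (simp add: mult_ac)
qed

lemma norm_root1_power [simp]: "cmod (root1 p ^ k) = 1"
  by (simp add: root1_power)

lemma root1_power_p: "p > 0 \<Longrightarrow> root1 p ^ p = 1"
  by (simp add: root1_power)

lemma root1_power_period: "p > 0 \<Longrightarrow> root1 p ^ (k * p) = 1"
  by (simp add: root1_power_p power_mult mult.commute[of k])

lemma root1_power_inj: "p > 0 \<Longrightarrow> k < p \<Longrightarrow> l < p \<Longrightarrow> root1 p ^ k = root1 p ^ l \<Longrightarrow> k = l"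
  using bij_betw_imp_inj_on[OF bij_betw_roots_unity[of p]] unfolding root1_power inj_on_def by simp

lemma root1_power_cong:
  assumes "p > 0"
  shows "root1 p ^ k = root1 p ^ l \<longleftrightarrow> [k = l] (mod p)"
proof -
  have red: "root1 p ^ k = root1 p ^ (k mod p)" for k
    by (subst div_mult_mod_eq[of k p, symmetric], subst power_add)
      (simp add: root1_power_period assms)
  show ?thesis
    using red[of k] red[of l] root1_power_inj[OF assms, of "k mod p" "l mod p"] assms
    by (auto simp: unique_euclidean_semiring_class.cong_def)
qed

lemma mult_cnj_root1_eq_1:
  "root1 p ^ k * cnj (root1 p ^ l) = 1 \<longleftrightarrow> root1 p ^ k = root1 p ^ l"
proof -
  have "root1 p ^ l * cnj (root1 p ^ l) = 1"
    by (simp only: complex_norm_square[symmetric]) (simp add: norm_power[symmetric])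
  then show ?thesis
    by (metis mult.assoc mult.commute mult.right_neutral)
qed

lemma root1_orthogonal:
  assumes "p > 0" "k < p" "l < p"
  shows "(\<Sum>s<p. root1 p ^ (k * s) * cnj (root1 p ^ (l * s))) = (if k = l then of_nat p else 0)"
proof -
  define a where "a = root1 p ^ k * cnj (root1 p ^ l)"
  have "(\<Sum>s<p. root1 p ^ (k * s) * cnj (root1 p ^ (l * s))) = (\<Sum>s<p. a ^ s)"
    by (simp add: a_def power_mult power_mult_distrib)
  also have "\<dots> = (if k = l then of_nat p else 0)"
  proof (cases "k = l")
    case True
    then have "a = 1" unfolding a_def mult_cnj_root1_eq_1 by simp
    then show ?thesis using True by simp
  next
    case False
    then have "a \<noteq> 1"
      unfolding a_def mult_cnj_root1_eq_1 using root1_power_inj[OF assms] by blast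
    moreover have "a ^ p = 1"
      by (simp add: a_def power_mult_distrib power_mult[symmetric] root1_power_period[OF assms(1)]
          flip: complex_cnj_power)
    ultimately show ?thesis using False by (simp add: geometric_sum)
  qed
  finally show ?thesis .
qed

lemma sum_lessThan_periodic:
  fixes \<psi> :: "nat \<Rightarrow> 'a::ab_group_add"
  assumes "\<And>r. \<psi> (r + p) = \<psi> r"
  shows "(\<Sum>r<p. \<psi> (r + s)) = (\<Sum>r<p. \<psi> r)"
proof (induction s)
  case (Suc s)
  have "(\<Sum>r<p. \<psi> (Suc r + s)) + \<psi> s = (\<Sum>r<Suc p. \<psi> (r + s))"
    by (subst sum.lessThan_Suc_shift) simp
  also have "\<dots> = (\<Sum>r<p. \<psi> (r + s)) + \<psi> s"
    using assms[of s] by (simp add: add.commute)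
  finally show ?case using Suc by simp
qed simp

locale cyclic_translation = finite_add_subgroup G for G :: "'g::group_add set" +
  fixes p :: nat and v :: "nat \<Rightarrow> 'g"
  assumes p_pos: "p > 0" and v_mem: "v s \<in> G" and v_add: "v (s + t) = v s + v t" and v_p: "v p = 0"
begin

text \<open>The projection onto the functions on which right translation by \<open>v s\<close> acts
  as the character \<open>\<lambda>s. root1 p ^ (k * s)\<close>. In particular \<open>comp 0\<close>
  averages over the translations.\<close>

definition comp :: "nat \<Rightarrow> ('g \<Rightarrow> complex) \<Rightarrow> 'g \<Rightarrow> complex" where
  "comp k \<phi> x = (\<Sum>s<p. cnj (root1 p ^ (k * s)) * \<phi> (x + v s)) / of_nat p"

lemma v_0: "v 0 = 0"
  using v_add[of 0 0] by (metis add.right_neutral add_left_cancel)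

lemma comp_equivariant: "comp k \<phi> (x + v s) = root1 p ^ (k * s) * comp k \<phi> x"
proof -
  define \<psi> where "\<psi> r = cnj (root1 p ^ (k * r)) * \<phi> (x + v r)" for r
  have one: "root1 p ^ (k * s) * cnj (root1 p ^ (k * s)) = 1"
    by (simp only: mult_cnj_root1_eq_1)
  have "\<psi> (r + p) = \<psi> r" for r
    by (simp add: \<psi>_def distrib_left power_add root1_power_period p_pos v_add v_p del: complex_cnj_power)
  then have "(\<Sum>r<p. \<psi> (r + s)) = (\<Sum>r<p. \<psi> r)" by (rule sum_lessThan_periodic)
  moreover have "cnj (root1 p ^ (k * r)) * \<phi> (x + v s + v r) = root1 p ^ (k * s) * \<psi> (r + s)" for r
  proof -
    have "root1 p ^ (k * s) * \<psi> (r + s) =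
       (root1 p ^ (k * s) * cnj (root1 p ^ (k * s))) * (cnj (root1 p ^ (k * r)) * \<phi> (x + v (s + r)))"
      by (simp add: \<psi>_def distrib_left power_add add.commute mult_ac del: complex_cnj_power)
    then show ?thesis unfolding one by (simp add: v_add add.assoc)
  qed
  ultimately show ?thesis
    by (simp add: comp_def sum_distrib_left[symmetric] \<psi>_def)
qed

lemma sum_comp: "(\<Sum>k<p. comp k \<phi> x) = \<phi> x"
proof -
  have "(\<Sum>k<p. comp k \<phi> x) = (\<Sum>s<p. (\<Sum>k<p. cnj (root1 p ^ (k * s))) * \<phi> (x + v s)) / of_nat p"
    unfolding comp_def sum_divide_distrib[symmetric]
    by (subst sum.swap) (simp add: sum_distrib_right)
  also have "(\<Sum>s<p. (\<Sum>k<p. cnj (root1 p ^ (k * s))) * \<phi> (x + v s)) = (\<Sum>s<p. if s = 0 then of_nat p * \<phi> x else 0)"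
  proof (intro sum.cong refl)
    fix s assume s: "s \<in> {..<p}"
    have "(\<Sum>k<p. cnj (root1 p ^ (k * s))) = (\<Sum>k<p. root1 p ^ (0 * k) * cnj (root1 p ^ (s * k)))"
      by (simp add: mult.commute)
    also have "\<dots> = (if 0 = s then of_nat p else 0)"
      using s p_pos by (intro root1_orthogonal) auto
    finally show "(\<Sum>k<p. cnj (root1 p ^ (k * s))) * \<phi> (x + v s) = (if s = 0 then of_nat p * \<phi> x else 0)"
      by (simp add: v_0)
  qed
  also have "\<dots> = of_nat p * \<phi> x" using p_pos by simp
  finally show ?thesis using p_pos by simp
qed

text \<open>Parseval in the translation parameter at every base point; summing over the base points
  turns each translate of \<open>\<phi>\<close> back into \<open>\<phi>\<close>.\<close>

lemma sum_nrm_comp: "(\<Sum>k<p. (nrm (comp k \<phi>))\<^sup>2) = (nrm \<phi>)\<^sup>2"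
proof -
  have parseval: "(\<Sum>k<p. (cmod (comp k \<phi> x))\<^sup>2) = (\<Sum>s<p. (cmod (\<phi> (x + v s)))\<^sup>2) / real p" for x
  proof -
    define a where "a s = \<phi> (x + v s)" for s
    have "of_real (\<Sum>k<p. (cmod (\<Sum>s<p. cnj (root1 p ^ (k * s)) * a s))\<^sup>2)
        = (\<Sum>k<p. (\<Sum>s<p. cnj (root1 p ^ (k * s)) * a s) * cnj (\<Sum>s<p. cnj (root1 p ^ (k * s)) * a s))"
      by (simp only: of_real_sum complex_norm_square)
    also have "\<dots> = (\<Sum>k<p. \<Sum>s<p. \<Sum>t<p. (a s * cnj (a t)) * (root1 p ^ (t * k) * cnj (root1 p ^ (s * k))))"
      unfolding cnj_sum sum_product by (simp add: mult_ac)
    also have "\<dots> = (\<Sum>s<p. \<Sum>k<p. \<Sum>t<p. (a s * cnj (a t)) * (root1 p ^ (t * k) * cnj (root1 p ^ (s * k))))"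
      by (rule sum.swap)
    also have "\<dots> = (\<Sum>s<p. \<Sum>t<p. (a s * cnj (a t)) * (\<Sum>k<p. root1 p ^ (t * k) * cnj (root1 p ^ (s * k))))"
      unfolding sum_distrib_left by (rule sum.cong[OF refl], rule sum.swap)
    also have "\<dots> = (\<Sum>s<p. \<Sum>t<p. if t = s then of_nat p * (a s * cnj (a s)) else 0)"
      using p_pos by (intro sum.cong refl) (subst root1_orthogonal, auto)
    also have "\<dots> = (\<Sum>s<p. of_nat p * (a s * cnj (a s)))"
      by (intro sum.cong refl) simp
    also have "\<dots> = of_real (real p * (\<Sum>s<p. (cmod (a s))\<^sup>2))"
      by (simp only: of_real_mult of_real_sum complex_norm_square sum_distrib_left of_real_of_nat_eq)
    finally have "(\<Sum>k<p. (cmod (\<Sum>s<p. cnj (root1 p ^ (k * s)) * a s))\<^sup>2) = real p * (\<Sum>s<p. (cmod (a s))\<^sup>2)"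
      by (simp only: of_real_eq_iff)
    then have "(\<Sum>k<p. (cmod (\<Sum>s<p. cnj (root1 p ^ (k * s)) * a s))\<^sup>2) / (real p)\<^sup>2
       = (\<Sum>s<p. (cmod (a s))\<^sup>2) / real p"
      using p_pos by (simp add: power2_eq_square)
    then show ?thesis
      unfolding comp_def norm_divide power_divide sum_divide_distrib[symmetric] by (simp add: a_def)
  qed
  have "(\<Sum>k<p. (nrm (comp k \<phi>))\<^sup>2) = (\<Sum>x\<in>G. \<Sum>k<p. (cmod (comp k \<phi> x))\<^sup>2)"
    unfolding nrm_sq by (rule sum.swap)
  also have "\<dots> = (\<Sum>s<p. \<Sum>x\<in>G. (cmod (\<phi> (x + v s)))\<^sup>2) / real p"
    unfolding parseval sum_divide_distrib[symmetric] by (subst sum.swap) simp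
  also have "\<dots> = (\<Sum>s<p. (nrm \<phi>)\<^sup>2) / real p"
    unfolding nrm_sq using sum_translate_right[OF v_mem, of "\<lambda>x. (cmod (\<phi> x))\<^sup>2"] by simp
  finally show ?thesis using p_pos by simp
qed

text \<open>\<open>conv f\<close> acts from the left and therefore commutes with right translations,
  hence with the projections built from them.\<close>

lemma conv_comp: "conv f (comp k \<phi>) x = comp k (conv f \<phi>) x"
proof -
  have "conv f (comp k \<phi>) x = (\<Sum>s<p. conv f (\<lambda>x. cnj (root1 p ^ (k * s)) * \<phi> (x + v s)) x) / of_nat p"
    unfolding comp_def conv_sum[symmetric]
    using conv_scale[of f "1 / of_nat p" "\<lambda>x. \<Sum>s<p. cnj (root1 p ^ (k * s)) * \<phi> (x + v s)"] by simp
  also have "\<dots> = comp k (conv f \<phi>) x"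
    unfolding comp_def conv_scale conv_translate ..
  finally show ?thesis .
qed

lemma nrm_comp_le: "nrm (comp k \<phi>) \<le> nrm \<phi>"
proof -
  have "nrm (comp k \<phi>) = nrm (\<lambda>x. \<Sum>s<p. (cnj (root1 p ^ (k * s)) / of_nat p) * \<phi> (x + v s))"
    by (intro nrm_cong) (simp add: comp_def sum_divide_distrib)
  also have "\<dots> \<le> (\<Sum>s<p. nrm (\<lambda>x. (cnj (root1 p ^ (k * s)) / of_nat p) * \<phi> (x + v s)))"
    by (rule nrm_sum) simp
  also have "\<dots> = (\<Sum>s<p. nrm \<phi> / real p)"
    unfolding nrm_scale nrm_translate[OF v_mem] norm_divide complex_mod_cnj norm_root1_power by simp
  finally show ?thesis using p_pos by simp
qed

text \<open>\<open>conv f\<close> respects the decomposition into components, so Parseval applies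
  before and after the convolution. The constant \<open>K\<close> survives without any factor for
  the number of components.\<close>

lemma nrm_conv_noninvariant:
  assumes bound: "\<And>k. 0 < k \<Longrightarrow> k < p \<Longrightarrow> nrm (conv f (comp k g)) \<le> K * nrm (comp k g)" and K: "K \<ge> 0"
  shows "nrm (conv f (\<lambda>x. g x - comp 0 g x)) \<le> K * nrm g"
proof (rule power2_le_imp_le)
  define g' where "g' = (\<lambda>x. g x - comp 0 g x)"
  have g': "g' x = (\<Sum>k\<in>{0<..<p}. comp k g x)" for x
  proof -
    have "{..<p} = insert 0 {0<..<p}" using p_pos by auto
    then show ?thesis unfolding g'_def using sum_comp[of g x] by (simp add: eq_diff_eq diff_eq_eq add.commute)
  qed
  have comp': "comp k (conv f g') x = (if 0 < k then conv f (comp k g) x else 0)" if k: "k < p" for k x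
  proof -
    have "comp k (conv f g') x = conv f (comp k g') x" by (simp add: conv_comp)
    moreover have "comp k g' y = (if 0 < k then comp k g y else 0)" for y
    proof -
      have "comp k g' y = comp k g y - comp k (comp 0 g) y"
        unfolding g'_def comp_def[of k]
        by (simp add: right_diff_distrib sum_subtractf diff_divide_distrib del: complex_cnj_power)
      also have "comp k (comp 0 g) y = comp 0 g y * (\<Sum>s<p. root1 p ^ (0 * s) * cnj (root1 p ^ (k * s))) / of_nat p"
        unfolding comp_def[of k] comp_equivariant by (simp add: sum_distrib_left mult_ac)
      also have "\<dots> = (if 0 < k then 0 else comp 0 g y)"
        using k p_pos by (subst root1_orthogonal) auto
      finally show ?thesis by auto
    qed
    ultimately show ?thesis by (auto simp: conv_def)
  qed
  have "(nrm (conv f g'))\<^sup>2 = (\<Sum>k<p. (nrm (comp k (conv f g')))\<^sup>2)"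
    by (rule sum_nrm_comp[symmetric])
  also have "\<dots> \<le> (\<Sum>k<p. K\<^sup>2 * (nrm (comp k g))\<^sup>2)"
  proof (rule sum_mono)
    fix k assume k: "k \<in> {..<p}"
    then have "comp k (conv f g') = (if 0 < k then conv f (comp k g) else (\<lambda>x. 0))"
      using comp'[of k] by (intro ext) simp
    then have "nrm (comp k (conv f g')) \<le> K * nrm (comp k g)"
      using bound[of k] k K by (cases "k = 0") simp_all
    then show "(nrm (comp k (conv f g')))\<^sup>2 \<le> K\<^sup>2 * (nrm (comp k g))\<^sup>2"
      by (metis nrm_nonneg power_mono power_mult_distrib)
  qed
  also have "\<dots> = (K * nrm g)\<^sup>2"
    by (simp add: sum_distrib_left[symmetric] sum_nrm_comp power_mult_distrib)
  finally show "(nrm (conv f (\<lambda>x. g x - comp 0 g x)))\<^sup>2 \<le> (K * nrm g)\<^sup>2" by (simp add: g'_def)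
qed (use K in simp)

text \<open>Substituting \<open>x + v 1\<close> multiplies the inner product by a root of unity
  different from 1.\<close>

lemma orthogonal_equivariant:
  assumes "\<And>x. x \<in> G \<Longrightarrow> \<phi> (x + v 1) = root1 p ^ k * \<phi> x"
    and "\<And>x. x \<in> G \<Longrightarrow> \<psi> (x + v 1) = root1 p ^ l * \<psi> x" and "\<not> [k = l] (mod p)"
  shows "(\<Sum>x\<in>G. \<phi> x * cnj (\<psi> x)) = 0"
proof -
  have "(\<Sum>x\<in>G. \<phi> x * cnj (\<psi> x)) = (\<Sum>x\<in>G. \<phi> (x + v 1) * cnj (\<psi> (x + v 1)))"
    using sum_translate_right[OF v_mem, of "\<lambda>x. \<phi> x * cnj (\<psi> x)"] by simp
  also have "\<dots> = (root1 p ^ k * cnj (root1 p ^ l)) * (\<Sum>x\<in>G. \<phi> x * cnj (\<psi> x))"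
    using assms(1,2) by (simp add: sum_distrib_left mult_ac)
  finally have "(1 - root1 p ^ k * cnj (root1 p ^ l)) * (\<Sum>x\<in>G. \<phi> x * cnj (\<psi> x)) = 0"
    by (simp add: algebra_simps)
  moreover have "root1 p ^ k * cnj (root1 p ^ l) \<noteq> 1"
    unfolding mult_cnj_root1_eq_1 root1_power_cong[OF p_pos] by fact
  ultimately show ?thesis by simp
qed

end

section \<open>Mixing in powers of a group\<close>

text \<open>Tuples are total functions that vanish off \<open>E\<close>, so the pointwise group
  operations on functions apply to them directly. The value 0 outside is used later: a relabelling
  does nothing after the last time.\<close>

definition hbox :: "nat set \<Rightarrow> 'h set \<Rightarrow> (nat \<Rightarrow> 'h::zero) set" where
  "hbox E H = {c. (\<forall>i\<in>E. c i \<in> H) \<and> (\<forall>i. i \<notin> E \<longrightarrow> c i = 0)}"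

definition pt :: "nat \<Rightarrow> 'h::zero \<Rightarrow> nat \<Rightarrow> 'h" where
  "pt j h = (\<lambda>i. if i = j then h else 0)"

lemma bij_betw_hbox_PiE: "bij_betw (\<lambda>c. restrict c E) (hbox E H) (PiE E (\<lambda>_. H))"
  by (rule bij_betw_byWitness[where f' = "\<lambda>c i. if i \<in> E then c i else 0"])
    (auto simp: hbox_def PiE_def extensional_def fun_eq_iff restrict_def)

lemma finite_hbox: "finite E \<Longrightarrow> finite H \<Longrightarrow> finite (hbox E H)"
  using bij_betw_finite[OF bij_betw_hbox_PiE[of E H]] by (simp add: finite_PiE)

lemma card_hbox: "finite E \<Longrightarrow> card (hbox E H) = card H ^ card E"
  using bij_betw_same_card[OF bij_betw_hbox_PiE[of E H]] by (simp add: card_PiE)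

lemma pt_commute: "i \<noteq> j \<Longrightarrow> pt i a + pt j b = pt j b + pt i (a::'h::group_add)"
  by (auto simp: pt_def fun_eq_iff)

lemma pt_add: "pt i (a + b) = pt i a + pt i (b::'h::group_add)"
  by (auto simp: pt_def fun_eq_iff)

lemma pt_0 [simp]: "pt i 0 = (0 :: nat \<Rightarrow> 'h::group_add)"
  by (auto simp: pt_def fun_eq_iff)

text \<open>The groups to which the argument applies. The maps \<open>u True\<close> and \<open>u False\<close> parametrise the
  upper and lower unipotent matrices of \<open>SL\<^sub>2(p)\<close>, and \<open>d\<close> enumerates half of the
  diagonal torus.\<close>

locale mixing_group = finite_add_subgroup H for H :: "'h::group_add set" +
  fixes p N :: nat and u :: "bool \<Rightarrow> nat \<Rightarrow> 'h" and d :: "nat \<Rightarrow> 'h" and m :: "bool \<Rightarrow> nat \<Rightarrow> nat"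
  assumes prime_p: "prime p" and N_pos: "N > 0"
    and u_mem: "u \<tau> s \<in> H" and u_add: "u \<tau> (s + t) = u \<tau> s + u \<tau> t" and u_p: "u \<tau> p = 0"
    and d_mem: "a < N \<Longrightarrow> d a \<in> H"
    and u_d: "a < N \<Longrightarrow> u \<tau> s + d a = d a + u \<tau> (m \<tau> a * s)"
    and m_inj: "a < N \<Longrightarrow> b < N \<Longrightarrow> [m \<tau> a = m \<tau> b] (mod p) \<Longrightarrow> a = b"
    and u_inj: "inj_on (\<lambda>(a, b, c). u True a + u False b + u True c) ({..<p} \<times> {1..<p} \<times> {..<p})"
    and card_le: "card H \<le> p ^ 3"
begin

lemma p_pos: "p > 0"
  using prime_p prime_gt_0_nat by blast

lemma card_H_pos: "card H > 0"
  using finite_carrier zero_mem card_gt_0_iff by blast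

lemma u_0: "u \<tau> 0 = 0"
  using u_add[of \<tau> 0 0] by (metis add.right_neutral add_left_cancel)

lemma box_subgroup: "finite E \<Longrightarrow> finite_add_subgroup (hbox E H)"
  by unfold_locales (auto simp: hbox_def zero_mem add_mem uminus_mem finite_carrier
      intro: finite_hbox[unfolded hbox_def])

lemma pt_mem: "j \<in> E \<Longrightarrow> h \<in> H \<Longrightarrow> pt j h \<in> hbox E H"
  by (auto simp: pt_def hbox_def zero_mem)

lemma cyclic_pt: "finite E \<Longrightarrow> j \<in> E \<Longrightarrow> cyclic_translation (hbox E H) p (\<lambda>s. pt j (u \<tau> s))"
  by (intro cyclic_translation.intro box_subgroup cyclic_translation_axioms.intro)
    (auto simp: p_pos u_add u_p pt_add pt_mem u_mem)

text \<open>The gain per coordinate. Three pieces without invariant part under a unipotent subgroup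
  contribute \<open>1 / sqrt N\<close> each, a remainder close to the full average contributes
  \<open>2 / p\<close>.\<close>

definition lam :: real where
  "lam = 3 / sqrt N + 2 / p"

lemma lam_nonneg: "lam \<ge> 0"
  by (simp add: lam_def)

end

locale mixing_box = mixing_group +
  fixes E :: "nat set"
  assumes finite_E: "finite E"
begin

abbreviation G :: "(nat \<Rightarrow> 'a) set" where
  "G \<equiv> hbox E H"

sublocale B: finite_add_subgroup G
  by (rule box_subgroup[OF finite_E])

definition mean_zero :: "nat set \<Rightarrow> ((nat \<Rightarrow> 'a) \<Rightarrow> complex) \<Rightarrow> bool" where
  "mean_zero J g \<longleftrightarrow> (\<forall>j\<in>J. \<forall>x\<in>G. (\<Sum>h\<in>H. g (x + pt j h)) = 0)"

definition equivariant :: "nat set \<Rightarrow> (nat \<Rightarrow> bool) \<Rightarrow> (nat \<Rightarrow> nat) \<Rightarrow> ((nat \<Rightarrow> 'a) \<Rightarrow> complex) \<Rightarrow> bool" where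
  "equivariant J \<tau> \<psi> g \<longleftrightarrow> (\<forall>j\<in>J. 0 < \<psi> j \<and> \<psi> j < p \<and>
     (\<forall>x\<in>G. \<forall>s. g (x + pt j (u (\<tau> j) s)) = root1 p ^ (\<psi> j * s) * g x))"

lemma mean_zero_sum:
  "(\<And>k. k \<in> K \<Longrightarrow> mean_zero J (g k)) \<Longrightarrow> mean_zero J (\<lambda>x. \<Sum>k\<in>K. g k x)"
  unfolding mean_zero_def by (auto simp: sum.swap[of _ K])

lemma mean_zero_scale: "mean_zero J g \<Longrightarrow> mean_zero J (\<lambda>x. c * g x)"
  unfolding mean_zero_def by (simp add: sum_distrib_left[symmetric])

lemma mean_zero_translate:
  assumes "mean_zero J g" "j \<notin> J" "j \<in> E" "h \<in> H"
  shows "mean_zero J (\<lambda>x. g (x + pt j h))"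
  unfolding mean_zero_def
proof (intro ballI)
  fix i x assume i: "i \<in> J" "x \<in> G"
  then have "(\<Sum>h'\<in>H. g (x + pt j h + pt i h')) = 0"
    using assms by (auto simp: mean_zero_def B.add_mem pt_mem)
  moreover have "x + pt i h' + pt j h = x + pt j h + pt i h'" for h'
    using pt_commute[of i j h' h] i assms(2) by (metis add.assoc)
  ultimately show "(\<Sum>h'\<in>H. g (x + pt i h' + pt j h)) = 0" by simp
qed

lemma equivariant_sum:
  assumes "\<And>j. j \<in> J \<Longrightarrow> 0 < \<psi> j \<and> \<psi> j < p" "\<And>k. k \<in> K \<Longrightarrow> equivariant J \<tau> \<psi> (g k)"
  shows "equivariant J \<tau> \<psi> (\<lambda>x. \<Sum>k\<in>K. g k x)"
  using assms unfolding equivariant_def by (simp add: sum_distrib_left)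

lemma equivariant_scale: "equivariant J \<tau> \<psi> g \<Longrightarrow> equivariant J \<tau> \<psi> (\<lambda>x. c * g x)"
  unfolding equivariant_def by simp

lemma equivariant_translate:
  assumes "equivariant J \<tau> \<psi> g" "j \<notin> J" "j \<in> E" "h \<in> H"
  shows "equivariant J \<tau> \<psi> (\<lambda>x. g (x + pt j h))"
  unfolding equivariant_def
proof (intro ballI conjI allI)
  fix i assume i: "i \<in> J"
  show "0 < \<psi> i" "\<psi> i < p" using assms(1) i by (auto simp: equivariant_def)
  fix x s assume x: "x \<in> G"
  have "g (x + pt j h + pt i (u (\<tau> i) s)) = root1 p ^ (\<psi> i * s) * g (x + pt j h)"
    using assms i x by (auto simp: equivariant_def B.add_mem pt_mem)
  moreover have "x + pt i (u (\<tau> i) s) + pt j h = x + pt j h + pt i (u (\<tau> i) s)"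
    using pt_commute[of i j "u (\<tau> i) s" h] i assms(2) by (metis add.assoc)
  ultimately show "g (x + pt i (u (\<tau> i) s) + pt j h) = root1 p ^ (\<psi> i * s) * g (x + pt j h)"
    by simp
qed

text \<open>Right translation by \<open>d a\<close> in coordinate \<open>j\<close> multiplies the
  character \<open>\<psi> j\<close> by \<open>m (\<tau> j) a\<close>. Distinct \<open>a\<close> give
  distinct characters because \<open>\<psi> j\<close> is a unit mod \<open>p\<close>, so the
  \<open>N ^ card J\<close> translates by tuples of torus elements are pairwise orthogonal.\<close>

lemma nrm_conv_equivariant:
  assumes J: "J \<subseteq> E" and g: "equivariant J \<tau> \<psi> g"
  shows "B.nrm (B.conv f g) \<le> sqrt (card G) * (1 / sqrt N) ^ card J * B.nrm f * B.nrm g"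
proof -
  define T where "T = PiE J (\<lambda>_. {..<N})"
  define D where "D t = (\<lambda>i. if i \<in> J then d (t i) else 0)" for t :: "nat \<Rightarrow> nat"
  have finJ: "finite J" using J finite_E finite_subset by blast
  have cardT: "card T = N ^ card J" by (simp add: T_def card_PiE finJ)
  have "real (card T) * (B.nrm (B.conv f g))\<^sup>2 \<le> card G * (B.nrm f)\<^sup>2 * (B.nrm g)\<^sup>2"
  proof (rule B.nrm_conv_orthogonal_translates)
    show "finite T" by (simp add: T_def finite_PiE finJ)
    show D_mem: "D t \<in> G" if "t \<in> T" for t
      using that J by (auto simp: D_def T_def hbox_def zero_mem intro!: d_mem)
    fix t t' assume t: "t \<in> T" "t' \<in> T" "t \<noteq> t'"
    then obtain j where j: "j \<in> J" "t j \<noteq> t' j"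
      unfolding T_def by (meson PiE_ext)
    interpret C: cyclic_translation G p "\<lambda>s. pt j (u (\<tau> j) s)"
      using cyclic_pt finite_E j(1) J by blast
    have eqv: "g (x + pt j (u (\<tau> j) 1) + D s) = root1 p ^ (\<psi> j * m (\<tau> j) (s j)) * g (x + D s)"
      if s: "s \<in> T" and x: "x \<in> G" for s x
    proof -
      have "s j < N" using s j by (auto simp: T_def)
      then have "pt j (u (\<tau> j) 1) + D s = D s + pt j (u (\<tau> j) (m (\<tau> j) (s j)))"
        using j u_d[of "s j" "\<tau> j" 1] by (auto simp: fun_eq_iff pt_def D_def)
      then have "x + pt j (u (\<tau> j) 1) + D s = x + D s + pt j (u (\<tau> j) (m (\<tau> j) (s j)))"
        by (metis add.assoc)
      then show ?thesis
        using g j(1) x D_mem[OF s] by (simp add: equivariant_def B.add_mem)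
    qed
    show "(\<Sum>x\<in>G. g (x + D t) * cnj (g (x + D t'))) = 0"
    proof (rule C.orthogonal_equivariant)
      have "\<not> [m (\<tau> j) (t j) = m (\<tau> j) (t' j)] (mod p)"
        using m_inj[of "t j" "t' j"] t j by (auto simp: T_def)
      moreover have "coprime (\<psi> j) p"
      proof -
        have "0 < \<psi> j" "\<psi> j < p" using g j(1) by (auto simp: equivariant_def)
        then show ?thesis
          using prime_p by (metis coprime_commute nat_dvd_not_less prime_imp_coprime_nat)
      qed
      ultimately show "\<not> [\<psi> j * m (\<tau> j) (t j) = \<psi> j * m (\<tau> j) (t' j)] (mod p)"
        by (simp add: cong_mult_lcancel_nat)
    qed (use eqv t in auto)
  qed
  then have "(B.nrm (B.conv f g))\<^sup>2 \<le> (card G * (B.nrm f)\<^sup>2 * (B.nrm g)\<^sup>2) / real N ^ card J"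
    using N_pos by (simp add: cardT field_simps)
  also have "\<dots> = (sqrt (card G) * (1 / sqrt N) ^ card J * B.nrm f * B.nrm g)\<^sup>2"
  proof -
    have "real N ^ card J = (sqrt N ^ card J)\<^sup>2"
      by (metis of_nat_0_le_iff power_mult mult.commute real_sqrt_pow2)
    then show ?thesis by (simp add: power_mult_distrib power_divide)
  qed
  finally show ?thesis
    by (rule power2_le_imp_le) simp
qed

text \<open>In a coordinate of mean zero the averages over the upper, the lower and again the upper
  unipotent subgroup are split off. What each of them removes is a sum of nontrivial characters, for
  which the coordinate moves from \<open>J2\<close> to \<open>J1\<close>. The triple average that
  remains almost equals the average over \<open>H\<close>, which vanishes. Carrying
  \<open>J1\<close> along is what lets the induction close.\<close>

lemma nrm_conv_mixed:
  assumes "finite J2" "J1 \<subseteq> E" "J2 \<subseteq> E" "J1 \<inter> J2 = {}" "equivariant J1 \<tau> \<psi> g" "mean_zero J2 g"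
  shows "B.nrm (B.conv f g)
     \<le> sqrt (card G) * (1 / sqrt N) ^ card J1 * lam ^ card J2 * B.nrm f * B.nrm g"
  using assms
proof (induction J2 arbitrary: J1 \<tau> \<psi> g rule: finite_induct)
  case empty
  then show ?case using nrm_conv_equivariant[of J1 \<tau> \<psi> g f] by simp
next
  case (insert j J2)
  have finJ1: "finite J1" using insert.prems(1) finite_E finite_subset by blast
  have j: "j \<in> E" "j \<notin> J1" "j \<notin> J2" using insert by auto
  have chi: "0 < \<psi> i \<and> \<psi> i < p" if "i \<in> J1" for i
    using insert.prems(4) that by (auto simp: equivariant_def)
  define K where "K = sqrt (card G) * (1 / sqrt N) ^ card J1 * lam ^ card J2 * B.nrm f"
  have K0: "K \<ge> 0" by (simp add: K_def lam_nonneg)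
  have gJ2: "mean_zero J2 g" using insert.prems(5) by (auto simp: mean_zero_def)
  define P where "P b = cyclic_translation.comp p (\<lambda>s. pt j (u b s)) 0" for b
  have part: "B.nrm (B.conv f (\<lambda>x. g x - P b g x)) \<le> K / sqrt N * B.nrm g" for b
  proof -
    interpret C: cyclic_translation G p "\<lambda>s. pt j (u b s)"
      using cyclic_pt finite_E j by blast
    show ?thesis
      unfolding P_def
    proof (rule C.nrm_conv_noninvariant)
      fix k assume k: "0 < k" "k < p"
      have comp_alt: "C.comp k g = (\<lambda>x. \<Sum>s<p. (cnj (root1 p ^ (k * s)) / of_nat p) * g (x + pt j (u b s)))"
        by (simp add: C.comp_def fun_eq_iff sum_divide_distrib)
      have eq1: "equivariant J1 \<tau> \<psi> (C.comp k g)"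
        unfolding comp_alt
        by (intro equivariant_sum equivariant_scale equivariant_translate chi insert.prems j u_mem)
      have "equivariant (insert j J1) (\<tau>(j := b)) (\<psi>(j := k)) (C.comp k g)"
        unfolding equivariant_def
      proof (intro ballI)
        fix i assume i: "i \<in> insert j J1"
        show "0 < (\<psi>(j := k)) i \<and> (\<psi>(j := k)) i < p \<and> (\<forall>x\<in>G. \<forall>s. C.comp k g (x + pt i (u ((\<tau>(j := b)) i) s)) =
             root1 p ^ ((\<psi>(j := k)) i * s) * C.comp k g x)"
        proof (cases "i = j")
          case True
          then show ?thesis using k C.comp_equivariant by simp
        next
          case False
          then show ?thesis using eq1 i by (simp add: equivariant_def)
        qed
      qed
      moreover have "mean_zero J2 (C.comp k g)"
        unfolding comp_alt
        by (intro mean_zero_sum mean_zero_scale mean_zero_translate gJ2 j u_mem)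
      ultimately have "B.nrm (B.conv f (C.comp k g))
         \<le> sqrt (card G) * (1 / sqrt N) ^ card (insert j J1) * lam ^ card J2 * B.nrm f * B.nrm (C.comp k g)"
        using insert.prems j by (intro insert.IH) auto
      also have "\<dots> = K / sqrt N * B.nrm (C.comp k g)"
        using finJ1 j by (simp add: K_def mult_ac)
      finally show "B.nrm (B.conv f (C.comp k g)) \<le> K / sqrt N * B.nrm (C.comp k g)" .
    qed (use K0 in simp)
  qed
  have P_conv: "B.conv f (P b v) = P b (B.conv f v)" and P_nrm: "B.nrm (P b v) \<le> B.nrm v"
    and P_alt: "P b v = (\<lambda>x. (\<Sum>s<p. v (x + pt j (u b s))) / of_nat p)" for b v
  proof -
    interpret C: cyclic_translation G p "\<lambda>s. pt j (u b s)"
      using cyclic_pt finite_E j by blast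
    show "B.conv f (P b v) = P b (B.conv f v)" by (simp add: P_def C.conv_comp fun_eq_iff)
    show "B.nrm (P b v) \<le> B.nrm v" unfolding P_def by (rule C.nrm_comp_le)
    show "P b v = (\<lambda>x. (\<Sum>s<p. v (x + pt j (u b s))) / of_nat p)" by (simp add: P_def C.comp_def fun_eq_iff)
  qed
  have P_diff: "P b (\<lambda>x. v x - w x) x = P b v x - P b w x" for b v w x
    by (simp add: P_alt sum_subtractf diff_divide_distrib)
  define Q where "Q = P True (P False (P True g))"
  have Q_alt: "Q x = (\<Sum>(a, b, c)\<in>{..<p} \<times> {..<p} \<times> {..<p}. g (x + pt j (u True a + u False b + u True c))) / of_nat p ^ 3" for x
    by (simp add: Q_def P_alt sum_divide_distrib[symmetric] sum.cartesian_product[symmetric] pt_add add.assoc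
        power3_eq_cube)
  \<comment> \<open>The products with \<open>b \<noteq> 0\<close> are distinct and so miss at most
    \<open>p ^ 2\<close> elements of \<open>H\<close>. Since \<open>g\<close> has mean zero over
    \<open>H\<close>, the sum over \<open>img\<close> is minus the sum over the missed elements.
    Together with the \<open>p ^ 2\<close> terms with \<open>b = 0\<close> this leaves
    \<open>2 * p ^ 2\<close> of the \<open>p ^ 3\<close> terms.\<close>
  define img where "img = (\<lambda>(a, b, c). u True a + u False b + u True c) ` ({..<p} \<times> {1..<p} \<times> {..<p})"
  have img_sub: "img \<subseteq> H" by (auto simp: img_def add_mem u_mem)
  have card_img: "card img = p * ((p - 1) * p)"
    unfolding img_def by (subst card_image[OF u_inj]) (simp add: card_cartesian_product)
  have card_compl: "card (H - img) \<le> p\<^sup>2"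
  proof -
    have "card (H - img) = card H - p * ((p - 1) * p)"
      using img_sub card_img by (simp add: card_Diff_subset finite_carrier finite_subset)
    also have "\<dots> \<le> p ^ 3 - p * ((p - 1) * p)" using card_le by simp
    also have "\<dots> = p\<^sup>2"
      by (cases p) (simp_all add: power2_eq_square power3_eq_cube algebra_simps)
    finally show ?thesis .
  qed
  have Q_split: "Q x = ((\<Sum>(a, c)\<in>{..<p} \<times> {..<p}. g (x + pt j (u True a + u True c)))
       + (\<Sum>h\<in>H - img. - g (x + pt j h))) / of_nat p ^ 3" if x: "x \<in> G" for x
  proof -
    define F where "F h = g (x + pt j h)" for h
    have set_eq: "{..<p} \<times> {..<p} \<times> {..<p} = ({..<p} \<times> {0} \<times> {..<p}) \<union> ({..<p} \<times> {1..<p} \<times> {..<p})"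
      using p_pos by auto
    have "(\<Sum>(a, b, c)\<in>{..<p} \<times> {..<p} \<times> {..<p}. F (u True a + u False b + u True c))
       = (\<Sum>(a, b, c)\<in>{..<p} \<times> {0} \<times> {..<p}. F (u True a + u False b + u True c))
       + (\<Sum>(a, b, c)\<in>{..<p} \<times> {1..<p} \<times> {..<p}. F (u True a + u False b + u True c))"
      unfolding set_eq by (rule sum.union_disjoint) auto
    also have "(\<Sum>(a, b, c)\<in>{..<p} \<times> {1..<p} \<times> {..<p}. F (u True a + u False b + u True c)) = (\<Sum>h\<in>img. F h)"
      unfolding img_def by (subst sum.reindex[OF u_inj]) (simp add: case_prod_unfold o_def)
    also have "(\<Sum>h\<in>img. F h) = (\<Sum>h\<in>H - img. - F h)"
    proof -
      have "(\<Sum>h\<in>H. F h) = 0" using insert.prems(5) x by (simp add: mean_zero_def F_def)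
      then show ?thesis
        using sum.subset_diff[OF img_sub finite_carrier, of F] by (simp add: sum_negf add_eq_0_iff)
    qed
    also have "(\<Sum>(a, b, c)\<in>{..<p} \<times> {0} \<times> {..<p}. F (u True a + u False b + u True c))
      = (\<Sum>(a, c)\<in>{..<p} \<times> {..<p}. F (u True a + u True c))"
      by (simp add: sum.cartesian_product[symmetric] u_0)
    finally show ?thesis by (simp add: Q_alt F_def)
  qed
  have nrm_pt: "B.nrm (\<lambda>x. g (x + pt j h)) = B.nrm g" if "h \<in> H" for h
    using that j by (intro B.nrm_translate pt_mem)
  have Q_nrm: "B.nrm Q \<le> 2 / p * B.nrm g"
  proof -
    have "B.nrm Q = B.nrm (\<lambda>x. (1 / of_nat p ^ 3) * ((\<Sum>ac\<in>{..<p} \<times> {..<p}. g (x + pt j (u True (fst ac) + u True (snd ac))))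
       + (\<Sum>h\<in>H - img. (- 1) * g (x + pt j h))))"
      by (rule B.nrm_cong) (simp add: Q_split case_prod_unfold)
    also have "\<dots> = (1 / real p ^ 3) * B.nrm (\<lambda>x. (\<Sum>ac\<in>{..<p} \<times> {..<p}. g (x + pt j (u True (fst ac) + u True (snd ac))))
       + (\<Sum>h\<in>H - img. (- 1) * g (x + pt j h)))"
      by (subst B.nrm_scale) (simp add: norm_divide norm_power)
    also have "\<dots> \<le> (1 / real p ^ 3) * ((\<Sum>ac\<in>{..<p} \<times> {..<p}. B.nrm g) + (\<Sum>h\<in>H - img. B.nrm g))"
    proof (intro mult_left_mono order_trans[OF B.nrm_add] add_mono)
      show "B.nrm (\<lambda>x. \<Sum>ac\<in>{..<p} \<times> {..<p}. g (x + pt j (u True (fst ac) + u True (snd ac)))) \<le> (\<Sum>ac\<in>{..<p} \<times> {..<p}. B.nrm g)"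
        by (rule order_trans[OF B.nrm_sum]) (auto simp: nrm_pt add_mem u_mem)
      show "B.nrm (\<lambda>x. \<Sum>h\<in>H - img. (- 1) * g (x + pt j h)) \<le> (\<Sum>h\<in>H - img. B.nrm g)"
        by (rule order_trans[OF B.nrm_sum]) (use finite_carrier nrm_pt B.nrm_scale[of "- 1"] in auto)
    qed simp
    also have "\<dots> \<le> (1 / real p ^ 3) * (real p * real p * B.nrm g + real (p\<^sup>2) * B.nrm g)"
      using card_compl by (intro mult_left_mono add_mono) (auto simp: card_cartesian_product intro!: mult_right_mono)
    also have "\<dots> = 2 / p * B.nrm g"
      using p_pos by (simp add: field_simps power2_eq_square power3_eq_cube)
    finally show ?thesis .
  qed
  have Q_ok: "equivariant J1 \<tau> \<psi> Q \<and> mean_zero J2 Q"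
  proof -
    have "equivariant J1 \<tau> \<psi> (P b v) \<and> mean_zero J2 (P b v)" if "equivariant J1 \<tau> \<psi> v" "mean_zero J2 v" for b v
    proof -
      have alt: "P b v = (\<lambda>x. \<Sum>s<p. (1 / of_nat p) * v (x + pt j (u b s)))"
        by (simp add: P_alt sum_divide_distrib)
      show ?thesis unfolding alt
        by (intro conjI mean_zero_sum mean_zero_scale mean_zero_translate equivariant_sum equivariant_scale
            equivariant_translate chi that j u_mem)
    qed
    then show ?thesis unfolding Q_def using insert.prems(4) gJ2 by blast
  qed
  have "B.nrm (B.conv f Q) \<le> K * B.nrm Q"
    unfolding K_def using Q_ok insert.prems by (intro insert.IH[of _ \<tau> \<psi>]) auto
  also have "\<dots> \<le> K * (2 / p * B.nrm g)" by (intro mult_left_mono Q_nrm K0)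
  finally have convQ: "B.nrm (B.conv f Q) \<le> K * (2 / p) * B.nrm g" by simp
  define g1 where "g1 b = (\<lambda>x. g x - P b g x)" for b
  \<comment> \<open>With \<open>A = P True\<close> and \<open>B = P False\<close> this is
    \<open>1 = (1 - A) + A (1 - B) + A B (1 - A) + A B A\<close>. The outer projections commute with
    \<open>conv f\<close> and do not increase the norm.\<close>
  have split: "g x = g1 True x + (P True (g1 False) x + (P True (P False (g1 True)) x + Q x))" for x
  proof -
    have "P False (g1 True) = (\<lambda>x. P False g x - P False (P True g) x)"
      unfolding g1_def by (rule ext, rule P_diff)
    moreover have "P True (g1 False) x = P True g x - P True (P False g) x"
      unfolding g1_def by (rule P_diff)
    ultimately show ?thesis by (simp add: P_diff Q_def g1_def)
  qed
  have "B.nrm (B.conv f g) = B.nrm (\<lambda>x. B.conv f (g1 True) x + (B.conv f (P True (g1 False)) x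
      + (B.conv f (P True (P False (g1 True))) x + B.conv f Q x)))"
    by (subst split[abs_def], rule B.nrm_cong) (simp only: B.conv_add)
  also have "\<dots> \<le> B.nrm (B.conv f (g1 True)) + (B.nrm (B.conv f (P True (g1 False)))
      + (B.nrm (B.conv f (P True (P False (g1 True)))) + B.nrm (B.conv f Q)))"
    by (intro order_trans[OF B.nrm_add] add_left_mono order_refl)
  also have "\<dots> \<le> K / sqrt N * B.nrm g + (K / sqrt N * B.nrm g + (K / sqrt N * B.nrm g + K * (2 / p) * B.nrm g))"
  proof (intro add_mono convQ)
    show "B.nrm (B.conv f (g1 True)) \<le> K / sqrt N * B.nrm g" unfolding g1_def by (rule part)
    show "B.nrm (B.conv f (P True (g1 False))) \<le> K / sqrt N * B.nrm g"
      unfolding P_conv g1_def by (rule order_trans[OF P_nrm part])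
    show "B.nrm (B.conv f (P True (P False (g1 True)))) \<le> K / sqrt N * B.nrm g"
      unfolding P_conv g1_def by (rule order_trans[OF P_nrm order_trans[OF P_nrm part]])
  qed
  also have "\<dots> = K * lam * B.nrm g" by (simp add: lam_def algebra_simps)
  also have "\<dots> = sqrt (card G) * (1 / sqrt N) ^ card J1 * lam ^ card (insert j J2) * B.nrm f * B.nrm g"
    using insert.hyps by (simp add: K_def mult_ac)
  finally show ?case .
qed

corollary nrm_conv_mean_zero:
  assumes "J \<subseteq> E" "mean_zero J g"
  shows "B.nrm (B.conv f g) \<le> sqrt (card G) * lam ^ card J * B.nrm f * B.nrm g"
  using nrm_conv_mixed[of J "{}" "\<lambda>_. True" "\<lambda>_. 0" g f] assms finite_subset[OF assms(1) finite_E]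
  by (simp add: equivariant_def)

end

section \<open>Expansion over the sets of mean-zero coordinates\<close>

lemma sum_Pow_insert:
  assumes "finite D" "d \<notin> D"
  shows "(\<Sum>J\<in>Pow (insert d D). F J) = (\<Sum>J\<in>Pow D. F J) + (\<Sum>J\<in>Pow D. F (insert d J))"
proof -
  have inj: "inj_on (insert d) (Pow D)"
    using assms(2) by (intro inj_onI) (metis Diff_insert_absorb PowD subsetD)
  have "(\<Sum>J\<in>Pow (insert d D). F J) = (\<Sum>J\<in>Pow D. F J) + (\<Sum>J\<in>insert d ` Pow D. F J)"
    unfolding Pow_insert using assms by (intro sum.union_disjoint) auto
  then show ?thesis by (simp add: sum.reindex[OF inj] o_def)
qed

lemma sum_Pow_power_card:
  fixes t :: "'a::comm_semiring_1"
  assumes "finite E"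
  shows "(\<Sum>J\<in>Pow E. t ^ card J) = (1 + t) ^ card E"
  using assms
proof (induction E rule: finite_induct)
  case (insert d E)
  have "(\<Sum>J\<in>Pow E. t ^ card (insert d J)) = t * (\<Sum>J\<in>Pow E. t ^ card J)"
    unfolding sum_distrib_left using insert.hyps
    by (intro sum.cong refl) (subst card_insert_disjoint, auto intro: finite_subset)
  then show ?case using insert by (simp add: sum_Pow_insert algebra_simps)
qed simp

context mixing_box
begin

definition invariant :: "nat set \<Rightarrow> ((nat \<Rightarrow> 'a) \<Rightarrow> complex) \<Rightarrow> bool" where
  "invariant K g \<longleftrightarrow> (\<forall>j\<in>K. \<forall>x\<in>G. \<forall>h\<in>H. g (x + pt j h) = g x)"

definition avg :: "nat set \<Rightarrow> ((nat \<Rightarrow> 'a) \<Rightarrow> 'b::real_normed_field) \<Rightarrow> (nat \<Rightarrow> 'a) \<Rightarrow> 'b" where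
  "avg K g x = (\<Sum>y\<in>hbox K H. g (x + y)) / of_nat (card (hbox K H))"

abbreviation avg1 :: "nat \<Rightarrow> ((nat \<Rightarrow> 'a) \<Rightarrow> 'b::real_normed_field) \<Rightarrow> (nat \<Rightarrow> 'a) \<Rightarrow> 'b" where
  "avg1 j g x \<equiv> (\<Sum>h\<in>H. g (x + pt j h)) / of_nat (card H)"

lemma hbox_empty [simp]: "hbox {} H = {0}"
  by (auto simp: hbox_def fun_eq_iff)

lemma hbox_mono: "K \<subseteq> L \<Longrightarrow> hbox K H \<subseteq> hbox L H"
  by (auto simp: hbox_def zero_mem)

lemma avg_empty [simp]: "avg {} g = g"
  by (simp add: avg_def fun_eq_iff)

lemma sum_hbox_insert:
  assumes "j \<notin> K"
  shows "(\<Sum>y\<in>hbox (insert j K) H. F y) = (\<Sum>y\<in>hbox K H. \<Sum>h\<in>H. F (y + pt j h))"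
proof -
  have eq: "c(j := 0) + (\<lambda>i. if i = j then c j else 0) = c" for c :: "nat \<Rightarrow> 'a"
    by (auto simp: fun_eq_iff)
  show ?thesis
    unfolding sum.cartesian_product
    by (rule sum.reindex_bij_witness[of _ "\<lambda>(y, h). y + pt j h" "\<lambda>c. (c(j := 0), c j)"])
      (use assms in \<open>auto simp: eq hbox_def pt_def fun_eq_iff\<close>)
qed

lemma avg_insert1:
  assumes "finite K" "j \<notin> K"
  shows "avg (insert j K) g x = avg K (avg1 j g) x"
  using assms by (simp add: avg_def sum_hbox_insert card_hbox add.assoc sum_divide_distrib[symmetric])

lemma avg_insert2:
  assumes "finite K" "j \<notin> K"
  shows "avg (insert j K) g x = avg1 j (avg K g) x"
proof -
  have "y + pt j h = pt j h + y" if "y \<in> hbox K H" for y h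
    using that assms(2) by (auto simp: hbox_def pt_def fun_eq_iff)
  then have "(\<Sum>y\<in>hbox K H. \<Sum>h\<in>H. g (x + (y + pt j h))) = (\<Sum>h\<in>H. \<Sum>y\<in>hbox K H. g (x + pt j h + y))"
    by (subst sum.swap) (simp add: add.assoc)
  then show ?thesis
    using assms by (simp add: avg_def sum_hbox_insert card_hbox sum_divide_distrib[symmetric])
qed

lemma avg_diff: "avg K (\<lambda>x. g x - h x) x = avg K g x - avg K h x"
  by (simp add: avg_def sum_subtractf diff_divide_distrib)

lemma nrm_avg1_le:
  assumes "j \<in> E"
  shows "B.nrm (avg1 j g) \<le> B.nrm g"
proof -
  have "B.nrm (avg1 j g) = B.nrm (\<lambda>x. \<Sum>h\<in>H. (1 / of_nat (card H)) * g (x + pt j h))"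
    by (simp add: sum_divide_distrib)
  also have "\<dots> \<le> (\<Sum>h\<in>H. B.nrm (\<lambda>x. (1 / of_nat (card H)) * g (x + pt j h)))"
    by (rule B.nrm_sum[OF finite_carrier])
  also have "\<dots> = (\<Sum>h\<in>H. B.nrm g / real (card H))"
    unfolding B.nrm_scale using assms
    by (intro sum.cong refl) (simp add: B.nrm_translate pt_mem norm_divide)
  finally show ?thesis using card_H_pos by simp
qed

lemma invariant_hbox:
  assumes "finite K" "invariant K g" "K \<subseteq> E" "x \<in> G" "y \<in> hbox K H"
  shows "g (x + y) = g x"
  using assms
proof (induction K arbitrary: y rule: finite_induct)
  case (insert j K)
  have y: "y = y(j := 0) + pt j (y j)" by (auto simp: pt_def fun_eq_iff)
  have mem: "y(j := 0) \<in> hbox K H" "y j \<in> H"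
    using insert.prems(4) insert.hyps by (auto simp: hbox_def)
  have "y(j := 0) \<in> G" using mem(1) hbox_mono[of K E] insert.prems(2) by auto
  then have "g (x + y) = g (x + y(j := 0))"
    using insert.prems mem(2) by (subst y, subst add.assoc[symmetric]) (simp add: invariant_def B.add_mem)
  also have "\<dots> = g x"
    using insert.prems by (intro insert.IH mem(1)) (auto simp: invariant_def)
  finally show ?case .
qed simp

text \<open>Normality of \<open>hbox K H\<close>: it allows a right translation of the argument of
  \<open>f\<close> to be moved through \<open>- y + x\<close> and absorbed by the invariance of
  \<open>g\<close>.\<close>

lemma hbox_conj:
  assumes "x \<in> G" "y \<in> hbox K H" "K \<subseteq> E"
  shows "- x + y + x \<in> hbox K H"
  using assms by (auto simp: hbox_def intro!: add_mem uminus_mem)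

text \<open>If \<open>g\<close> does not depend on the coordinates in \<open>K\<close>, the
  convolution neither sees them in \<open>f\<close> nor depends on them. Hence the error terms
  involve only averages of \<open>f\<close> and \<open>h\<close>, which spreadness controls, and
  never their pointwise size.\<close>

lemma inner_conv_invariant:
  assumes K: "K \<subseteq> E" and inv: "invariant K g"
  shows "(\<Sum>x\<in>G. B.conv f g x * h x) = (\<Sum>x\<in>G. B.conv (avg K f) g x * avg K h x)"
proof -
  have finK: "finite K" using K finite_E finite_subset by blast
  have KG: "hbox K H \<subseteq> G" using hbox_mono[OF K] .
  interpret K: finite_add_subgroup "hbox K H" by (rule box_subgroup[OF finK])
  have cK: "of_nat (card (hbox K H)) \<noteq> (0::complex)"
    using K.finite_carrier K.zero_mem by auto
  have cong1: "B.conv f g (x + k) = B.conv f g x" if "x \<in> G" "k \<in> hbox K H" for x k f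
    unfolding B.conv_def add.assoc[symmetric]
    by (intro sum.cong refl arg_cong2[of _ _ _ _ "(*)"] invariant_hbox[OF finK inv K] B.add_mem B.uminus_mem that)
  have "(\<Sum>x\<in>G. B.conv f g x * h x) = (\<Sum>x\<in>G. B.conv f g x * h (x + k))" if k: "k \<in> hbox K H" for k h f
    using B.sum_translate_right[of k "\<lambda>x. B.conv f g x * h x"] k KG cong1 by (auto simp: subset_iff)
  note shift = this
  have right: "(\<Sum>x\<in>G. B.conv f g x * h x) = (\<Sum>x\<in>G. B.conv f g x * avg K h x)" for h f
  proof -
    have "(\<Sum>k\<in>hbox K H. \<Sum>x\<in>G. B.conv f g x * h x) = (\<Sum>k\<in>hbox K H. \<Sum>x\<in>G. B.conv f g x * h (x + k))"
      by (rule sum.cong[OF refl]) (rule shift)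
    also have "\<dots> = (\<Sum>x\<in>G. B.conv f g x * (\<Sum>k\<in>hbox K H. h (x + k)))"
      by (subst sum.swap) (simp add: sum_distrib_left)
    finally show ?thesis
      using cK by (simp add: avg_def sum_divide_distrib[symmetric] field_simps)
  qed
  have left: "B.conv f g x = B.conv (avg K f) g x" if x: "x \<in> G" for x
  proof -
    have "B.conv f g x = (\<Sum>y\<in>G. f (y + k) * g (- y + x))" if k: "k \<in> hbox K H" for k
    proof -
      have "B.conv f g x = (\<Sum>y\<in>G. f (y + k) * g (- (y + k) + x))"
        unfolding B.conv_def
        using B.sum_translate_right[of k "\<lambda>y. f y * g (- y + x)"] k KG by auto
      also have "\<dots> = (\<Sum>y\<in>G. f (y + k) * g (- y + x))"
      proof (intro sum.cong refl arg_cong2[of _ _ _ _ "(*)"])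
        fix y assume y: "y \<in> G"
        define z where "z = - y + x"
        have z: "z \<in> G" using x y by (simp add: z_def B.add_mem B.uminus_mem)
        have "- (y + k) + x = z + (- z + (- k) + z)"
        proof -
          have "- (y + k) + x = - k + z" by (simp only: z_def minus_add add.assoc)
          also have "\<dots> = z + (- z + (- k) + z)" by (metis add.assoc add.left_neutral add.right_inverse)
          finally show ?thesis .
        qed
        then show "g (- (y + k) + x) = g z"
          using invariant_hbox[OF finK inv K z hbox_conj[OF z K.uminus_mem[OF k] K]] by simp
      qed
      finally show ?thesis .
    qed
    then have "(\<Sum>k\<in>hbox K H. B.conv f g x) = (\<Sum>k\<in>hbox K H. \<Sum>y\<in>G. f (y + k) * g (- y + x))"
      by (intro sum.cong) auto
    also have "\<dots> = (\<Sum>y\<in>G. (\<Sum>k\<in>hbox K H. f (y + k)) * g (- y + x))"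
      by (subst sum.swap) (simp add: sum_distrib_right)
    finally show ?thesis
      unfolding B.conv_def[of "avg K f"] using cK
      by (simp add: avg_def sum_divide_distrib[symmetric] field_simps)
  qed
  show ?thesis
    unfolding right[of f h] by (intro sum.cong refl) (simp add: left)
qed

lemma mean_zero_sub_avg1:
  assumes "j \<in> E"
  shows "mean_zero {j} (\<lambda>x. g x - avg1 j g x)"
  unfolding mean_zero_def
proof (intro ballI, simp)
  fix x assume x: "x \<in> G"
  have "avg1 j g (x + pt j h) = avg1 j g x" if h: "h \<in> H" for h
    using sum_translate_left[OF h, of "\<lambda>h. g (x + pt j h)"] by (simp add: pt_add add.assoc)
  then show "(\<Sum>h\<in>H. g (x + pt j h) - avg1 j g (x + pt j h)) = 0"
    using card_H_pos by (simp add: sum_subtractf)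
qed

lemma mean_zero_diff: "mean_zero J g \<Longrightarrow> mean_zero J h \<Longrightarrow> mean_zero J (\<lambda>x. g x - h x)"
  by (simp add: mean_zero_def sum_subtractf)

lemma mean_zero_avg1:
  assumes "mean_zero J g" "j \<notin> J" "j \<in> E"
  shows "mean_zero J (avg1 j g)"
  using mean_zero_scale[OF mean_zero_sum[OF mean_zero_translate[OF assms]], of H "\<lambda>h. h" "1 / of_nat (card H)"]
  by (simp add: mean_zero_def)

lemma invariant_avg1:
  assumes g: "invariant K g" and j: "j \<in> E" "j \<notin> K" and K: "K \<subseteq> E"
  shows "invariant (insert j K) (avg1 j g)"
  unfolding invariant_def
proof (intro ballI)
  fix i x h assume i: "i \<in> insert j K" and x: "x \<in> G" and h: "h \<in> H"
  show "avg1 j g (x + pt i h) = avg1 j g x"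
  proof (cases "i = j")
    case True
    then show ?thesis
      using sum_translate_left[OF h, of "\<lambda>h. g (x + pt j h)"] by (simp add: pt_add add.assoc)
  next
    case False
    then have iK: "i \<in> K" using i by simp
    have "g (x + pt i h + pt j h') = g (x + pt j h')" if h': "h' \<in> H" for h'
    proof -
      have "x + pt i h + pt j h' = x + pt j h' + pt i h"
        using pt_commute[OF False, of h h'] by (metis add.assoc)
      then show ?thesis
        using g iK x h h' j by (simp add: invariant_def B.add_mem pt_mem)
    qed
    then show ?thesis by simp
  qed
qed

text \<open>\<open>D\<close> holds the coordinates not yet treated. Splitting \<open>g\<close> into
  \<open>avg1 d g\<close> and the rest sends \<open>d\<close> to \<open>K0\<close>, where
  \<open>g\<close> is invariant, or to \<open>J0\<close>, where it has mean zero. The branch that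
  never uses the rest is the main term and is kept exactly. Each rest has at most twice the norm,
  whence \<open>2 * lam\<close>.\<close>

lemma inner_conv_decomposition:
  assumes "finite D" "D \<union> J0 \<union> K0 = E" "D \<inter> J0 = {}" "D \<inter> K0 = {}" "J0 \<inter> K0 = {}"
    "mean_zero J0 g" "invariant K0 g"
  shows "cmod ((\<Sum>x\<in>G. B.conv f g x * h x) - (if J0 = {} then \<Sum>x\<in>G. B.conv f (avg D g) x * h x else 0))
    \<le> (\<Sum>J\<in>Pow D. if J = {} \<and> J0 = {} then 0 else
        sqrt (card G) * (2 * lam) ^ card J * lam ^ card J0 *
        B.nrm (avg (K0 \<union> (D - J)) f) * B.nrm (avg (D - J) g) * B.nrm (avg (K0 \<union> (D - J)) h))"
  using assms
proof (induction D arbitrary: J0 K0 g rule: finite_induct)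
  case empty
  show ?case
  proof (cases "J0 = {}")
    case False
    have "(\<Sum>x\<in>G. B.conv f g x * h x) = (\<Sum>x\<in>G. B.conv (avg K0 f) g x * avg K0 h x)"
      using empty by (intro inner_conv_invariant) auto
    then have "cmod (\<Sum>x\<in>G. B.conv f g x * h x) \<le> B.nrm (B.conv (avg K0 f) g) * B.nrm (avg K0 h)"
      using B.cmod_inner_le by metis
    also have "\<dots> \<le> (sqrt (card G) * lam ^ card J0 * B.nrm (avg K0 f) * B.nrm g) * B.nrm (avg K0 h)"
      using empty by (intro mult_right_mono nrm_conv_mean_zero) auto
    finally show ?thesis using False by simp
  qed simp
next
  case (insert d D)
  define T where "T = (\<lambda>(J0 :: nat set) K0 D g J. sqrt (card G) * (2 * lam) ^ card J * lam ^ card J0 *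
        B.nrm (avg (K0 \<union> (D - J)) f) * B.nrm (avg (D - J) g) * B.nrm (avg (K0 \<union> (D - J)) h))"
  define I where "I g = (\<Sum>x\<in>G. B.conv f g x * h x)" for g
  have d: "d \<in> E" "d \<notin> J0" "d \<notin> K0" using insert.prems by auto
  have J0: "J0 \<subseteq> E" "finite J0" using insert.prems(1) finite_E finite_subset[of J0 E] by auto
  define g1 where "g1 = avg1 d g"
  define g2 where "g2 = (\<lambda>x. g x - avg1 d g x)"
  have "I (\<lambda>x. g1 x + g2 x) = I g1 + I g2"
    by (simp only: I_def B.conv_add distrib_right sum.distrib)
  then have I_split: "I g = I g1 + I g2" by (simp add: g1_def g2_def)
  have avg_g1: "avg D g1 = avg (insert d D) g"
    using insert.hyps by (simp add: avg_insert1 fun_eq_iff g1_def)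
  have IH1: "cmod (I g1 - (if J0 = {} then I (avg D g1) else 0))
     \<le> (\<Sum>J\<in>Pow D. if J = {} \<and> J0 = {} then 0 else T J0 (insert d K0) D g1 J)"
    unfolding I_def T_def
  proof (rule insert.IH)
    show "mean_zero J0 g1" unfolding g1_def by (rule mean_zero_avg1) (use insert.prems d in auto)
    show "invariant (insert d K0) g1" unfolding g1_def by (rule invariant_avg1) (use insert.prems d in auto)
  qed (use insert.prems insert.hyps in auto)
  have IH2: "cmod (I g2) \<le> (\<Sum>J\<in>Pow D. T (insert d J0) K0 D g2 J)"
  proof -
    have "cmod (I g2 - (if insert d J0 = {} then I (avg D g2) else 0))
     \<le> (\<Sum>J\<in>Pow D. if J = {} \<and> insert d J0 = {} then 0 else T (insert d J0) K0 D g2 J)"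
      unfolding I_def T_def
    proof (rule insert.IH)
      have "mean_zero J0 g2"
        unfolding g2_def by (intro mean_zero_diff insert.prems(5) mean_zero_avg1 d)
      moreover have "mean_zero {d} g2" unfolding g2_def by (rule mean_zero_sub_avg1[OF d(1)])
      ultimately show "mean_zero (insert d J0) g2" by (auto simp: mean_zero_def)
      have "invariant (insert d K0) (avg1 d g)" by (rule invariant_avg1) (use insert.prems d in auto)
      then show "invariant K0 g2" using insert.prems(6) by (auto simp: invariant_def g2_def)
    qed (use insert.prems insert.hyps in auto)
    then show ?thesis by simp
  qed
  have T1: "T J0 (insert d K0) D g1 J = T J0 K0 (insert d D) g J" if J: "J \<subseteq> D" for J
  proof -
    have "insert d D - J = insert d (D - J)" "insert d K0 \<union> (D - J) = K0 \<union> insert d (D - J)"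
      using J insert.hyps by auto
    moreover have "avg (D - J) g1 = avg (insert d (D - J)) g"
      using insert.hyps by (simp add: avg_insert1 fun_eq_iff g1_def)
    ultimately show ?thesis by (simp add: T_def)
  qed
  have T2: "T (insert d J0) K0 D g2 J \<le> T J0 K0 (insert d D) g (insert d J)" if J: "J \<subseteq> D" for J
  proof -
    have eq: "insert d D - insert d J = D - J" using insert.hyps by auto
    have "B.nrm (avg (D - J) g2) = B.nrm (\<lambda>x. avg (D - J) g x + (- 1) * avg1 d (avg (D - J) g) x)"
    proof (rule B.nrm_cong)
      fix x
      have "avg (D - J) g2 x = avg (D - J) g x - avg (D - J) (avg1 d g) x"
        unfolding g2_def by (rule avg_diff)
      also have "avg (D - J) (avg1 d g) x = avg1 d (avg (D - J) g) x"
        using insert.hyps avg_insert1[of "D - J" d g x] avg_insert2[of "D - J" d g x] by simp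
      finally show "avg (D - J) g2 x = avg (D - J) g x + (- 1) * avg1 d (avg (D - J) g) x" by simp
    qed
    also have "\<dots> \<le> B.nrm (avg (D - J) g) + B.nrm (\<lambda>x. (- 1) * avg1 d (avg (D - J) g) x)"
      by (rule B.nrm_add)
    also have "B.nrm (\<lambda>x. (- 1) * avg1 d (avg (D - J) g) x) = B.nrm (avg1 d (avg (D - J) g))"
      by (subst B.nrm_scale) simp
    also have "\<dots> \<le> B.nrm (avg (D - J) g)" by (rule nrm_avg1_le[OF d(1)])
    finally have n: "B.nrm (avg (D - J) g2) \<le> 2 * B.nrm (avg (D - J) g)" by simp
    have c1: "card (insert d J) = Suc (card J)"
      using J insert.hyps finite_subset by (subst card_insert_disjoint) auto
    have c2: "card (insert d J0) = Suc (card J0)" using J0 d by simp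
    have "T (insert d J0) K0 D g2 J = (sqrt (card G) * (2 * lam) ^ card J * lam ^ card (insert d J0) *
        B.nrm (avg (K0 \<union> (D - J)) f) * B.nrm (avg (K0 \<union> (D - J)) h)) * B.nrm (avg (D - J) g2)"
      by (simp add: T_def mult_ac)
    also have "\<dots> \<le> (sqrt (card G) * (2 * lam) ^ card J * lam ^ card (insert d J0) *
        B.nrm (avg (K0 \<union> (D - J)) f) * B.nrm (avg (K0 \<union> (D - J)) h)) * (2 * B.nrm (avg (D - J) g))"
      by (intro mult_left_mono n mult_nonneg_nonneg) (auto simp: lam_nonneg)
    also have "\<dots> = T J0 K0 (insert d D) g (insert d J)"
      by (simp add: T_def eq c1 c2 mult_ac)
    finally show ?thesis .
  qed
  have "cmod (I g - (if J0 = {} then I (avg (insert d D) g) else 0))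
     \<le> cmod (I g1 - (if J0 = {} then I (avg D g1) else 0)) + cmod (I g2)"
    unfolding I_split avg_g1 by (rule order_trans[OF _ norm_triangle_ineq]) (simp add: algebra_simps)
  also have "\<dots> \<le> (\<Sum>J\<in>Pow D. if J = {} \<and> J0 = {} then 0 else T J0 K0 (insert d D) g J)
      + (\<Sum>J\<in>Pow D. T J0 K0 (insert d D) g (insert d J))"
    by (intro add_mono order_trans[OF IH1] order_trans[OF IH2] sum_mono) (auto simp: T1 T2)
  also have "\<dots> = (\<Sum>J\<in>Pow (insert d D). if J = {} \<and> J0 = {} then 0 else T J0 K0 (insert d D) g J)"
    using insert.hyps by (simp add: sum_Pow_insert)
  finally show ?case by (simp only: I_def T_def)
qed

lemma avg_of_real: "avg K (\<lambda>x. of_real (f x)) x = (of_real (avg K f x) :: complex)"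
  by (simp add: avg_def)

lemma sum_avg:
  assumes "K \<subseteq> E"
  shows "(\<Sum>x\<in>G. avg K f x) = (\<Sum>x\<in>G. f x)"
proof -
  have sub: "hbox K H \<subseteq> G" by (rule hbox_mono[OF assms])
  have fin: "finite (hbox K H)" using sub B.finite_carrier finite_subset by blast
  have ne: "card (hbox K H) \<noteq> 0"
    using fin zero_mem by (auto simp: hbox_def intro!: exI[of _ "\<lambda>_. 0"])
  have "(\<Sum>x\<in>G. avg K f x) = (\<Sum>y\<in>hbox K H. \<Sum>x\<in>G. f (x + y)) / of_nat (card (hbox K H))"
    unfolding avg_def sum_divide_distrib[symmetric] by (subst sum.swap) simp
  also have "\<dots> = (\<Sum>y\<in>hbox K H. \<Sum>x\<in>G. f x) / of_nat (card (hbox K H))"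
    using sub by (intro arg_cong2[of _ _ _ _ "(/)"] sum.cong refl B.sum_translate_right) auto
  finally show ?thesis using ne by simp
qed

text \<open>The squared norm is at most the supremum times the sum, and averaging preserves the sum.
  A supremum of \<open>k\<close> times the mean therefore costs only \<open>sqrt k\<close>.\<close>

lemma nrm_avg_le:
  fixes f :: "(nat \<Rightarrow> 'a) \<Rightarrow> real"
  assumes K: "K \<subseteq> E" and nonneg: "\<And>x. f x \<ge> 0" and k: "k \<ge> 0"
    and le: "\<And>x. x \<in> G \<Longrightarrow> avg K f x \<le> k * ((\<Sum>x\<in>G. f x) / card G)"
  shows "B.nrm (avg K (\<lambda>x. of_real (f x))) \<le> sqrt (card G) * sqrt k * ((\<Sum>x\<in>G. f x) / card G)"
proof (rule power2_le_imp_le)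
  define m where "m = (\<Sum>x\<in>G. f x) / card G"
  have m0: "m \<ge> 0" using nonneg by (simp add: m_def sum_nonneg)
  have cG: "card G > 0" using B.finite_carrier B.zero_mem card_gt_0_iff by blast
  have avg0: "avg K f x \<ge> 0" for x using nonneg by (simp add: avg_def sum_nonneg)
  have "(B.nrm (avg K (\<lambda>x. of_real (f x))))\<^sup>2 = (\<Sum>x\<in>G. avg K f x * avg K f x)"
    by (subst B.nrm_sq) (simp add: avg_of_real power2_eq_square)
  also have "\<dots> \<le> (\<Sum>x\<in>G. (k * m) * avg K f x)"
    using le avg0 by (intro sum_mono mult_right_mono) (auto simp: m_def)
  also have "\<dots> = k * m * (\<Sum>x\<in>G. f x)"
    by (simp add: sum_distrib_left[symmetric] sum_avg[OF K])
  also have "\<dots> = (sqrt (card G) * sqrt k * m)\<^sup>2"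
  proof -
    have "(\<Sum>x\<in>G. f x) = m * card G" using cG by (simp add: m_def)
    moreover have "(sqrt (card G) * sqrt k * m)\<^sup>2 = card G * k * m\<^sup>2"
      using k by (simp add: power_mult_distrib)
    ultimately show ?thesis by (simp only: power2_eq_square mult_ac)
  qed
  finally show "(B.nrm (avg K (\<lambda>x. of_real (f x))))\<^sup>2 \<le> (sqrt (card G) * sqrt k * ((\<Sum>x\<in>G. f x) / card G))\<^sup>2"
    by (simp add: m_def)
qed (use nonneg k in \<open>simp add: sum_nonneg\<close>)

text \<open>\<open>\<tau>\<close> combines the mixing gain with the spread factors of the three
  functions, per coordinate. Summing \<open>\<tau> ^ card J\<close> over the nonempty
  \<open>J\<close> gives \<open>(1 + \<tau>) ^ card E - 1\<close> as the relative error.\<close>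

theorem trilinear_lower_bound:
  fixes f g h :: "(nat \<Rightarrow> 'a) \<Rightarrow> real" and kf kg kh :: "nat \<Rightarrow> real"
  defines "fb \<equiv> (\<Sum>x\<in>G. f x) / card G" and "gb \<equiv> (\<Sum>x\<in>G. g x) / card G"
    and "hb \<equiv> (\<Sum>x\<in>G. h x) / card G"
  assumes nonneg: "\<And>x. f x \<ge> 0" "\<And>x. g x \<ge> 0" "\<And>x. h x \<ge> 0"
    and k0: "\<And>i. kf i \<ge> 0" "\<And>i. kg i \<ge> 0" "\<And>i. kh i \<ge> 0"
    and f: "\<And>J x. J \<subseteq> E \<Longrightarrow> J \<noteq> {} \<Longrightarrow> x \<in> G \<Longrightarrow> avg (E - J) f x \<le> kf (card J) * fb"
    and g: "\<And>J x. J \<subseteq> E \<Longrightarrow> J \<noteq> {} \<Longrightarrow> x \<in> G \<Longrightarrow> avg (E - J) g x \<le> kg (card J) * gb"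
    and h: "\<And>J x. J \<subseteq> E \<Longrightarrow> J \<noteq> {} \<Longrightarrow> x \<in> G \<Longrightarrow> avg (E - J) h x \<le> kh (card J) * hb"
    and \<tau>: "\<And>i. i > 0 \<Longrightarrow> (2 * lam) ^ i * (sqrt (kf i) * sqrt (kg i) * sqrt (kh i)) \<le> \<tau> ^ i"
  shows "(\<Sum>x\<in>G. \<Sum>y\<in>G. f y * g (- y + x) * h x)
    \<ge> (real (card G))\<^sup>2 * fb * gb * hb * (2 - (1 + \<tau>) ^ card E)"
proof -
  define F where "F = (\<lambda>x. complex_of_real (f x))"
  define Gc where "Gc = (\<lambda>x. complex_of_real (g x))"
  define Hc where "Hc = (\<lambda>x. complex_of_real (h x))"
  define M where "M = (real (card G))\<^sup>2 * fb * gb * hb"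
  have cG: "card G > 0" using B.finite_carrier B.zero_mem card_gt_0_iff by blast
  have mean0: "fb \<ge> 0" "gb \<ge> 0" "hb \<ge> 0"
    using nonneg by (simp_all add: fb_def gb_def hb_def sum_nonneg)
  have I: "(\<Sum>x\<in>G. B.conv F Gc x * Hc x) = of_real (\<Sum>x\<in>G. \<Sum>y\<in>G. f y * g (- y + x) * h x)"
    by (simp add: B.conv_def F_def Gc_def Hc_def sum_distrib_right)
  have main: "(\<Sum>x\<in>G. B.conv F (avg E Gc) x * Hc x) = of_real M"
  proof -
    have avgE: "avg E Gc x = of_real gb" if "x \<in> G" for x
      unfolding avg_def Gc_def gb_def
      using B.sum_translate_left[OF that, of "\<lambda>y. complex_of_real (g y)"] by simp
    have "(\<Sum>x\<in>G. B.conv F (avg E Gc) x * Hc x) = (\<Sum>x\<in>G. (\<Sum>y\<in>G. F y * of_real gb) * Hc x)"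
      unfolding B.conv_def by (intro sum.cong refl arg_cong2[of _ _ _ _ "(*)"] avgE B.add_mem B.uminus_mem)
    also have "\<dots> = (\<Sum>y\<in>G. F y) * of_real gb * (\<Sum>x\<in>G. Hc x)"
      by (simp add: sum_distrib_left[symmetric] sum_distrib_right[symmetric])
    also have "\<dots> = of_real M"
      using cG by (simp add: M_def F_def Hc_def fb_def hb_def power2_eq_square)
    finally show ?thesis .
  qed
  have "cmod ((\<Sum>x\<in>G. B.conv F Gc x * Hc x) - (if ({} :: nat set) = {} then \<Sum>x\<in>G. B.conv F (avg E Gc) x * Hc x else 0))
    \<le> (\<Sum>J\<in>Pow E. if J = {} \<and> ({} :: nat set) = {} then 0 else
        sqrt (card G) * (2 * lam) ^ card J * lam ^ card ({} :: nat set) *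
        B.nrm (avg ({} \<union> (E - J)) F) * B.nrm (avg (E - J) Gc) * B.nrm (avg ({} \<union> (E - J)) Hc))"
    by (rule inner_conv_decomposition) (auto simp: finite_E mean_zero_def invariant_def)
  also have "\<dots> \<le> (\<Sum>J\<in>Pow E. (if J = {} then 0 else M * \<tau> ^ card J))"
  proof (rule sum_mono)
    fix J assume J: "J \<in> Pow E"
    show "(if J = {} \<and> ({} :: nat set) = {} then 0 else
        sqrt (card G) * (2 * lam) ^ card J * lam ^ card ({} :: nat set) *
        B.nrm (avg ({} \<union> (E - J)) F) * B.nrm (avg (E - J) Gc) * B.nrm (avg ({} \<union> (E - J)) Hc))
      \<le> (if J = {} then 0 else M * \<tau> ^ card J)"
    proof (cases "J = {}")
      case False
      have cJ: "card J > 0" using False J finite_E finite_subset card_gt_0_iff by blast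
      have "B.nrm (avg (E - J) F) * B.nrm (avg (E - J) Gc) * B.nrm (avg (E - J) Hc) \<le>
         (sqrt (card G) * sqrt (kf (card J)) * fb) * (sqrt (card G) * sqrt (kg (card J)) * gb)
          * (sqrt (card G) * sqrt (kh (card J)) * hb)"
        unfolding F_def Gc_def Hc_def fb_def gb_def hb_def
        by (intro mult_mono nrm_avg_le mult_nonneg_nonneg)
          (use J False nonneg k0 f g h in \<open>auto simp: fb_def gb_def hb_def sum_nonneg\<close>)
      then have "sqrt (card G) * (2 * lam) ^ card J *
         (B.nrm (avg (E - J) F) * B.nrm (avg (E - J) Gc) * B.nrm (avg (E - J) Hc)) \<le>
         sqrt (card G) * (2 * lam) ^ card J *
         ((sqrt (card G) * sqrt (kf (card J)) * fb) * (sqrt (card G) * sqrt (kg (card J)) * gb)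
          * (sqrt (card G) * sqrt (kh (card J)) * hb))"
        by (intro mult_left_mono) (auto simp: lam_nonneg)
      also have "\<dots> = M * ((2 * lam) ^ card J * (sqrt (kf (card J)) * sqrt (kg (card J)) * sqrt (kh (card J))))"
        by (simp add: M_def power2_eq_square algebra_simps)
      also have "\<dots> \<le> M * \<tau> ^ card J"
        using \<tau>[OF cJ] mean0 by (intro mult_left_mono) (auto simp: M_def)
      finally show ?thesis using False by (simp add: mult_ac)
    qed simp
  qed
  also have "\<dots> = (\<Sum>J\<in>Pow E. M * \<tau> ^ card J) - M"
  proof -
    have "(\<Sum>J\<in>Pow E. M * \<tau> ^ card J) = M + (\<Sum>J\<in>Pow E - {{}}. M * \<tau> ^ card J)"
      using finite_E by (subst sum.remove[of _ "{}"]) auto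
    moreover have "(\<Sum>J\<in>Pow E. (if J = {} then 0 else M * \<tau> ^ card J)) = (\<Sum>J\<in>Pow E - {{}}. M * \<tau> ^ card J)"
      using finite_E by (subst sum.remove[of _ "{}"]) auto
    ultimately show ?thesis by simp
  qed
  also have "\<dots> = M * ((1 + \<tau>) ^ card E - 1)"
    by (simp add: sum_distrib_left[symmetric] sum_Pow_power_card finite_E algebra_simps)
  finally have "cmod (of_real ((\<Sum>x\<in>G. \<Sum>y\<in>G. f y * g (- y + x) * h x) - M)) \<le> M * ((1 + \<tau>) ^ card E - 1)"
    unfolding I main by simp
  then have "\<bar>(\<Sum>x\<in>G. \<Sum>y\<in>G. f y * g (- y + x) * h x) - M\<bar> \<le> M * ((1 + \<tau>) ^ card E - 1)"
    by (simp only: norm_of_real)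
  then show ?thesis by (simp add: M_def abs_le_iff algebra_simps)
qed

end

lemma card_le_image_plus1:
  assumes "finite F" "A \<subseteq> insert a (f ` F)"
  shows "card A \<le> card F + 1"
proof -
  have "card A \<le> card (insert a (f ` F))" using assms by (intro card_mono) auto
  also have "\<dots> \<le> card (f ` F) + 1" using assms(1) by (simp add: card_insert_if)
  also have "\<dots> \<le> card F + 1" using assms(1) by (simp add: card_image_le)
  finally show ?thesis .
qed

section \<open>Tuples and their spread fibres\<close>

text \<open>\<open>{..<11 * b}\<close> is divided into \<open>b\<close> consecutive blocks of length 11. Blocks that meet \<open>I\<close> are
  discarded, so that every maximal run of the remaining set \<open>V\<close> has length at least 11.\<close>

locale superblocks =
  fixes b :: nat and I :: "nat set"
  assumes I_sub: "I \<subseteq> {..<11 * b}"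
begin

definition F where "F = {i. i < 11 * b \<and> (\<exists>j\<in>I. j div 11 = i div 11)}"
definition V where "V = {..<11 * b} - F"
definition St where "St = {i \<in> V. i = 0 \<or> i - 1 \<notin> V}"
definition En where "En = {i \<in> V. Suc i \<notin> V}"
text \<open>The pairs of neighbours inside a run. \<open>E\<close> is the common index set of the
  convolution: \<open>i\<close> stands for coordinate \<open>Suc i\<close> of the tuple
  \<open>k + v\<close>, for coordinate \<open>i\<close> of the shifted tuple, and for the sum of
  coordinates \<open>Suc i\<close> and \<open>i\<close> of \<open>k\<close>.\<close>

definition E where "E = {i \<in> V. Suc i \<in> V}"

lemma finite_sets [simp]: "finite I" "finite F" "finite V" "finite St" "finite En" "finite E"
proof -
  show "finite I" using I_sub finite_subset by blast
  show F: "finite F" by (rule finite_subset[of _ "{..<11 * b}"]) (auto simp: F_def)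
  show V: "finite V" by (simp add: V_def)
  show "finite St" "finite En" "finite E" using V by (simp_all add: St_def En_def E_def)
qed

lemma subs: "F \<subseteq> {..<11 * b}" "V \<subseteq> {..<11 * b}" "St \<subseteq> V" "En \<subseteq> V" "E \<subseteq> V"
  by (auto simp: F_def V_def St_def En_def E_def)

lemma I_sub_F: "I \<subseteq> F"
  using I_sub by (auto simp: F_def)

lemma card_F: "card F \<le> 11 * card I"
proof -
  have "F \<subseteq> (\<Union>q\<in>(\<lambda>j. j div 11) ` I. {11 * q..<11 * q + 11})"
  proof
    fix i assume "i \<in> F"
    then obtain j where "j \<in> I" "j div 11 = i div 11" by (auto simp: F_def)
    moreover have "i \<in> {11 * (i div 11)..<11 * (i div 11) + 11}"
      using mult_div_mod_eq[of 11 i] mod_less_divisor[of 11 i] by simp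
    ultimately show "i \<in> (\<Union>q\<in>(\<lambda>j. j div 11) ` I. {11 * q..<11 * q + 11})"
      by (intro UN_I[of "i div 11"]) (auto intro: image_eqI[of _ _ j])
  qed
  then have "card F \<le> card (\<Union>q\<in>(\<lambda>j. j div 11) ` I. {11 * q..<11 * q + 11})"
    by (intro card_mono) auto
  also have "\<dots> \<le> (\<Sum>q\<in>(\<lambda>j. j div 11) ` I. card {11 * q..<11 * q + 11})"
    by (rule card_UN_le) simp
  also have "\<dots> = 11 * card ((\<lambda>j. j div 11) ` I)" by simp
  also have "\<dots> \<le> 11 * card I" using card_image_le[of I] by simp
  finally show ?thesis .
qed

lemma card_St: "card St \<le> card F + 1"
proof (rule card_le_image_plus1)
  show "St \<subseteq> insert 0 (Suc ` F)"
  proof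
    fix i assume i: "i \<in> St"
    show "i \<in> insert 0 (Suc ` F)"
    proof (cases i)
      case (Suc j)
      then have "j \<in> F" using i by (auto simp: St_def V_def)
      then show ?thesis using Suc by auto
    qed simp
  qed
qed simp

lemma card_En: "card En \<le> card F + 1"
proof (rule card_le_image_plus1)
  show "En \<subseteq> insert (11 * b - 1) ((\<lambda>i. i - 1) ` F)"
  proof
    fix i assume i: "i \<in> En"
    then have iV: "i < 11 * b" "i \<notin> F" by (auto simp: En_def V_def)
    show "i \<in> insert (11 * b - 1) ((\<lambda>i. i - 1) ` F)"
    proof (cases "Suc i < 11 * b")
      case True
      then have "Suc i \<in> F" using i by (auto simp: En_def V_def)
      then show ?thesis by (intro insertI2 image_eqI[of _ _ "Suc i"]) auto
    qed (use iV in auto)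
  qed
qed simp

lemma card_V: "card V = 11 * b - card F"
  using subs(1) by (simp add: V_def card_Diff_subset)

lemma V_En_E: "V - En = E" "V - E = En" and V_St_E: "V - St = Suc ` E"
proof -
  show "V - En = E" by (auto simp: En_def E_def)
  show "V - E = En" by (auto simp: En_def E_def)
  show "V - St = Suc ` E"
  proof (rule equalityI; rule subsetI)
    fix i assume i: "i \<in> V - St"
    then obtain j where "i = Suc j" by (cases i) (auto simp: St_def)
    then show "i \<in> Suc ` E" using i by (auto simp: St_def E_def)
  qed (auto simp: St_def E_def)
qed

lemma card_E: "card E = card V - card En"
  using V_En_E subs by (metis card_Diff_subset finite_sets(5))

lemma V_same_block:
  assumes "i \<in> V" "j < 11 * b" "i div 11 = j div 11"
  shows "j \<in> V"
  using assms by (auto simp: V_def F_def)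

lemma V_Suc:
  assumes "i \<in> V" "i mod 11 < 10"
  shows "Suc i \<in> V"
proof (rule V_same_block[OF assms(1)])
  show eq: "i div 11 = Suc i div 11" using assms(2) by (simp add: div_Suc mod_Suc)
  have "i div 11 < b" using assms(1) by (auto simp: V_def less_mult_imp_div_less mult.commute)
  then show "Suc i < 11 * b" using eq by (metis div_less_iff_less_mult mult.commute zero_less_numeral)
qed

lemma V_pred:
  assumes "Suc i \<in> V" "Suc i mod 11 > 0"
  shows "i \<in> V"
proof (rule V_same_block[OF assms(1)])
  show "Suc i div 11 = i div 11" using assms(2) by (simp add: div_Suc)
  show "i < 11 * b" using assms(1) by (auto simp: V_def)
qed

text \<open>The coordinate to be computed from the equation at \<open>i\<close>. Within a block,
  equations below residue \<open>c\<close> are solved upwards and those above it downwards; once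
  residue \<open>c\<close> is dropped, no coordinate is computed twice.\<close>

definition slot :: "nat \<Rightarrow> nat \<Rightarrow> nat" where
  "slot c i = (if i mod 11 < c then Suc i else i)"

lemma slot_inj:
  assumes "c < 10" "\<And>i. i \<in> J \<Longrightarrow> i mod 11 \<noteq> c"
  shows "inj_on (slot c) J"
proof -
  have *: "False" if "i \<in> J" "Suc i \<in> J" "i mod 11 < c" "\<not> Suc i mod 11 < c" for i
  proof -
    have "Suc i mod 11 = Suc (i mod 11)" using that(3) assms(1) by (simp add: mod_Suc)
    then show False using that assms(2)[of "Suc i"] by linarith
  qed
  show ?thesis
  proof (rule inj_onI)
    fix i j assume ij: "i \<in> J" "j \<in> J" "slot c i = slot c j"
    then show "i = j"
      using *[of i] *[of j] by (auto simp: slot_def split: if_splits)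
  qed
qed

text \<open>Runs start at residue 0 and end at residue 10. With \<open>c < 10\<close>, a coordinate
  of residue 0 is never a slot, and one of residue 10 is a slot only for the equation leading into
  the next block, which is absent at the end of a run. So slots are free coordinates even when both
  ends of each run are fixed.\<close>

lemma slot_mem:
  assumes "c < 10" "i \<in> E" "i mod 11 \<noteq> c"
  shows "slot c i \<in> V - (St \<union> En)"
proof (cases "i mod 11 < c")
  case True
  then have "Suc i mod 11 < 10" using assms(1) by (simp add: mod_Suc)
  then show ?thesis
    using True assms(2) V_Suc[of "Suc i"] by (auto simp: slot_def E_def St_def En_def)
next
  case False
  then have "i mod 11 > 0" using assms(3) by simp
  then obtain j where j: "i = Suc j" by (cases i) auto
  then have "j \<in> V" using \<open>i mod 11 > 0\<close> assms(2) V_pred[of j] by (auto simp: E_def)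
  then show ?thesis
    using False assms(2) j by (auto simp: slot_def E_def St_def En_def)
qed

text \<open>Outside the residue class \<open>c\<close>, the equations \<open>y (Suc i) + y i = \<omega> i\<close> can be solved one after the other
  for the values of \<open>y\<close> at the slots.\<close>

lemma slot_determined:
  fixes y y' :: "nat \<Rightarrow> 'h::group_add"
  assumes c: "c < 10" and J: "J \<subseteq> E" "\<And>i. i \<in> J \<Longrightarrow> i mod 11 \<noteq> c"
    and eq: "\<And>i. i \<in> J \<Longrightarrow> y (Suc i) + y i = y' (Suc i) + y' i"
    and out: "\<And>i. i \<in> (J \<union> Suc ` J) - slot c ` J \<Longrightarrow> y i = y' i"
    and i: "i \<in> J \<union> Suc ` J"
  shows "y i = y' i"
proof -
  have up: "i \<in> J \<Longrightarrow> i mod 11 < c \<Longrightarrow> y (Suc i) = y' (Suc i)" for i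
  proof (induction i rule: less_induct)
    case (less i)
    have "y i = y' i"
    proof (cases "i \<in> slot c ` J")
      case True
      then obtain j where j: "j \<in> J" "i = slot c j" by auto
      then have "j mod 11 < c" "i = Suc j" using less.prems by (auto simp: slot_def split: if_splits)
      then show ?thesis using less.IH[of j] j(1) by simp
    qed (use out less.prems in auto)
    then show ?case using eq[OF less.prems(1)] by simp
  qed
  have down: "i \<in> J \<Longrightarrow> \<not> i mod 11 < c \<Longrightarrow> y i = y' i" for i
  proof (induction "11 * b - i" arbitrary: i rule: less_induct)
    case less
    have "y (Suc i) = y' (Suc i)"
    proof (cases "Suc i \<in> slot c ` J")
      case True
      then obtain j where j: "j \<in> J" "Suc i = slot c j" by auto
      then have "\<not> j mod 11 < c" "j = Suc i" using less.prems by (auto simp: slot_def split: if_splits)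
      moreover have "i < 11 * b" using less.prems J(1) subs by auto
      ultimately show ?thesis using less.hyps[of j] j(1) by simp
    qed (use out less.prems in auto)
    then show ?case using eq[OF less.prems(1)] by simp
  qed
  show ?thesis
  proof (cases "i \<in> slot c ` J")
    case True
    then obtain j where "j \<in> J" "i = slot c j" by auto
    then show ?thesis using up[of j] down[of j] by (auto simp: slot_def split: if_splits)
  qed (use out i in auto)
qed

end

text \<open>Pigeonhole over ten of the eleven residues: residue 10 is not offered, since slots avoid
  the ends of runs only for \<open>c < 10\<close>.\<close>

lemma sparse_residue:
  fixes J :: "nat set"
  assumes "finite J"
  obtains c where "c < 10" "10 * card {i \<in> J. i mod 11 = c} \<le> card J"
proof -
  have "\<exists>c<10. 10 * card {i \<in> J. i mod 11 = c} \<le> card J"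
  proof (rule ccontr)
    assume "\<not> ?thesis"
    then have "(\<Sum>c<(10::nat). card J) < (\<Sum>c<(10::nat). 10 * card {i \<in> J. i mod 11 = c})"
      by (intro sum_strict_mono) (auto simp: not_le lessThan_empty_iff)
    also have "\<dots> = 10 * card (\<Union>c\<in>{..<10}. {i \<in> J. i mod 11 = c})"
      using assms by (subst card_UN_disjoint) (auto simp: sum_distrib_left)
    also have "\<dots> \<le> 10 * card J"
      using assms by (intro mult_left_mono card_mono) auto
    finally show False by simp
  qed
  then show ?thesis using that by blast
qed


section \<open>Fibres of a set of tuples and their densities\<close>

context mixing_group
begin

definition fibre :: "(nat \<Rightarrow> 'a) set \<Rightarrow> nat set \<Rightarrow> (nat \<Rightarrow> 'a) \<Rightarrow> (nat \<Rightarrow> 'a) set" where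
  "fibre S I \<beta> = {k \<in> S. \<forall>i\<in>I. k i = \<beta> i}"

definition dens :: "(nat \<Rightarrow> 'a) set \<Rightarrow> nat \<Rightarrow> nat set \<Rightarrow> (nat \<Rightarrow> 'a) \<Rightarrow> real" where
  "dens S R I \<beta> = card (fibre S I \<beta>) / card H ^ (R - card I)"

lemma dens_nonneg: "dens S R I \<beta> \<ge> 0"
  by (simp add: dens_def)

lemma card_fibre: "card (fibre S I \<beta>) = dens S R I \<beta> * card H ^ (R - card I)"
  using card_H_pos by (simp add: dens_def)

lemma dens_cong: "(\<And>i. i \<in> I \<Longrightarrow> \<beta> i = \<gamma> i) \<Longrightarrow> dens S R I \<beta> = dens S R I \<gamma>"
  by (simp add: dens_def fibre_def)

lemma fibre_subset_hbox_image:
  assumes S: "S \<subseteq> hbox {..<R} H" and I: "I \<subseteq> {..<R}"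
  shows "card (fibre S I \<beta>) \<le> card H ^ (R - card I)"
proof -
  have "card (fibre S I \<beta>) \<le> card (hbox ({..<R} - I) H)"
  proof (rule card_inj_on_le)
    show "inj_on (\<lambda>k i. if i \<in> I then 0 else k i) (fibre S I \<beta>)"
      by (rule inj_onI) (force simp: fibre_def fun_eq_iff split: if_splits)
    show "(\<lambda>k i. if i \<in> I then 0 else k i) ` fibre S I \<beta> \<subseteq> hbox ({..<R} - I) H"
      using S by (auto simp: fibre_def hbox_def)
    show "finite (hbox ({..<R} - I) H)" by (intro finite_hbox finite_carrier) auto
  qed
  also have "\<dots> = card H ^ (R - card I)"
    using I by (simp add: card_hbox card_Diff_subset finite_subset)
  finally show ?thesis .
qed

lemma dens_le_1:
  assumes "S \<subseteq> hbox {..<R} H" "I \<subseteq> {..<R}"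
  shows "dens S R I \<beta> \<le> 1"
proof -
  have "real (card (fibre S I \<beta>)) \<le> real (card H) ^ (R - card I)"
    using fibre_subset_hbox_image[OF assms, of \<beta>] by (metis of_nat_le_iff of_nat_power)
  then show ?thesis using card_H_pos by (simp add: dens_def)
qed

text \<open>The elements are grouped by their values on \<open>I' - I\<close>. There are
  \<open>card H ^ (card I' - card I)\<close> groups, and one meeting a thin subfibre lies inside it.
  The bound serves to find one tuple whose subfibres over several sets are simultaneously not
  thin.\<close>

lemma card_sparse_subfibres:
  fixes \<epsilon> :: real
  assumes S: "S \<subseteq> hbox {..<R} H" and I: "I \<subseteq> I'" "I' \<subseteq> {..<R}"
    and \<epsilon>: "\<epsilon> \<ge> 0"
  shows "card {k \<in> fibre S I \<beta>. dens S R I' k < \<epsilon>} \<le> \<epsilon> * card H ^ (R - card I)"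
proof -
  define bad where "bad = {k \<in> fibre S I \<beta>. dens S R I' k < \<epsilon>}"
  define W where "W = hbox (I' - I) H"
  have finS: "finite S" using S finite_hbox[of "{..<R}" H] finite_carrier finite_subset by blast
  have fin: "finite I'" "finite I" using I by (auto intro: finite_subset[OF _ finite_lessThan[of R]])
  have cI: "card I' \<le> R" "card I \<le> card I'"
    using I fin card_mono[of "{..<R}" I'] card_mono[of I' I] by auto
  have "bad \<subseteq> (\<Union>w\<in>W. {k \<in> bad. \<forall>i\<in>I' - I. k i = w i})"
  proof
    fix k assume k: "k \<in> bad"
    have "(\<lambda>i. if i \<in> I' - I then k i else 0) \<in> W"
      using k S I by (fastforce simp: bad_def fibre_def W_def hbox_def)
    then show "k \<in> (\<Union>w\<in>W. {k \<in> bad. \<forall>i\<in>I' - I. k i = w i})"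
      using k by (intro UN_I) auto
  qed
  moreover have finW: "finite W" using fin by (simp add: W_def finite_hbox finite_carrier)
  moreover have "finite bad" using finS by (simp add: bad_def fibre_def)
  ultimately have "card bad \<le> card (\<Union>w\<in>W. {k \<in> bad. \<forall>i\<in>I' - I. k i = w i})"
    by (intro card_mono finite_UN_I) simp_all
  also have "\<dots> \<le> (\<Sum>w\<in>W. card {k \<in> bad. \<forall>i\<in>I' - I. k i = w i})"
    by (rule card_UN_le[OF finW])
  finally have "real (card bad) \<le> (\<Sum>w\<in>W. real (card {k \<in> bad. \<forall>i\<in>I' - I. k i = w i}))"
    unfolding of_nat_sum[symmetric] of_nat_le_iff .
  also have "\<dots> \<le> (\<Sum>w\<in>W. \<epsilon> * card H ^ (R - card I'))"
  proof (rule sum_mono)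
    fix w
    show "real (card {k \<in> bad. \<forall>i\<in>I' - I. k i = w i}) \<le> \<epsilon> * card H ^ (R - card I')"
    proof (cases "{k \<in> bad. \<forall>i\<in>I' - I. k i = w i} = {}")
      case True
      then show ?thesis using \<epsilon> by (simp only: card.empty) simp
    next
      case False
      then obtain k0 where k0: "k0 \<in> bad" "\<forall>i\<in>I' - I. k0 i = w i" by blast
      have "{k \<in> bad. \<forall>i\<in>I' - I. k i = w i} \<subseteq> fibre S I' k0"
      proof
        fix k assume k: "k \<in> {k \<in> bad. \<forall>i\<in>I' - I. k i = w i}"
        have "k i = k0 i" if "i \<in> I'" for i
          using k k0 that by (cases "i \<in> I") (auto simp: bad_def fibre_def)
        then show "k \<in> fibre S I' k0" using k by (auto simp: bad_def fibre_def)
      qed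
      then have "real (card {k \<in> bad. \<forall>i\<in>I' - I. k i = w i}) \<le> real (card (fibre S I' k0))"
        using finS by (intro of_nat_mono card_mono) (auto simp: fibre_def)
      also have "\<dots> = dens S R I' k0 * card H ^ (R - card I')"
        by (rule card_fibre)
      also have "\<dots> \<le> \<epsilon> * card H ^ (R - card I')"
        using k0(1) by (intro mult_right_mono) (auto simp: bad_def)
      finally show ?thesis .
    qed
  qed
  also have "\<dots> = \<epsilon> * (card H ^ (card I' - card I) * card H ^ (R - card I'))"
    using I fin by (simp add: W_def card_hbox card_Diff_subset)
  also have "\<dots> = \<epsilon> * card H ^ (R - card I)"
    using cI by (simp add: power_add[symmetric])
  finally show ?thesis by (simp add: bad_def)
qed

text \<open>The fibre maximising this quantity is spread: fixing \<open>j\<close> further coordinates multiplies the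
  density by at most \<open>(1 + j / (card I + 1)) powr C\<close>, so a constant factor only while \<open>j\<close> is
  comparable with \<open>card I\<close>.\<close>

lemma spread_fibre_exists:
  assumes S: "S \<subseteq> hbox {..<R} H" "S \<noteq> {}" and C: "C > 0"
  obtains I \<beta> where "I \<subseteq> {..<R}" "\<beta> \<in> S" "dens S R I \<beta> > 0"
    "dens S R {} \<beta> * real (card I + 1) powr C \<le> dens S R I \<beta>"
    "\<And>I' \<gamma>. I' \<subseteq> {..<R} \<Longrightarrow> dens S R I' \<gamma> \<le> dens S R I \<beta> * (real (card I' + 1) / real (card I + 1)) powr C"
proof -
  define pot where "pot = (\<lambda>(I, \<beta>). dens S R I \<beta> / real (card I + 1) powr C)"
  define X where "X = Pow {..<R} \<times> S"
  have finS: "finite S" using S finite_hbox[of "{..<R}" H] finite_carrier finite_subset by blast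
  have X: "finite X" "X \<noteq> {}" using finS S by (auto simp: X_def)
  define mx where "mx = Max (pot ` X)"
  have "mx \<in> pot ` X" using X by (simp add: mx_def)
  then obtain I \<beta> where I: "(I, \<beta>) \<in> X" "pot (I, \<beta>) = mx" by auto
  have max: "pot z \<le> pot (I, \<beta>)" if "z \<in> X" for z
    using that X I(2) by (simp add: mx_def)
  have pos: "dens S R I \<beta> > 0"
  proof -
    have "\<beta> \<in> fibre S I \<beta>" "finite (fibre S I \<beta>)" using I(1) finS by (auto simp: X_def fibre_def)
    then have "card (fibre S I \<beta>) > 0" using card_gt_0_iff by blast
    then show ?thesis using card_H_pos by (simp add: dens_def)
  qed
  have le: "dens S R I' \<gamma> \<le> dens S R I \<beta> * (real (card I' + 1) / real (card I + 1)) powr C"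
    if I': "I' \<subseteq> {..<R}" for I' \<gamma>
  proof (cases "fibre S I' \<gamma> = {}")
    case True
    then have "dens S R I' \<gamma> = 0" by (simp add: dens_def)
    then show ?thesis by (simp add: dens_nonneg)
  next
    case False
    then obtain k where k: "k \<in> S" "\<forall>i\<in>I'. k i = \<gamma> i" by (auto simp: fibre_def)
    have "pot (I', k) \<le> pot (I, \<beta>)" using k I' by (intro max) (auto simp: X_def)
    moreover have "dens S R I' \<gamma> = dens S R I' k" using k by (intro dens_cong) auto
    ultimately show ?thesis
      by (simp add: pot_def powr_divide field_simps)
  qed
  show ?thesis
  proof (rule that[of I \<beta>])
    show "I \<subseteq> {..<R}" "\<beta> \<in> S" using I by (auto simp: X_def)
    show "dens S R {} \<beta> * real (card I + 1) powr C \<le> dens S R I \<beta>"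
      using le[of "{}" \<beta>] by (simp add: powr_divide field_simps)
  qed (use pos le in auto)
qed


section \<open>The three functions on the edges of the runs\<close>

definition emb :: "nat \<Rightarrow> nat set \<Rightarrow> nat set \<Rightarrow> (nat \<Rightarrow> nat) \<Rightarrow> (nat \<Rightarrow> 'h) \<Rightarrow> (nat \<Rightarrow> 'h) \<Rightarrow> nat \<Rightarrow> 'h" where
  "emb R Z E \<sigma> \<kappa> \<xi> = (\<lambda>i. if i \<in> Z then \<kappa> i else if i < R then \<xi> (inv_into E \<sigma> i) else 0)"

text \<open>The triples \<open>k\<close>, \<open>a = k + v\<close>, \<open>c = (\<lambda>i. - v (Suc i) + k i)\<close> satisfy
  \<open>a (Suc i) + c i = k (Suc i) + k i\<close>, so they are counted by convolving the indicator functions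
  of the possible \<open>a\<close> and \<open>c\<close>, and comparing with the distribution of these sums over \<open>k\<close>.\<close>

definition edges :: "nat set \<Rightarrow> (nat \<Rightarrow> 'h) \<Rightarrow> nat \<Rightarrow> 'h" where
  "edges E y = (\<lambda>i. if i \<in> E then y (Suc i) + y i else 0)"

lemma emb_image:
  assumes "inj_on \<sigma> E" "\<sigma> ` E = {..<R} - Z" "j \<in> E"
  shows "emb R Z E \<sigma> \<kappa> \<xi> (\<sigma> j) = \<xi> j"
proof -
  have "\<sigma> j \<in> {..<R} - Z" using assms by blast
  then show ?thesis using assms by (simp add: emb_def)
qed

lemma emb_eqI:
  assumes \<sigma>: "inj_on \<sigma> E" "\<sigma> ` E = {..<R} - Z" and k: "k \<in> hbox {..<R} H"
    and Z: "\<And>i. i \<in> Z \<Longrightarrow> k i = \<kappa> i" and E: "\<And>j. j \<in> E \<Longrightarrow> k (\<sigma> j) = \<xi> j"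
  shows "emb R Z E \<sigma> \<kappa> \<xi> = k"
proof
  fix i
  show "emb R Z E \<sigma> \<kappa> \<xi> i = k i"
  proof (cases "i \<in> {..<R} - Z")
    case True
    then obtain j where j: "j \<in> E" "i = \<sigma> j" using \<sigma>(2) by blast
    then show ?thesis using emb_image[OF \<sigma> j(1)] E by simp
  next
    case False
    then show ?thesis using Z[of i] k by (cases "i \<in> Z") (auto simp: emb_def hbox_def)
  qed
qed

text \<open>\<open>\<sigma>\<close> matches \<open>E\<close> with the coordinates outside
  \<open>Z\<close>, so the embedding identifies the box with the tuples that equal
  \<open>\<kappa>\<close> on \<open>Z\<close>.\<close>

lemma emb_mean:
  assumes S: "S \<subseteq> hbox {..<R} H" and Z: "Z \<subseteq> {..<R}" and E: "finite E"
    and \<sigma>: "inj_on \<sigma> E" "\<sigma> ` E = {..<R} - Z"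
  shows "(\<Sum>\<xi>\<in>hbox E H. if emb R Z E \<sigma> \<kappa> \<xi> \<in> S then 1 else 0) / card (hbox E H) = dens S R Z \<kappa>"
proof -
  have fin: "finite (hbox E H)" by (rule finite_hbox[OF E finite_carrier])
  have "bij_betw (emb R Z E \<sigma> \<kappa>) {\<xi> \<in> hbox E H. emb R Z E \<sigma> \<kappa> \<xi> \<in> S} (fibre S Z \<kappa>)"
  proof (rule bij_betw_byWitness[where f' = "\<lambda>k j. if j \<in> E then k (\<sigma> j) else 0"])
    show "\<forall>\<xi>\<in>{\<xi> \<in> hbox E H. emb R Z E \<sigma> \<kappa> \<xi> \<in> S}. (\<lambda>j. if j \<in> E then emb R Z E \<sigma> \<kappa> \<xi> (\<sigma> j) else 0) = \<xi>"
      using emb_image[OF \<sigma>] by (auto simp: hbox_def fun_eq_iff)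
    have eq: "emb R Z E \<sigma> \<kappa> (\<lambda>j. if j \<in> E then k (\<sigma> j) else 0) = k" if "k \<in> fibre S Z \<kappa>" for k
      using that S by (intro emb_eqI[OF \<sigma>]) (auto simp: fibre_def)
    then show "\<forall>k\<in>fibre S Z \<kappa>. emb R Z E \<sigma> \<kappa> (\<lambda>j. if j \<in> E then k (\<sigma> j) else 0) = k"
      by blast
    show "emb R Z E \<sigma> \<kappa> ` {\<xi> \<in> hbox E H. emb R Z E \<sigma> \<kappa> \<xi> \<in> S} \<subseteq> fibre S Z \<kappa>"
      by (auto simp: fibre_def emb_def)
    show "(\<lambda>k j. if j \<in> E then k (\<sigma> j) else 0) ` fibre S Z \<kappa> \<subseteq> {\<xi> \<in> hbox E H. emb R Z E \<sigma> \<kappa> \<xi> \<in> S}"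
    proof (rule image_subsetI)
      fix k assume k: "k \<in> fibre S Z \<kappa>"
      have "k (\<sigma> j) \<in> H" if "j \<in> E" for j
      proof -
        have "\<sigma> j \<in> {..<R}" using \<sigma>(2) that by blast
        then show ?thesis using k S by (auto simp: fibre_def hbox_def subset_iff)
      qed
      then show "(\<lambda>j. if j \<in> E then k (\<sigma> j) else 0) \<in> {\<xi> \<in> hbox E H. emb R Z E \<sigma> \<kappa> \<xi> \<in> S}"
        using eq[OF k] k by (auto simp: hbox_def fibre_def)
    qed
  qed
  then have "card {\<xi> \<in> hbox E H. emb R Z E \<sigma> \<kappa> \<xi> \<in> S} = card (fibre S Z \<kappa>)"
    by (rule bij_betw_same_card)
  moreover have "card E = R - card Z"
    using card_image[OF \<sigma>(1)] Z by (simp add: \<sigma>(2) card_Diff_subset finite_subset)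
  moreover have "(\<Sum>\<xi>\<in>hbox E H. if emb R Z E \<sigma> \<kappa> \<xi> \<in> S then 1 else 0) = real (card {\<xi> \<in> hbox E H. emb R Z E \<sigma> \<kappa> \<xi> \<in> S})"
    using fin by (simp add: sum.If_cases Int_def)
  ultimately show ?thesis by (simp add: dens_def card_hbox E)
qed

lemma emb_avg_le:
  assumes S: "S \<subseteq> hbox {..<R} H" and Z: "Z \<subseteq> {..<R}" and E: "finite E"
    and \<sigma>: "inj_on \<sigma> E" "\<sigma> ` E = {..<R} - Z" and J: "J \<subseteq> E"
  shows "(\<Sum>y\<in>hbox (E - J) H. if emb R Z E \<sigma> \<kappa> (\<xi> + y) \<in> S then 1 else 0) / card (hbox (E - J) H)
    \<le> dens S R (Z \<union> \<sigma> ` J) (emb R Z E \<sigma> \<kappa> \<xi>)"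
proof -
  have finS: "finite S" using S finite_hbox[of "{..<R}" H] finite_carrier finite_subset by blast
  have fin: "finite (hbox (E - J) H)" using E finite_carrier by (simp add: finite_hbox)
  have "card {y \<in> hbox (E - J) H. emb R Z E \<sigma> \<kappa> (\<xi> + y) \<in> S} \<le> card (fibre S (Z \<union> \<sigma> ` J) (emb R Z E \<sigma> \<kappa> \<xi>))"
  proof (rule card_inj_on_le)
    show "inj_on (\<lambda>y. emb R Z E \<sigma> \<kappa> (\<xi> + y)) {y \<in> hbox (E - J) H. emb R Z E \<sigma> \<kappa> (\<xi> + y) \<in> S}"
    proof (rule inj_onI, rule ext)
      fix y y' j
      assume y: "y \<in> {y \<in> hbox (E - J) H. emb R Z E \<sigma> \<kappa> (\<xi> + y) \<in> S}"
        "y' \<in> {y \<in> hbox (E - J) H. emb R Z E \<sigma> \<kappa> (\<xi> + y) \<in> S}"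
        "emb R Z E \<sigma> \<kappa> (\<xi> + y) = emb R Z E \<sigma> \<kappa> (\<xi> + y')"
      show "y j = y' j"
      proof (cases "j \<in> E")
        case True
        then show ?thesis
          using emb_image[OF \<sigma> True, of \<kappa> "\<xi> + y"] emb_image[OF \<sigma> True, of \<kappa> "\<xi> + y'"] y(3) by simp
      qed (use y in \<open>auto simp: hbox_def\<close>)
    qed
    show "(\<lambda>y. emb R Z E \<sigma> \<kappa> (\<xi> + y)) ` {y \<in> hbox (E - J) H. emb R Z E \<sigma> \<kappa> (\<xi> + y) \<in> S}
      \<subseteq> fibre S (Z \<union> \<sigma> ` J) (emb R Z E \<sigma> \<kappa> \<xi>)"
    proof (rule image_subsetI)
      fix y assume y: "y \<in> {y \<in> hbox (E - J) H. emb R Z E \<sigma> \<kappa> (\<xi> + y) \<in> S}"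
      have "emb R Z E \<sigma> \<kappa> (\<xi> + y) i = emb R Z E \<sigma> \<kappa> \<xi> i" if i: "i \<in> Z \<union> \<sigma> ` J" for i
      proof (cases "i \<in> Z")
        case False
        then obtain j where j: "j \<in> J" "i = \<sigma> j" using i by blast
        then have "j \<in> E" "y j = 0" using J y by (auto simp: hbox_def)
        then show ?thesis using j emb_image[OF \<sigma>, of j] by simp
      qed (simp add: emb_def)
      then show "emb R Z E \<sigma> \<kappa> (\<xi> + y) \<in> fibre S (Z \<union> \<sigma> ` J) (emb R Z E \<sigma> \<kappa> \<xi>)"
        using y by (auto simp: fibre_def)
    qed
    show "finite (fibre S (Z \<union> \<sigma> ` J) (emb R Z E \<sigma> \<kappa> \<xi>))" using finS by (simp add: fibre_def)
  qed
  moreover have "card (E - J) = R - card (Z \<union> \<sigma> ` J)"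
  proof -
    have "\<sigma> ` (E - J) = {..<R} - (Z \<union> \<sigma> ` J)"
      using \<sigma> J by (auto simp: inj_on_image_set_diff[OF \<sigma>(1)])
    moreover have "card (\<sigma> ` (E - J)) = card (E - J)"
      using \<sigma>(1) by (intro card_image) (auto simp: inj_on_def)
    moreover have "Z \<union> \<sigma> ` J \<subseteq> {..<R}" using Z \<sigma>(2) J by blast
    ultimately show ?thesis by (metis card_Diff_subset card_lessThan finite_lessThan finite_subset)
  qed
  moreover have "(\<Sum>y\<in>hbox (E - J) H. if emb R Z E \<sigma> \<kappa> (\<xi> + y) \<in> S then 1 else 0)
     = real (card {y \<in> hbox (E - J) H. emb R Z E \<sigma> \<kappa> (\<xi> + y) \<in> S})"
    using fin by (simp add: sum.If_cases Int_def)
  ultimately show ?thesis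
    using card_H_pos E by (simp add: dens_def card_hbox divide_right_mono)
qed

text \<open>The weight \<open>card H ^ card E / card H ^ M\<close> is chosen so that the mean is
  again the density of a fibre; \<open>M\<close> is the number of free coordinates of
  \<open>y\<close>.\<close>

lemma edges_mean:
  assumes S: "S \<subseteq> hbox {..<R} H" and E: "finite E" "E \<subseteq> {..<R}" "Suc ` E \<subseteq> {..<R}"
    and M: "card Z + M = R"
  shows "(\<Sum>\<omega>\<in>hbox E H. card {y \<in> fibre S Z \<kappa>. edges E y = \<omega>} * real (card H) ^ card E / card H ^ M)
     / card (hbox E H) = dens S R Z \<kappa>"
proof -
  have finS: "finite S" using S finite_hbox[of "{..<R}" H] finite_carrier finite_subset by blast
  have edges_mem: "edges E y \<in> hbox E H" if "y \<in> S" for y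
  proof -
    have "y i \<in> H" if "i < R" for i using S \<open>y \<in> S\<close> that by (auto simp: hbox_def)
    then show ?thesis using E by (auto simp: edges_def hbox_def intro!: add_mem)
  qed
  have "(\<Sum>\<omega>\<in>hbox E H. card {y \<in> fibre S Z \<kappa>. edges E y = \<omega>}) = card (\<Union>\<omega>\<in>hbox E H. {y \<in> fibre S Z \<kappa>. edges E y = \<omega>})"
    using finS finite_hbox[OF E(1) finite_carrier]
    by (intro card_UN_disjoint[symmetric]) (auto simp: fibre_def)
  also have "(\<Union>\<omega>\<in>hbox E H. {y \<in> fibre S Z \<kappa>. edges E y = \<omega>}) = fibre S Z \<kappa>"
    using edges_mem by (auto simp: fibre_def)
  finally have "(\<Sum>\<omega>\<in>hbox E H. real (card {y \<in> fibre S Z \<kappa>. edges E y = \<omega>})) = real (card (fibre S Z \<kappa>))"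
    by (simp flip: of_nat_sum)
  moreover have "R - card Z = M" using M by simp
  ultimately show ?thesis
    using card_H_pos
    by (simp add: dens_def card_hbox E(1) sum_divide_distrib[symmetric] sum_distrib_right[symmetric])
qed

lemma edges_avg_le:
  assumes S: "S \<subseteq> hbox {..<R} H" and E: "finite E" and J: "J \<subseteq> E"
  shows "(\<Sum>y'\<in>hbox (E - J) H. card {y \<in> fibre S Z \<kappa>. edges E y = \<omega> + y'} * real (card H) ^ card E / card H ^ M)
     / card (hbox (E - J) H)
     \<le> card {y \<in> fibre S Z \<kappa>. \<forall>i\<in>J. y (Suc i) + y i = \<omega> i} * real (card H) ^ card J / card H ^ M"
proof -
  have finS: "finite S" using S finite_hbox[of "{..<R}" H] finite_carrier finite_subset by blast
  have "(\<Sum>y'\<in>hbox (E - J) H. card {y \<in> fibre S Z \<kappa>. edges E y = \<omega> + y'})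
    = card (\<Union>y'\<in>hbox (E - J) H. {y \<in> fibre S Z \<kappa>. edges E y = \<omega> + y'})"
    using finS finite_hbox[of "E - J", OF _ finite_carrier] E
    by (intro card_UN_disjoint[symmetric]) (auto simp: fibre_def)
  also have "\<dots> \<le> card {y \<in> fibre S Z \<kappa>. \<forall>i\<in>J. y (Suc i) + y i = \<omega> i}"
  proof (intro card_mono subsetI)
    fix y assume "y \<in> (\<Union>y'\<in>hbox (E - J) H. {y \<in> fibre S Z \<kappa>. edges E y = \<omega> + y'})"
    then obtain y' where y': "y' \<in> hbox (E - J) H" "y \<in> fibre S Z \<kappa>" "edges E y = \<omega> + y'" by blast
    have "y (Suc i) + y i = \<omega> i" if "i \<in> J" for i
      using fun_cong[OF y'(3), of i] y'(1) that J by (auto simp: edges_def hbox_def)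
    then show "y \<in> {y \<in> fibre S Z \<kappa>. \<forall>i\<in>J. y (Suc i) + y i = \<omega> i}" using y' by simp
  qed (use finS in \<open>simp add: fibre_def\<close>)
  finally have *: "(\<Sum>y'\<in>hbox (E - J) H. real (card {y \<in> fibre S Z \<kappa>. edges E y = \<omega> + y'}))
      \<le> real (card {y \<in> fibre S Z \<kappa>. \<forall>i\<in>J. y (Suc i) + y i = \<omega> i})"
    unfolding of_nat_sum[symmetric] of_nat_le_iff .
  have "card E = card (E - J) + card J"
    using E J by (simp add: card_Diff_subset finite_subset card_mono)
  then have pow: "real (card H) ^ card E = real (card H) ^ card (E - J) * real (card H) ^ card J"
    by (simp add: power_add)
  have "(\<Sum>y'\<in>hbox (E - J) H. card {y \<in> fibre S Z \<kappa>. edges E y = \<omega> + y'} * real (card H) ^ card E / card H ^ M)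
     / card (hbox (E - J) H) = (\<Sum>y'\<in>hbox (E - J) H. real (card {y \<in> fibre S Z \<kappa>. edges E y = \<omega> + y'}))
     * (real (card H) ^ card J / card H ^ M)"
    using card_H_pos E
    by (simp add: pow card_hbox sum_divide_distrib[symmetric] sum_distrib_right[symmetric])
  also have "\<dots> \<le> card {y \<in> fibre S Z \<kappa>. \<forall>i\<in>J. y (Suc i) + y i = \<omega> i} * (real (card H) ^ card J / card H ^ M)"
    by (intro mult_right_mono *) simp
  finally show ?thesis by simp
qed

text \<open>The equations indexed by \<open>J\<close> may outnumber the free coordinates, so those
  of one sparse residue are dropped, at the cost \<open>card H ^ (card J div 10)\<close>. Once the
  remaining free coordinates \<open>X'\<close> are given, the other equations determine the slots.
  Each choice of values on \<open>X'\<close> thus leaves at most one fibre over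
  \<open>Z \<union> X\<close>, of density at most \<open>D\<close>.\<close>

lemma edges_count_le:
  fixes D :: real
  assumes "superblocks b I"
  defines "E \<equiv> superblocks.E b I" and "Z \<equiv> superblocks.F b I \<union> superblocks.St b I \<union> superblocks.En b I"
  defines "M \<equiv> {..<11 * b} - Z"
  assumes S: "S \<subseteq> hbox {..<11 * b} H" and J: "J \<subseteq> E"
    and D: "D \<ge> 0" "\<And>X \<gamma>. X \<subseteq> M \<Longrightarrow> card X \<le> 2 * card J \<Longrightarrow> dens S (11 * b) (Z \<union> X) \<gamma> \<le> D"
  shows "card {y \<in> fibre S Z \<kappa>. \<forall>i\<in>J. y (Suc i) + y i = \<omega> i} * real (card H) ^ card J / card H ^ card M
    \<le> D * card H ^ (card J div 10)"
proof -
  interpret sb: superblocks b I by fact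
  have finS: "finite S" using S finite_hbox[of "{..<11 * b}" H] finite_carrier finite_subset by blast
  have finJ: "finite J" using J unfolding E_def by (rule finite_subset) simp
  obtain c where c: "c < 10" "10 * card {i \<in> J. i mod 11 = c} \<le> card J"
    using sparse_residue[OF finJ] by blast
  define J' where "J' = {i \<in> J. i mod 11 \<noteq> c}"
  have J': "J' \<subseteq> E" "finite J'" "\<And>i. i \<in> J' \<Longrightarrow> i mod 11 \<noteq> c" using J finJ by (auto simp: J'_def)
  have "card J = card J' + card {i \<in> J. i mod 11 = c}"
    unfolding J'_def using finJ by (subst card_Un_disjoint[symmetric]) (auto intro: arg_cong[of _ _ card])
  then have cJ': "card J \<le> card J' + card J div 10" "card J' \<le> card J" using c(2) by auto
  define X where "X = (J' \<union> Suc ` J') \<inter> M"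
  define X' where "X' = X - sb.slot c ` J'"
  define Y' where "Y' = {y \<in> fibre S Z \<kappa>. \<forall>i\<in>J'. y (Suc i) + y i = \<omega> i}"
  have M_alt: "M = sb.V - (sb.St \<union> sb.En)"
    using sb.subs by (auto simp: M_def Z_def sb.V_def)
  have finX: "finite X" "finite X'" using J'(2) by (simp_all add: X_def X'_def)
  have slot_inj: "inj_on (sb.slot c) J'" using c(1) J'(3) by (rule sb.slot_inj)
  have slot_sub: "sb.slot c ` J' \<subseteq> X"
  proof
    fix i assume "i \<in> sb.slot c ` J'"
    then obtain j where j: "j \<in> J'" "i = sb.slot c j" by blast
    moreover have "sb.slot c j \<in> M"
      unfolding M_alt using j J'(1,3) c(1) by (intro sb.slot_mem) (auto simp: E_def)
    ultimately show "i \<in> X" by (auto simp: X_def sb.slot_def)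
  qed
  have cX: "card X = card X' + card J'"
    using slot_sub finX card_image[OF slot_inj] card_mono[OF finX(1) slot_sub] J'(2)
    by (simp add: X'_def card_Diff_subset)
  have cX2: "card X \<le> 2 * card J"
  proof -
    have "card X \<le> card (J' \<union> Suc ` J')" using J'(2) by (intro card_mono) (auto simp: X_def)
    also have "\<dots> \<le> card J' + card (Suc ` J')" by (rule card_Un_le)
    also have "\<dots> \<le> 2 * card J" using cJ'(2) by (simp add: card_image)
    finally show ?thesis .
  qed
  have finM: "finite M" by (simp add: M_def)
  have XM: "X \<subseteq> M" "card X \<le> card M" using finM by (auto simp: X_def intro: card_mono)
  have Z_sub: "Z \<subseteq> {..<11 * b}" using sb.subs by (auto simp: Z_def)
  have cZX: "11 * b - card (Z \<union> X) = card M - card X"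
  proof -
    have "{..<11 * b} - (Z \<union> X) = M - X" by (auto simp: M_def)
    moreover have "card ({..<11 * b} - (Z \<union> X)) = 11 * b - card (Z \<union> X)"
      using Z_sub XM(1) finX finite_subset[OF Z_sub] by (subst card_Diff_subset) (auto simp: M_def)
    ultimately show ?thesis using XM(1) finX by (simp add: card_Diff_subset)
  qed
  have "Y' \<subseteq> (\<Union>w\<in>hbox X' H. {y \<in> Y'. \<forall>i\<in>X'. y i = w i})"
  proof
    fix y assume y: "y \<in> Y'"
    have "y i \<in> H" if "i < 11 * b" for i using y S that by (auto simp: Y'_def fibre_def hbox_def)
    then have "(\<lambda>i. if i \<in> X' then y i else 0) \<in> hbox X' H"
      using XM(1) by (auto simp: hbox_def X'_def M_def)
    then show "y \<in> (\<Union>w\<in>hbox X' H. {y \<in> Y'. \<forall>i\<in>X'. y i = w i})"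
      using y by (intro UN_I) auto
  qed
  moreover have finY': "finite Y'" using finS by (simp add: Y'_def fibre_def)
  moreover have finW: "finite (hbox X' H)" by (rule finite_hbox[OF finX(2) finite_carrier])
  ultimately have "card Y' \<le> card (\<Union>w\<in>hbox X' H. {y \<in> Y'. \<forall>i\<in>X'. y i = w i})"
    by (intro card_mono finite_UN_I) simp_all
  also have "\<dots> \<le> (\<Sum>w\<in>hbox X' H. card {y \<in> Y'. \<forall>i\<in>X'. y i = w i})"
    by (rule card_UN_le[OF finW])
  finally have "real (card Y') \<le> (\<Sum>w\<in>hbox X' H. real (card {y \<in> Y'. \<forall>i\<in>X'. y i = w i}))"
    unfolding of_nat_sum[symmetric] of_nat_le_iff .
  also have "\<dots> \<le> (\<Sum>w\<in>hbox X' H. D * card H ^ (card M - card X))"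
  proof (rule sum_mono)
    fix w
    show "real (card {y \<in> Y'. \<forall>i\<in>X'. y i = w i}) \<le> D * card H ^ (card M - card X)"
    proof (cases "{y \<in> Y'. \<forall>i\<in>X'. y i = w i} = {}")
      case True
      show ?thesis unfolding True using D(1) by simp
    next
      case False
      then obtain y0 where y0: "y0 \<in> Y'" "\<forall>i\<in>X'. y0 i = w i" by blast
      have "{y \<in> Y'. \<forall>i\<in>X'. y i = w i} \<subseteq> fibre S (Z \<union> X) y0"
      proof
        fix y assume y: "y \<in> {y \<in> Y'. \<forall>i\<in>X'. y i = w i}"
        have Z_eq: "y i = y0 i" if "i \<in> Z" for i
          using that y y0 by (auto simp: Y'_def fibre_def)
        have "y i = y0 i" if i: "i \<in> J' \<union> Suc ` J'" for i
        proof (rule sb.slot_determined[OF c(1) _ J'(3) _ _ i])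
          show "J' \<subseteq> sb.E" using J'(1) by (simp add: E_def)
          show "y (Suc j) + y j = y0 (Suc j) + y0 j" if "j \<in> J'" for j
            using that y y0 by (auto simp: Y'_def)
          show "y j = y0 j" if j: "j \<in> J' \<union> Suc ` J' - sb.slot c ` J'" for j
          proof (cases "j \<in> Z")
            case False
            have "j < 11 * b"
              using j J'(1) sb.subs(2) by (auto simp: E_def sb.E_def)
            then have "j \<in> X'" using False j by (auto simp: X'_def X_def M_def)
            then show ?thesis using y y0 by auto
          qed (rule Z_eq)
        qed
        then show "y \<in> fibre S (Z \<union> X) y0"
          using y Z_eq by (auto simp: Y'_def fibre_def X_def)
      qed
      then have "real (card {y \<in> Y'. \<forall>i\<in>X'. y i = w i}) \<le> real (card (fibre S (Z \<union> X) y0))"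
        using finS by (intro of_nat_mono card_mono) (auto simp: fibre_def)
      also have "\<dots> = dens S (11 * b) (Z \<union> X) y0 * card H ^ (card M - card X)"
        unfolding card_fibre[of _ _ _ "11 * b"] cZX by simp
      also have "\<dots> \<le> D * card H ^ (card M - card X)"
        by (intro mult_right_mono D(2) XM(1) cX2) simp
      finally show ?thesis .
    qed
  qed
  also have "\<dots> = D * (real (card H) ^ card X' * real (card H) ^ (card M - card X))"
    by (simp add: card_hbox finX)
  also have "\<dots> = D * real (card H) ^ (card M - card J')"
    using cX XM(2) by (simp add: power_add[symmetric])
  finally have Y'_le: "real (card Y') \<le> D * real (card H) ^ (card M - card J')" .
  have "card {y \<in> fibre S Z \<kappa>. \<forall>i\<in>J. y (Suc i) + y i = \<omega> i} \<le> card Y'"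
    by (intro card_mono finY') (auto simp: Y'_def J'_def)
  then have "card {y \<in> fibre S Z \<kappa>. \<forall>i\<in>J. y (Suc i) + y i = \<omega> i} * real (card H) ^ card J
     \<le> (D * real (card H) ^ (card M - card J')) * real (card H) ^ card J"
    using Y'_le by (intro mult_right_mono) auto
  also have "\<dots> = D * real (card H) ^ (card M - card J' + card J)" by (simp add: power_add)
  also have "\<dots> \<le> D * real (card H) ^ (card M + card J div 10)"
    using cJ' cX XM(2) D(1) card_H_pos by (intro mult_left_mono power_increasing) auto
  finally show ?thesis
    using card_H_pos by (simp add: power_add field_simps)
qed


text \<open>At most \<open>33 * t + 2\<close> coordinates are fixed to isolate the runs, eleven
  times \<open>card I\<close> for each of \<open>F\<close>, \<open>St\<close>, \<open>En\<close> and
  one extra for \<open>St\<close> and \<open>En\<close>. Every edge touches at most two more.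
  Comparing with \<open>t + 1\<close> makes the factor independent of \<open>t\<close>.\<close>

lemma spread_ratio_le:
  assumes C: "C > 0" and m0: "m0 \<ge> 0" and z: "z + 1 \<le> (33 + 2 * i) * (t + 1)"
  shows "m0 * (real (z + 1) / real (t + 1)) powr C \<le> m0 * real (33 + 2 * i) powr C"
proof (intro mult_left_mono powr_mono2)
  have "real (z + 1) \<le> real ((33 + 2 * i) * (t + 1))"
    using z by (rule of_nat_mono)
  then show "real (z + 1) / real (t + 1) \<le> real (33 + 2 * i)"
    by (simp add: field_simps)
qed (use C m0 in auto)

text \<open>The exponents produce the square roots of the spread factors of the three functions that are
  convolved, the third one carrying the additional factor \<open>card H ^ (i div 10)\<close>.\<close>

lemma spread_factors_le:
  fixes \<rho> :: real
  assumes C: "C > 0" and i: "i > 0"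
    and \<tau>: "\<tau> \<ge> 16 * lam * 35 powr (3 / 2 * C) * card H powr (1 / 20)"
  defines "\<rho> \<equiv> 4 * real (33 + 2 * i) powr C"
  shows "(2 * lam) ^ i * (sqrt \<rho> * sqrt \<rho> * sqrt (\<rho> * card H ^ (i div 10))) \<le> \<tau> ^ i"
proof -
  have h: "real (card H) \<ge> 1" using card_H_pos by simp
  \<comment> \<open>The target \<open>\<tau> ^ i\<close> asks for a geometric bound; 35 is forced by
    \<open>i = 1\<close>.\<close>
  have "real (33 + 2 * i) \<le> 35 ^ i"
    using i
  proof (induction i rule: nat_induct_non_zero)
    case (Suc n)
    then show ?case by simp
  qed simp
  then have "real (33 + 2 * i) powr C \<le> (35 ^ i) powr C"
    using C by (intro powr_mono2) auto
  also have "(35 ^ i :: real) powr C = (35 powr C) ^ i"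
    by (simp add: powr_powr mult.commute flip: powr_realpow)
  finally have r: "real (33 + 2 * i) powr C \<le> (35 powr C) ^ i" .
  have "(4::real) \<le> 4 ^ i" using i by (simp add: self_le_power)
  then have \<rho>: "\<rho> \<le> 4 ^ i * (35 powr C) ^ i"
    unfolding \<rho>_def using r by (intro mult_mono) auto
  have \<rho>0: "\<rho> \<ge> 0" by (simp add: \<rho>_def)
  have sq: "sqrt \<rho> \<le> (2 * 35 powr (C / 2)) ^ i"
  proof (rule real_le_lsqrt)
    have "(2 * 35 powr (C / 2))\<^sup>2 = 4 * (35 :: real) powr C"
      by (simp add: power2_eq_square flip: powr_add)
    then have "((2 * 35 powr (C / 2)) ^ i)\<^sup>2 = 4 ^ i * ((35 :: real) powr C) ^ i"
      by (metis power_mult mult.commute power_mult_distrib)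
    then show "\<rho> \<le> ((2 * 35 powr (C / 2)) ^ i)\<^sup>2" using \<rho> by simp
  qed (use \<rho>0 in auto)
  have hp: "sqrt (real (card H) ^ (i div 10)) \<le> (card H powr (1 / 20)) ^ i"
  proof (rule real_le_lsqrt)
    have "real (card H) ^ (i div 10) = real (card H) powr real (i div 10)"
      using h by (simp add: powr_realpow)
    also have "\<dots> \<le> real (card H) powr (real i / 10)"
    proof (rule powr_mono)
      have "10 * (i div 10) \<le> i" by simp
      then have "real (10 * (i div 10)) \<le> real i" by (rule of_nat_mono)
      then show "real (i div 10) \<le> real i / 10" by simp
    qed (use h in simp)
    also have "\<dots> = ((card H powr (1 / 20)) ^ i)\<^sup>2"
    proof -
      have "((card H powr (1 / 20)) ^ i)\<^sup>2 = (card H powr (1 / 20)) ^ (2 * i)"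
        by (metis power_mult mult.commute)
      also have "\<dots> = (card H powr (1 / 20)) powr real (2 * i)"
        using h by (subst powr_realpow) auto
      finally show ?thesis by (simp add: powr_powr)
    qed
    finally show "real (card H) ^ (i div 10) \<le> ((card H powr (1 / 20)) ^ i)\<^sup>2" .
  qed (use h in auto)
  have "sqrt \<rho> * sqrt \<rho> * sqrt (\<rho> * card H ^ (i div 10)) = \<rho> * (sqrt \<rho> * sqrt (real (card H) ^ (i div 10)))"
    using \<rho>0 by (simp add: real_sqrt_mult)
  also have "\<dots> \<le> (4 ^ i * (35 powr C) ^ i) * ((2 * 35 powr (C / 2)) ^ i * (card H powr (1 / 20)) ^ i)"
    using \<rho>0 by (intro mult_mono \<rho> sq hp) auto
  also have "\<dots> = (8 * 35 powr (3 / 2 * C) * card H powr (1 / 20)) ^ i"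
  proof -
    have "(35 :: real) powr (3 / 2 * C) = 35 powr C * 35 powr (C / 2)"
      by (simp flip: powr_add)
    then have "8 * 35 powr (3 / 2 * C) * card H powr (1 / 20) = (4 * 35 powr C) * ((2 * 35 powr (C / 2)) * card H powr (1 / 20))"
      by simp
    then show ?thesis by (simp only: power_mult_distrib)
  qed
  finally have "(2 * lam) ^ i * (sqrt \<rho> * sqrt \<rho> * sqrt (\<rho> * card H ^ (i div 10)))
    \<le> (2 * lam) ^ i * (8 * 35 powr (3 / 2 * C) * card H powr (1 / 20)) ^ i"
    by (intro mult_left_mono) (auto simp: lam_nonneg)
  also have "\<dots> = (16 * lam * 35 powr (3 / 2 * C) * card H powr (1 / 20)) ^ i"
  proof -
    have "16 * lam * 35 powr (3 / 2 * C) * card H powr (1 / 20) = (2 * lam) * (8 * 35 powr (3 / 2 * C) * card H powr (1 / 20))"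
      by simp
    then show ?thesis by (simp only: power_mult_distrib)
  qed
  also have "\<dots> \<le> \<tau> ^ i"
    using \<tau> by (intro power_mono) (auto simp: lam_nonneg)
  finally show ?thesis .
qed

text \<open>If \<open>v = 0\<close> were the only possibility, every \<open>k\<close> would belong
  to a single pair of the two other tuples, and the weighted count would be at most
  \<open>card (hbox E H)\<close> times a density. The trilinear lower bound exceeds this by a factor
  of order \<open>\<delta>\<^sup>2 * card H ^ b\<close>.\<close>

theorem chain_solution:
  fixes C \<delta> \<tau> :: real
  assumes S: "S \<subseteq> hbox {..<11 * b} H" and C: "C > 0" and b: "b > 0"
    and \<delta>: "card S \<ge> \<delta> * card H ^ (11 * b)" "\<delta> \<ge> (real b / 4) powr - C"
      "\<delta>\<^sup>2 * real (card H) ^ b > 32"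
    and \<tau>: "\<tau> \<ge> 16 * lam * 35 powr (3 / 2 * C) * card H powr (1 / 20)" "(1 + \<tau>) ^ (11 * b) \<le> 3 / 2"
  obtains k v where "k \<in> S" "v \<in> hbox {..<11 * b} H" "v \<noteq> 0" "v 0 = 0"
    "k + v \<in> S" "(\<lambda>i. - v (Suc i) + k i) \<in> S"
proof -
  note solution = that
  define R where "R = 11 * b"
  define h where "h = real (card H)"
  have h1: "h \<ge> 1" using card_H_pos by (simp add: h_def)
  have "(real b / 4) powr - C > 0" using b by simp
  then have \<delta>0: "\<delta> > 0" using \<delta>(2) by (rule less_le_trans)
  have finS: "finite S" using S finite_hbox[of "{..<11 * b}" H] finite_carrier finite_subset by blast
  have S': "S \<subseteq> hbox {..<R} H" using S by (simp add: R_def)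
  have "real (card S) > 0"
  proof -
    have "0 < \<delta> * h ^ (11 * b)" using \<delta>0 h1 by simp
    then show ?thesis using \<delta>(1) unfolding h_def of_nat_power by linarith
  qed
  then have Sne: "S \<noteq> {}" by auto
  obtain I \<kappa>0 where I: "I \<subseteq> {..<R}" "\<kappa>0 \<in> S" "dens S R I \<kappa>0 > 0"
    and pot: "dens S R {} \<kappa>0 * real (card I + 1) powr C \<le> dens S R I \<kappa>0"
    and spread: "\<And>I' \<gamma>. I' \<subseteq> {..<R} \<Longrightarrow> dens S R I' \<gamma> \<le> dens S R I \<kappa>0 * (real (card I' + 1) / real (card I + 1)) powr C"
    using spread_fibre_exists[OF S' Sne C] by metis
  define m0 where "m0 = dens S R I \<kappa>0"
  define t where "t = card I"
  have m0: "m0 > 0" "m0 \<le> 1" using I dens_le_1[OF S' I(1)] by (auto simp: m0_def)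
  have "\<delta> \<le> dens S R {} \<kappa>0"
    using \<delta>(1) h1 by (simp add: dens_def fibre_def R_def h_def field_simps)
  then have "\<delta> * real (t + 1) powr C \<le> dens S R {} \<kappa>0 * real (t + 1) powr C"
    by (rule mult_right_mono) simp
  then have \<delta>t: "\<delta> * real (t + 1) powr C \<le> m0"
    using pot unfolding m0_def t_def by (rule order_trans)
  have \<delta>m0: "\<delta> \<le> m0"
  proof -
    have "\<delta> * 1 \<le> \<delta> * real (t + 1) powr C"
      using \<delta>0 C by (intro mult_left_mono ge_one_powr_ge_zero) auto
    then show ?thesis using \<delta>t by simp
  qed
  \<comment> \<open>The maximised potential gives \<open>\<delta> * (t + 1) powr C \<le> 1\<close>,
    so the lower bound on \<open>\<delta>\<close> keeps the number of fixed coordinates below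
    \<open>b / 4\<close> and most blocks intact.\<close>
  have t_le: "4 * (t + 1) \<le> b"
  proof (rule ccontr)
    assume "\<not> 4 * (t + 1) \<le> b"
    then have "real b < real (4 * (t + 1))" by (simp only: of_nat_less_iff not_le)
    then have "real b / 4 < real (t + 1)" by simp
    then have "(real b / 4) powr C < real (t + 1) powr C" using C by (intro powr_less_mono2) auto
    then have "1 < (real b / 4) powr - C * real (t + 1) powr C"
      using b by (simp add: powr_minus field_simps)
    also have "\<dots> \<le> \<delta> * real (t + 1) powr C" by (intro mult_right_mono \<delta>(2)) simp
    finally show False using \<delta>t m0(2) by simp
  qed
  interpret sb: superblocks b I by unfold_locales (use I(1) in \<open>simp add: R_def\<close>)
  \<comment> \<open>\<open>Z1\<close> is fixed for \<open>k + v\<close>, \<open>Z2\<close> for the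
    shifted tuple and \<open>Z3\<close> for \<open>k\<close>. A \<open>v\<close> that vanishes on
    \<open>Z1\<close> does not change the run starts, and at the end of a run \<open>Suc i\<close>
    is fixed or out of range, so the shifted tuple agrees with \<open>k\<close> there.\<close>
  define Z1 where "Z1 = sb.F \<union> sb.St"
  define Z2 where "Z2 = sb.F \<union> sb.En"
  define Z3 where "Z3 = sb.F \<union> sb.St \<union> sb.En"
  have Z_sub: "Z1 \<subseteq> {..<R}" "Z2 \<subseteq> {..<R}" "Z3 \<subseteq> {..<R}"
    using sb.subs by (auto simp: Z1_def Z2_def Z3_def R_def)
  have IZ: "I \<subseteq> Z1" "I \<subseteq> Z2" "I \<subseteq> Z3" using sb.I_sub_F by (auto simp: Z1_def Z2_def Z3_def)
  have cF: "card sb.F \<le> 11 * t" "card sb.St \<le> 11 * t + 1" "card sb.En \<le> 11 * t + 1"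
    using sb.card_F sb.card_St sb.card_En by (auto simp: t_def)
  have cZ: "card Z1 \<le> 22 * t + 1" "card Z2 \<le> 22 * t + 1" "card Z3 \<le> 33 * t + 2"
    using cF card_Un_le[of sb.F sb.St] card_Un_le[of sb.F sb.En] card_Un_le[of "sb.F \<union> sb.St" sb.En]
    by (auto simp: Z1_def Z2_def Z3_def)
  define bad where "bad Z = {k \<in> fibre S I \<kappa>0. dens S R Z k < m0 / 4}" for Z
  have bad: "card (bad Z) \<le> m0 / 4 * h ^ (R - t)" if "I \<subseteq> Z" "Z \<subseteq> {..<R}" for Z
    using card_sparse_subfibres[OF S' that, of "m0 / 4" \<kappa>0] m0 by (simp add: bad_def h_def t_def)
  \<comment> \<open>Each bad set takes at most a quarter of the fibre, so the three of them cannot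
    cover it. The tuple found serves as the common boundary value.\<close>
  have "\<exists>\<kappa>\<in>fibre S I \<kappa>0. \<kappa> \<notin> bad Z1 \<union> bad Z2 \<union> bad Z3"
  proof (rule ccontr)
    assume "\<not> ?thesis"
    then have "card (fibre S I \<kappa>0) \<le> card (bad Z1 \<union> bad Z2 \<union> bad Z3)"
      using finS by (intro card_mono) (auto simp: bad_def fibre_def)
    also have "\<dots> \<le> card (bad Z1) + card (bad Z2) + card (bad Z3)"
      using card_Un_le[of "bad Z1 \<union> bad Z2" "bad Z3"] card_Un_le[of "bad Z1" "bad Z2"] by linarith
    finally have "real (card (fibre S I \<kappa>0)) \<le> 3 / 4 * (m0 * h ^ (R - t))"
      using bad[OF IZ(1) Z_sub(1)] bad[OF IZ(2) Z_sub(2)] bad[OF IZ(3) Z_sub(3)] by linarith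
    moreover have "real (card (fibre S I \<kappa>0)) = m0 * h ^ (R - t)"
      using card_fibre[of S I \<kappa>0 R] by (simp add: m0_def t_def h_def)
    moreover have "m0 * h ^ (R - t) > 0" using m0 h1 by simp
    ultimately show False by linarith
  qed
  then obtain \<kappa> where \<kappa>: "\<kappa> \<in> fibre S I \<kappa>0" "\<kappa> \<notin> bad Z1" "\<kappa> \<notin> bad Z2" "\<kappa> \<notin> bad Z3" by blast
  have \<kappa>S: "\<kappa> \<in> S" using \<kappa>(1) by (simp add: fibre_def)
  define E where "E = sb.E"
  interpret X: mixing_box H p N u d m E
    by unfold_locales (simp add: E_def)
  have finE: "finite E" by (simp add: E_def)
  have E_sub: "E \<subseteq> {..<R}" "Suc ` E \<subseteq> {..<R}"
    using sb.subs(2) by (auto simp: E_def sb.E_def R_def)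
  have \<sigma>1: "inj_on Suc E" "Suc ` E = {..<R} - Z1"
    using sb.V_St_E sb.subs(1) by (auto simp: E_def Z1_def R_def sb.V_def)
  have \<sigma>2: "inj_on (\<lambda>i. i) E" "(\<lambda>i. i) ` E = {..<R} - Z2"
    using sb.V_En_E(1) sb.subs(1) by (auto simp: E_def Z2_def R_def sb.V_def)
  define e1 where "e1 = emb R Z1 E Suc \<kappa>"
  define e2 where "e2 = emb R Z2 E (\<lambda>i. i) \<kappa>"
  define M where "M = {..<11 * b} - Z3"
  have cM: "card Z3 + card M = R"
    using Z_sub(3) card_mono[OF _ Z_sub(3)] finite_subset[OF Z_sub(3)]
    by (simp add: M_def card_Diff_subset R_def)
  define Y where "Y = fibre S Z3 \<kappa>"
  define f where "f \<xi> = (if e1 \<xi> \<in> S then 1 else 0 :: real)" for \<xi>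
  define g where "g \<xi> = (if e2 \<xi> \<in> S then 1 else 0 :: real)" for \<xi>
  define w where "w \<omega> = card {y \<in> Y. edges E y = \<omega>} * real (card H) ^ card E / card H ^ card M" for \<omega>
  have fb: "(\<Sum>\<xi>\<in>hbox E H. f \<xi>) / card (hbox E H) = dens S R Z1 \<kappa>"
    unfolding f_def e1_def by (rule emb_mean[OF S' Z_sub(1) finE \<sigma>1])
  have gb: "(\<Sum>\<xi>\<in>hbox E H. g \<xi>) / card (hbox E H) = dens S R Z2 \<kappa>"
    unfolding g_def e2_def by (rule emb_mean[OF S' Z_sub(2) finE \<sigma>2])
  have wb: "(\<Sum>\<xi>\<in>hbox E H. w \<xi>) / card (hbox E H) = dens S R Z3 \<kappa>"
    unfolding w_def Y_def by (rule edges_mean[OF S' finE E_sub cM])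
  have dens_ge: "dens S R Z1 \<kappa> \<ge> m0 / 4" "dens S R Z2 \<kappa> \<ge> m0 / 4" "dens S R Z3 \<kappa> \<ge> m0 / 4"
    using \<kappa> by (auto simp: bad_def not_less)
  define \<rho> where "\<rho> i = 4 * real (33 + 2 * i) powr C" for i
  have dens_le: "dens S R Z \<gamma> \<le> m0 * real (33 + 2 * i) powr C"
    if "Z \<subseteq> {..<R}" "card Z \<le> 33 * t + 2 + 2 * i" for Z \<gamma> i
  proof -
    have "dens S R Z \<gamma> \<le> m0 * (real (card Z + 1) / real (t + 1)) powr C"
      using spread[OF that(1), of \<gamma>] by (simp add: m0_def t_def)
    also have "\<dots> \<le> m0 * real (33 + 2 * i) powr C"
      using that(2) m0 by (intro spread_ratio_le C) (auto simp: algebra_simps)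
    finally show ?thesis .
  qed
  have \<rho>_le: "m0 * real (33 + 2 * i) powr C \<le> \<rho> i * x" if "x \<ge> m0 / 4" for i x
    using mult_left_mono[OF that, of "\<rho> i"] by (simp add: \<rho>_def mult_ac)
  have "(\<Sum>x\<in>hbox E H. \<Sum>y\<in>hbox E H. f y * g (- y + x) * w x)
    \<ge> (real (card (hbox E H)))\<^sup>2 * ((\<Sum>\<xi>\<in>hbox E H. f \<xi>) / card (hbox E H)) * ((\<Sum>\<xi>\<in>hbox E H. g \<xi>) / card (hbox E H))
        * ((\<Sum>\<xi>\<in>hbox E H. w \<xi>) / card (hbox E H)) * (2 - (1 + \<tau>) ^ card E)"
  proof (rule X.trilinear_lower_bound[where kf = \<rho> and kg = \<rho> and kh = "\<lambda>i. \<rho> i * card H ^ (i div 10)"])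
    show "(2 * lam) ^ i * (sqrt (\<rho> i) * sqrt (\<rho> i) * sqrt (\<rho> i * card H ^ (i div 10))) \<le> \<tau> ^ i" if "i > 0" for i
      unfolding \<rho>_def by (rule spread_factors_le[OF C that \<tau>(1)])
    fix J x assume J: "J \<subseteq> E" "J \<noteq> {}"
    have cJ: "card (Suc ` J) \<le> card J" "card ((\<lambda>i. i) ` J) \<le> card J"
      using J(1) finE finite_subset by (auto intro: card_image_le)
    have "X.avg (E - J) f x \<le> dens S R (Z1 \<union> Suc ` J) (e1 x)"
      unfolding X.avg_def f_def e1_def by (rule emb_avg_le[OF S' Z_sub(1) finE \<sigma>1 J(1)])
    also have "\<dots> \<le> m0 * real (33 + 2 * card J) powr C"
      using J(1) E_sub(2) Z_sub(1) card_Un_le[of Z1 "Suc ` J"] cJ cZ by (intro dens_le) auto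
    also have "\<dots> \<le> \<rho> (card J) * dens S R Z1 \<kappa>" by (rule \<rho>_le[OF dens_ge(1)])
    finally show "X.avg (E - J) f x \<le> \<rho> (card J) * ((\<Sum>\<xi>\<in>hbox E H. f \<xi>) / card (hbox E H))"
      unfolding fb .
    have "X.avg (E - J) g x \<le> dens S R (Z2 \<union> (\<lambda>i. i) ` J) (e2 x)"
      unfolding X.avg_def g_def e2_def by (rule emb_avg_le[OF S' Z_sub(2) finE \<sigma>2 J(1)])
    also have "\<dots> \<le> m0 * real (33 + 2 * card J) powr C"
      using J(1) E_sub(1) Z_sub(2) card_Un_le[of Z2 "(\<lambda>i. i) ` J"] cJ cZ by (intro dens_le) auto
    also have "\<dots> \<le> \<rho> (card J) * dens S R Z2 \<kappa>" by (rule \<rho>_le[OF dens_ge(2)])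
    finally show "X.avg (E - J) g x \<le> \<rho> (card J) * ((\<Sum>\<xi>\<in>hbox E H. g \<xi>) / card (hbox E H))"
      unfolding gb .
    have "X.avg (E - J) w x \<le> card {y \<in> Y. \<forall>i\<in>J. y (Suc i) + y i = x i} * real (card H) ^ card J / card H ^ card M"
      using edges_avg_le[OF S' finE J(1), where Z = Z3 and \<kappa> = \<kappa> and \<omega> = x and M = "card M"]
      unfolding X.avg_def w_def Y_def by (simp only: of_nat_power)
    also have "\<dots> \<le> (m0 * real (33 + 2 * card J) powr C) * card H ^ (card J div 10)"
      unfolding Y_def M_def Z3_def
    proof (rule edges_count_le)
      show "superblocks b I" by (rule sb.superblocks_axioms)
      show "S \<subseteq> hbox {..<11 * b} H" by (rule S)
      show "J \<subseteq> sb.E" using J(1) by (simp add: E_def)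
      show "0 \<le> m0 * real (33 + 2 * card J) powr C" using m0 by simp
      fix X' \<gamma> assume X': "X' \<subseteq> {..<11 * b} - (sb.F \<union> sb.St \<union> sb.En)" "card X' \<le> 2 * card J"
      show "dens S (11 * b) (sb.F \<union> sb.St \<union> sb.En \<union> X') \<gamma> \<le> m0 * real (33 + 2 * card J) powr C"
        using dens_le[of "Z3 \<union> X'" "card J" \<gamma>] X' Z_sub(3) card_Un_le[of Z3 X'] cZ(3)
        by (auto simp: Z3_def R_def)
    qed
    also have "\<dots> \<le> \<rho> (card J) * dens S R Z3 \<kappa> * card H ^ (card J div 10)"
      by (intro mult_right_mono \<rho>_le[OF dens_ge(3)]) simp
    finally show "X.avg (E - J) w x \<le> \<rho> (card J) * card H ^ (card J div 10) * ((\<Sum>\<xi>\<in>hbox E H. w \<xi>) / card (hbox E H))"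
      unfolding wb by (simp add: mult_ac)
  qed (auto simp: f_def g_def w_def \<rho>_def)
  then have lower: "(\<Sum>x\<in>hbox E H. \<Sum>y\<in>hbox E H. f y * g (- y + x) * w x)
    \<ge> (real (card (hbox E H)))\<^sup>2 * dens S R Z1 \<kappa> * dens S R Z2 \<kappa> * dens S R Z3 \<kappa> * (2 - (1 + \<tau>) ^ card E)"
    unfolding fb gb wb .
  have \<tau>0: "\<tau> \<ge> 0" using \<tau>(1) lam_nonneg by (intro order_trans[OF _ \<tau>(1)]) auto
  have cE: "b \<le> card E" "card E \<le> 11 * b"
    using sb.card_E sb.card_V cF t_le E_sub(1) card_mono[of "{..<R}" E] by (auto simp: E_def R_def)
  have "(1 + \<tau>) ^ card E \<le> (1 + \<tau>) ^ (11 * b)"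
    using cE \<tau>0 by (intro power_increasing) auto
  then have half: "2 - (1 + \<tau>) ^ card E \<ge> 1 / 2" using \<tau>(2) by simp
  define G where "G = real (card (hbox E H))"
  have G: "G = h ^ card E" by (simp add: G_def h_def card_hbox finE)
  have G_pos: "G > 0" using h1 by (simp add: G)
  show ?thesis
  proof (rule ccontr)
    assume no: "\<not> thesis"
    \<comment> \<open>For \<open>y\<close> with edge sums \<open>x\<close>, a pair counted by
      \<open>f\<close> and \<open>g\<close> produces the candidate
      \<open>v = - y + e1 \<xi>\<close>. Unless it is a solution, \<open>v = 0\<close>, which
      happens only for \<open>\<xi> = \<xi>y\<close>.\<close>
    have upper: "(\<Sum>y\<in>hbox E H. f y * g (- y + x) * w x) \<le> w x" if x: "x \<in> hbox E H" for x
    proof (cases "{y \<in> Y. edges E y = x} = {}")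
      case True
      then have "w x = 0" unfolding w_def True by simp
      then show ?thesis by simp
    next
      case False
      then obtain y where y: "y \<in> Y" "edges E y = x" by blast
      have yS: "y \<in> S" and yZ: "\<And>i. i \<in> Z3 \<Longrightarrow> y i = \<kappa> i" using y(1) by (auto simp: Y_def fibre_def)
      define \<xi>y where "\<xi>y = (\<lambda>i. if i \<in> E then y (Suc i) else 0)"
      have "f \<xi> * g (- \<xi> + x) = 0" if \<xi>: "\<xi> \<in> hbox E H" "\<xi> \<noteq> \<xi>y" for \<xi>
      proof (rule ccontr)
        assume "f \<xi> * g (- \<xi> + x) \<noteq> 0"
        then have xz: "e1 \<xi> \<in> S" "e2 (- \<xi> + x) \<in> S" by (auto simp: f_def g_def split: if_splits)
        define v where "v = - y + e1 \<xi>"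
        have supp: "y i = 0" "e1 \<xi> i = 0" if "i \<ge> R" for i
          using that S' yS xz(1) by (auto simp: hbox_def)
        have v_Z1: "v i = 0" if "i \<in> Z1 \<or> i \<ge> R" for i
          using that supp yZ by (auto simp: v_def e1_def emb_def Z1_def Z3_def)
        have v_E: "v (Suc i) = - y (Suc i) + \<xi> i" if "i \<in> E" for i
          using emb_image[OF \<sigma>1 that, of \<kappa> \<xi>] by (simp add: v_def e1_def)
        have mem: "v \<in> hbox {..<11 * b} H"
        proof -
          have "y \<in> hbox {..<R} H" "e1 \<xi> \<in> hbox {..<R} H" using yS xz(1) S' by blast+
          then show ?thesis
            using supp by (auto simp: v_def hbox_def R_def intro!: add_mem uminus_mem)
        qed
        \<comment> \<open>Coordinate 0 lies in \<open>F\<close> or starts a run; in both cases it is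
          in \<open>Z1\<close>.\<close>
        have "v 0 = 0"
        proof (rule v_Z1)
          have "0 < R" using b by (simp add: R_def)
          then show "0 \<in> Z1 \<or> 0 \<ge> R" by (auto simp: Z1_def sb.St_def sb.V_def R_def)
        qed
        moreover have "v \<noteq> 0"
        proof
          assume "v = 0"
          have "\<xi> = \<xi>y"
          proof
            fix i
            show "\<xi> i = \<xi>y i"
            proof (cases "i \<in> E")
              case True
              then show ?thesis using v_E[OF True] \<open>v = 0\<close> by (simp add: \<xi>y_def add_eq_0_iff)
            qed (use \<xi>(1) in \<open>simp add: \<xi>y_def hbox_def\<close>)
          qed
          then show False using \<xi>(2) by simp
        qed
        moreover have "y + v \<in> S" using xz(1) by (simp add: v_def add.assoc[symmetric])
        moreover have "(\<lambda>i. - v (Suc i) + y i) \<in> S"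
        proof -
          have "e2 (- \<xi> + x) = (\<lambda>i. - v (Suc i) + y i)"
            unfolding e2_def
          proof (rule emb_eqI[OF \<sigma>2])
            show "(\<lambda>i. - v (Suc i) + y i) \<in> hbox {..<R} H"
              unfolding hbox_def
            proof (intro CollectI conjI ballI allI impI)
              fix i
              have "v (Suc i) \<in> H" using mem zero_mem by (cases "Suc i < 11 * b") (auto simp: hbox_def)
              moreover have "y \<in> hbox {..<R} H" using yS S' by blast
              ultimately show "- v (Suc i) + y i \<in> H" if "i \<in> {..<R}"
                using that by (intro add_mem uminus_mem) (auto simp: hbox_def)
              show "- v (Suc i) + y i = 0" if "i \<notin> {..<R}"
              proof -
                have "v (Suc i) = 0" by (rule v_Z1) (use that in auto)
                then show ?thesis using that supp(1)[of i] by simp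
              qed
            qed
            fix i
            show "- v (Suc i) + y i = \<kappa> i" if "i \<in> Z2"
            proof -
              have "i \<notin> E" using that \<sigma>2(2) by auto
              then have "Suc i \<in> Z1 \<or> Suc i \<ge> R" using \<sigma>1(2) by (metis DiffI Suc_inject imageE lessThan_iff not_less)
              then show ?thesis using v_Z1[of "Suc i"] yZ[of i] that by (auto simp: Z2_def Z3_def)
            qed
            show "- v (Suc i) + y i = (- \<xi> + x) i" if "i \<in> E"
              using v_E[OF that] y(2) that by (auto simp: edges_def minus_add add.assoc)
          qed
          then show ?thesis using xz(2) by simp
        qed
        ultimately show False using no solution[of y v] yS mem by blast
      qed
      note zero = this
      have "(\<Sum>\<xi>\<in>hbox E H. f \<xi> * g (- \<xi> + x)) \<le> (\<Sum>\<xi>\<in>hbox E H. if \<xi> = \<xi>y then 1 else 0)"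
      proof (rule sum_mono)
        fix \<xi> assume \<xi>: "\<xi> \<in> hbox E H"
        show "f \<xi> * g (- \<xi> + x) \<le> (if \<xi> = \<xi>y then 1 else 0)"
        proof (cases "\<xi> = \<xi>y")
          case False
          then show ?thesis unfolding zero[OF \<xi> False] by simp
        qed (simp add: f_def g_def)
      qed
      also have "\<dots> \<le> 1" using finite_hbox[OF finE finite_carrier] by (simp add: sum.delta)
      finally have "(\<Sum>\<xi>\<in>hbox E H. f \<xi> * g (- \<xi> + x)) * w x \<le> 1 * w x"
        by (intro mult_right_mono) (auto simp: w_def)
      then show ?thesis by (simp add: sum_distrib_right)
    qed
    have "(\<Sum>x\<in>hbox E H. \<Sum>y\<in>hbox E H. f y * g (- y + x) * w x) \<le> (\<Sum>x\<in>hbox E H. w x)"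
      by (intro sum_mono upper)
    also have "\<dots> = G * dens S R Z3 \<kappa>"
      using wb G_pos by (simp add: G_def field_simps)
    finally have "G\<^sup>2 * dens S R Z1 \<kappa> * dens S R Z2 \<kappa> * dens S R Z3 \<kappa> * (2 - (1 + \<tau>) ^ card E) \<le> G * dens S R Z3 \<kappa>"
      using lower by (simp add: G_def)
    moreover have "G\<^sup>2 * dens S R Z1 \<kappa> * dens S R Z2 \<kappa> * dens S R Z3 \<kappa> * (1 / 2)
      \<le> G\<^sup>2 * dens S R Z1 \<kappa> * dens S R Z2 \<kappa> * dens S R Z3 \<kappa> * (2 - (1 + \<tau>) ^ card E)"
      by (intro mult_left_mono half mult_nonneg_nonneg dens_nonneg) simp
    ultimately have "(G * dens S R Z3 \<kappa>) * (G * (dens S R Z1 \<kappa> * dens S R Z2 \<kappa>) / 2) \<le> (G * dens S R Z3 \<kappa>) * 1"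
      by (simp add: power2_eq_square mult_ac)
    moreover have "G * dens S R Z3 \<kappa> > 0" using G_pos dens_ge(3) m0 by simp
    ultimately have "G * (dens S R Z1 \<kappa> * dens S R Z2 \<kappa>) \<le> 2"
      by (simp add: mult_le_cancel_left_pos)
    moreover have "(\<delta> / 4) * (\<delta> / 4) \<le> dens S R Z1 \<kappa> * dens S R Z2 \<kappa>"
      using dens_ge \<delta>m0 \<delta>0 by (intro mult_mono) auto
    then have "G * ((\<delta> / 4) * (\<delta> / 4)) \<le> G * (dens S R Z1 \<kappa> * dens S R Z2 \<kappa>)"
      using G_pos by simp
    moreover have "h ^ b \<le> G" unfolding G using cE h1 by (intro power_increasing) auto
    then have "h ^ b * ((\<delta> / 4) * (\<delta> / 4)) \<le> G * ((\<delta> / 4) * (\<delta> / 4))"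
      using \<delta>0 by (intro mult_right_mono) auto
    \<comment> \<open>The threshold 32 is \<open>4 * 4 * 2\<close>: two densities of at least
      \<open>\<delta> / 4\<close> and half of the main term.\<close>
    ultimately show False using \<delta>(3) by (simp add: h_def power2_eq_square mult_ac)
  qed
qed

end

section \<open>The special linear group of a prime field\<close>

text \<open>A type of its own makes bijections under composition an instance of
  \<open>group_add\<close>, which does not assume commutativity. Hence the additive notation for
  matrices, and pointwise arithmetic for tuples of them.\<close>

typedef 'a bijection = "{f :: 'a \<Rightarrow> 'a. bij f}"
  morphisms apply_bij Abs_bij
  by (rule exI[of _ id]) simp

instantiation bijection :: (type) group_add
begin

definition zero_bijection :: "'a bijection" where "0 = Abs_bij id"
definition plus_bijection :: "'a bijection \<Rightarrow> 'a bijection \<Rightarrow> 'a bijection" where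
  "f + g = Abs_bij (apply_bij f \<circ> apply_bij g)"
definition uminus_bijection :: "'a bijection \<Rightarrow> 'a bijection" where
  "- f = Abs_bij (inv_into UNIV (apply_bij f))"
definition minus_bijection :: "'a bijection \<Rightarrow> 'a bijection \<Rightarrow> 'a bijection" where
  "f - g = f + - (g :: 'a bijection)"

lemma bij_apply_bij: "bij (apply_bij f)"
  using apply_bij[of f] by simp

lemma apply_bij_simps:
  "apply_bij 0 = id" "apply_bij (f + g) = apply_bij f \<circ> apply_bij g" "apply_bij (- f) = inv_into UNIV (apply_bij f)"
  using bij_apply_bij[of f] bij_apply_bij[of g]
  by (simp_all add: zero_bijection_def plus_bijection_def uminus_bijection_def Abs_bij_inverse
      bij_comp bij_imp_bij_inv)

instance
proof
  fix a b c :: "'a bijection"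
  show "a + b + c = a + (b + c)"
    by (rule apply_bij_inject[THEN iffD1]) (simp add: apply_bij_simps o_assoc)
  show "0 + a = a" "a + 0 = a"
    by (rule apply_bij_inject[THEN iffD1], simp add: apply_bij_simps)+
  show "- a + a = 0"
    by (rule apply_bij_inject[THEN iffD1])
      (simp add: apply_bij_simps bij_is_inj[OF bij_apply_bij] inv_o_cancel)
  show "a + - b = a - b" by (simp add: minus_bijection_def)
qed

end

lemma bijection_eqI: "(\<And>x. apply_bij f x = apply_bij g x) \<Longrightarrow> f = g"
  by (rule apply_bij_inject[THEN iffD1]) (rule ext)

text \<open>The plane over the field with \<open>p\<close> elements is represented by residues in
  \<open>{0..<int p}\<close>. Outside it the map is the identity, so that matrices of determinant 1
  give bijections of the whole type.\<close>

definition mat_act :: "nat \<Rightarrow> int \<Rightarrow> int \<Rightarrow> int \<Rightarrow> int \<Rightarrow> int \<times> int \<Rightarrow> int \<times> int" where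
  "mat_act p a b c d = (\<lambda>(x, y). if x \<in> {0..<int p} \<and> y \<in> {0..<int p}
     then ((a * x + b * y) mod int p, (c * x + d * y) mod int p) else (x, y))"

definition mat :: "nat \<Rightarrow> int \<Rightarrow> int \<Rightarrow> int \<Rightarrow> int \<Rightarrow> (int \<times> int) bijection" where
  "mat p a b c d = Abs_bij (mat_act p a b c d)"

definition SL2 :: "nat \<Rightarrow> (int \<times> int) bijection set" where
  "SL2 p = {mat p a b c d | a b c d. [a * d - b * c = 1] (mod int p)}"

lemma SL2I: "[a * d - b * c = 1] (mod int p) \<Longrightarrow> mat p a b c d \<in> SL2 p"
  unfolding SL2_def by blast

lemma mat_act_comp:
  assumes "p > 0"
  shows "mat_act p a b c d \<circ> mat_act p a' b' c' d'
    = mat_act p (a * a' + b * c') (a * b' + b * d') (c * a' + d * c') (c * b' + d * d')"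
proof
  fix z :: "int \<times> int"
  obtain x y where z: "z = (x, y)" by (cases z)
  have "(a * ((a' * x + b' * y) mod int p) + b * ((c' * x + d' * y) mod int p)) mod int p
     = ((a * a' + b * c') * x + (a * b' + b * d') * y) mod int p" for a b
  proof -
    have "[a * ((a' * x + b' * y) mod int p) + b * ((c' * x + d' * y) mod int p)
        = a * (a' * x + b' * y) + b * (c' * x + d' * y)] (mod int p)"
      by (intro cong_add cong_mult cong_refl) (simp_all add: unique_euclidean_semiring_class.cong_def)
    then show ?thesis by (simp add: unique_euclidean_semiring_class.cong_def algebra_simps)
  qed
  then show "(mat_act p a b c d \<circ> mat_act p a' b' c' d') z
    = mat_act p (a * a' + b * c') (a * b' + b * d') (c * a' + d * c') (c * b' + d * d') z"
    using assms by (simp add: z mat_act_def)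
qed

lemma mat_act_cong:
  assumes "[a = a'] (mod int p)" "[b = b'] (mod int p)" "[c = c'] (mod int p)" "[d = d'] (mod int p)"
  shows "mat_act p a b c d = mat_act p a' b' c' d'"
proof -
  have "[a * x + b * y = a' * x + b' * y] (mod int p)" "[c * x + d * y = c' * x + d' * y] (mod int p)" for x y
    by (intro cong_add cong_mult assms cong_refl)+
  then show ?thesis by (auto simp: mat_act_def fun_eq_iff unique_euclidean_semiring_class.cong_def)
qed

lemma mat_act_id: "mat_act p 1 0 0 1 = id"
  by (auto simp: mat_act_def fun_eq_iff)

lemma bij_mat_act:
  assumes p: "p > 0" and det: "[a * d - b * c = 1] (mod int p)"
  shows "bij (mat_act p a b c d)"
proof (rule o_bij)
  have det': "[d * a + - b * c = 1] (mod int p)" "[- c * b + a * d = 1] (mod int p)"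
    "[a * d + b * - c = 1] (mod int p)" "[c * - b + d * a = 1] (mod int p)"
    using det by (simp_all add: algebra_simps)
  have z: "d * b + - b * d = 0" "- c * a + a * c = 0" "a * - b + b * a = 0" "c * d + d * - c = 0"
    by simp_all
  show "mat_act p d (- b) (- c) a \<circ> mat_act p a b c d = id"
    unfolding mat_act_comp[OF p] z mat_act_id[of p, symmetric]
    by (intro mat_act_cong det' cong_refl)
  show "mat_act p a b c d \<circ> mat_act p d (- b) (- c) a = id"
    unfolding mat_act_comp[OF p] z mat_act_id[of p, symmetric]
    by (intro mat_act_cong det' cong_refl)
qed

lemma apply_mat:
  "p > 0 \<Longrightarrow> [a * d - b * c = 1] (mod int p) \<Longrightarrow> apply_bij (mat p a b c d) = mat_act p a b c d"
  by (simp add: mat_def Abs_bij_inverse bij_mat_act)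

lemma mat_cong:
  assumes "[a = a'] (mod int p)" "[b = b'] (mod int p)" "[c = c'] (mod int p)" "[d = d'] (mod int p)"
  shows "mat p a b c d = mat p a' b' c' d'"
  by (simp only: mat_def mat_act_cong[OF assms])

lemma mat_add:
  assumes "p > 0" "[a * d - b * c = 1] (mod int p)" "[a' * d' - b' * c' = 1] (mod int p)"
  shows "mat p a b c d + mat p a' b' c' d'
    = mat p (a * a' + b * c') (a * b' + b * d') (c * a' + d * c') (c * b' + d * d')"
  unfolding plus_bijection_def apply_mat[OF assms(1,2)] apply_mat[OF assms(1,3)] mat_act_comp[OF assms(1)]
  by (simp add: mat_def)

lemma det_mult:
  assumes "[a * d - b * c = 1] (mod m)" "[a' * d' - b' * c' = 1] (mod (m :: int))"
  shows "[(a * a' + b * c') * (c * b' + d * d') - (a * b' + b * d') * (c * a' + d * c') = 1] (mod m)"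
proof -
  have "(a * a' + b * c') * (c * b' + d * d') - (a * b' + b * d') * (c * a' + d * c')
    = (a * d - b * c) * (a' * d' - b' * c')" by (simp add: algebra_simps)
  then show ?thesis using cong_mult[OF assms] by simp
qed

lemma mat_zero: "mat p 1 0 0 1 = 0"
  by (simp add: mat_def mat_act_id zero_bijection_def)

lemma mat_eq_cong:
  assumes p: "p > 1" and "[a * d - b * c = 1] (mod int p)" "[a' * d' - b' * c' = 1] (mod int p)"
    and eq: "mat p a b c d = mat p a' b' c' d'"
  shows "[a = a'] (mod int p)" "[b = b'] (mod int p)" "[c = c'] (mod int p)" "[d = d'] (mod int p)"
proof -
  have p0: "p > 0" using p by simp
  have "mat_act p a b c d = mat_act p a' b' c' d'"
    using arg_cong[OF eq, of apply_bij] p0 by (simp only: apply_mat[OF p0 assms(2)] apply_mat[OF p0 assms(3)])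
  then have "mat_act p a b c d (1, 0) = mat_act p a' b' c' d' (1, 0)"
    "mat_act p a b c d (0, 1) = mat_act p a' b' c' d' (0, 1)" by simp_all
  then show "[a = a'] (mod int p)" "[b = b'] (mod int p)" "[c = c'] (mod int p)" "[d = d'] (mod int p)"
    using p by (simp_all add: mat_act_def unique_euclidean_semiring_class.cong_def)
qed

text \<open>If the lower left entry is nonzero, the other entries of \<open>(a, c, d)\<close>
  determine \<open>b\<close>; if it is 0, then \<open>a\<close> is a unit and determines
  \<open>d\<close>. The counts \<open>p * (p - 1) * p\<close> and \<open>p * p\<close> add up to
  \<open>p ^ 3\<close>.\<close>

lemma SL2_subgroup_and_card:
  assumes "prime p"
  shows "finite_add_subgroup (SL2 p)" "card (SL2 p) \<le> p ^ 3"
proof -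
  have p: "p > 1" using assms prime_gt_1_nat by blast
  define D where "D = {(a, b, c, d) \<in> {0..<int p} \<times> {0..<int p} \<times> {0..<int p} \<times> {0..<int p}.
     [a * d - b * c = 1] (mod int p)}"
  define D1 where "D1 = {z \<in> D. case z of (a, b, c, d) \<Rightarrow> c \<noteq> 0}"
  define D2 where "D2 = {z \<in> D. case z of (a, b, c, d) \<Rightarrow> c = 0}"
  have finD: "finite D" unfolding D_def by (rule finite_subset[of _ "{0..<int p} \<times> {0..<int p} \<times> {0..<int p} \<times> {0..<int p}"]) auto
  have SL2_sub: "SL2 p \<subseteq> (\<lambda>(a, b, c, d). mat p a b c d) ` D"
  proof
    fix g assume "g \<in> SL2 p"
    then obtain a b c d where g: "g = mat p a b c d" "[a * d - b * c = 1] (mod int p)" by (auto simp: SL2_def)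
    have "[(a mod int p) * (d mod int p) - (b mod int p) * (c mod int p) = 1] (mod int p)"
    proof -
      have "[(a mod int p) * (d mod int p) - (b mod int p) * (c mod int p) = a * d - b * c] (mod int p)"
        by (intro cong_diff cong_mult) (simp_all add: unique_euclidean_semiring_class.cong_def)
      then show ?thesis using g(2) by (rule cong_trans)
    qed
    then have "(a mod int p, b mod int p, c mod int p, d mod int p) \<in> D" using p by (simp add: D_def)
    moreover have "g = mat p (a mod int p) (b mod int p) (c mod int p) (d mod int p)"
      unfolding g(1) by (intro mat_cong) (simp_all add: unique_euclidean_semiring_class.cong_def)
    ultimately show "g \<in> (\<lambda>(a, b, c, d). mat p a b c d) ` D" by force
  qed
  have unit: "[x = y] (mod int p)" if "[c * x = c * y] (mod int p)" "0 < c" "c < int p" for c x y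
  proof -
    have "\<not> int p dvd c" using that(2,3) zdvd_not_zless by blast
    then have "coprime c (int p)" using assms
      by (metis coprime_commute prime_imp_coprime prime_nat_int_transfer)
    then show ?thesis using that(1) by (simp add: cong_mult_lcancel)
  qed
  have small: "x = y" if "[x = y] (mod int p)" "0 \<le> x" "x < int p" "0 \<le> y" "y < int p" for x y
    using that by (simp add: unique_euclidean_semiring_class.cong_def)
  have "card D1 \<le> card ({0..<int p} \<times> {1..<int p} \<times> {0..<int p})"
  proof (rule card_inj_on_le)
    show "inj_on (\<lambda>(a, b, c, d). (a, c, d)) D1"
    proof (rule inj_onI)
      fix z z' assume z: "z \<in> D1" "z' \<in> D1" "(\<lambda>(a, b, c, d). (a, c, d)) z = (\<lambda>(a, b, c, d). (a, c, d)) z'"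
      obtain a b c d where z1: "z = (a, b, c, d)" by (cases z)
      obtain b' where z2: "z' = (a, b', c, d)" using z(3) z1 by (cases z') auto
      have mem: "0 < c" "c < int p" "0 \<le> b" "b < int p" "0 \<le> b'" "b' < int p"
        using z(1,2) unfolding z1 z2 D1_def D_def by auto
      have "[a * d - b * c = a * d - b' * c] (mod int p)"
        using z z1 z2 by (auto simp: D1_def D_def unique_euclidean_semiring_class.cong_def)
      then have "int p dvd (a * d - b * c) - (a * d - b' * c)" by (simp only: cong_iff_dvd_diff)
      also have "(a * d - b * c) - (a * d - b' * c) = c * b' - c * b" by (simp add: algebra_simps)
      finally have "[c * b' = c * b] (mod int p)" by (simp only: cong_iff_dvd_diff)
      then have "[c * b = c * b'] (mod int p)" by (rule cong_sym)
      then have "[b = b'] (mod int p)" by (rule unit[OF _ mem(1,2)])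
      then have "b = b'" by (rule small[OF _ mem(3-6)])
      then show "z = z'" by (simp add: z1 z2)
    qed
  qed (auto simp: D1_def D_def)
  moreover have "card D2 \<le> card ({0..<int p} \<times> {0..<int p})"
  proof (rule card_inj_on_le)
    show "inj_on (\<lambda>(a, b, c, d). (a, b)) D2"
    proof (rule inj_onI)
      fix z z' assume z: "z \<in> D2" "z' \<in> D2" "(\<lambda>(a, b, c, d). (a, b)) z = (\<lambda>(a, b, c, d). (a, b)) z'"
      obtain a b d where z1: "z = (a, b, 0, d)" using z(1) by (auto simp: D2_def)
      obtain d' where z2: "z' = (a, b, 0, d')" using z z1 by (auto simp: D2_def)
      have ad: "[a * d = 1] (mod int p)" "[a * d' = 1] (mod int p)" using z z1 z2 by (auto simp: D2_def D_def)
      then have eq: "[a * d = a * d'] (mod int p)" by (metis cong_sym cong_trans)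
      have "a \<noteq> 0"
      proof
        assume "a = 0"
        then show False using ad(1) p by (simp add: unique_euclidean_semiring_class.cong_def)
      qed
      then have mem: "0 < a" "a < int p" "0 \<le> d" "d < int p" "0 \<le> d'" "d' < int p"
        using z(1,2) unfolding z1 z2 D2_def D_def by auto
      have "[d = d'] (mod int p)" by (rule unit[OF eq mem(1,2)])
      then have "d = d'" by (rule small[OF _ mem(3-6)])
      then show "z = z'" by (simp add: z1 z2)
    qed
  qed (auto simp: D2_def D_def)
  moreover have "card D \<le> card D1 + card D2"
  proof -
    have "D = D1 \<union> D2" by (auto simp: D1_def D2_def)
    then show ?thesis using card_Un_le by metis
  qed
  moreover have "nat (int p - 1) = p - 1" by simp
  ultimately have "card D \<le> p * ((p - 1) * p) + p * p"
    by (simp add: card_cartesian_product)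
  also have "\<dots> = p ^ 3" using p by (cases p) (simp_all add: power3_eq_cube algebra_simps)
  finally have cardD: "card D \<le> p ^ 3" .
  show "card (SL2 p) \<le> p ^ 3"
    using card_mono[OF _ SL2_sub] card_image_le[OF finD, of "\<lambda>(a, b, c, d). mat p a b c d"] finD cardD
    by (meson finite_imageI le_trans)
  show "finite_add_subgroup (SL2 p)"
  proof
    show "finite (SL2 p)" using finite_subset[OF SL2_sub] finD by simp
    have "[1 * 1 - 0 * 0 = 1] (mod int p)" by simp
    then show "0 \<in> SL2 p" unfolding SL2_def mat_zero[of p, symmetric] by blast
    fix x y assume xy: "x \<in> SL2 p" "y \<in> SL2 p"
    obtain a b c d where x: "x = mat p a b c d" "[a * d - b * c = 1] (mod int p)" using xy by (auto simp: SL2_def)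
    obtain a' b' c' d' where y: "y = mat p a' b' c' d'" "[a' * d' - b' * c' = 1] (mod int p)" using xy by (auto simp: SL2_def)
    show "x + y \<in> SL2 p"
      unfolding x(1) y(1) using x(2) y(2) p det_mult[OF x(2) y(2)] by (auto simp: mat_add SL2_def)
    have inv: "[d * a - (- b) * (- c) = 1] (mod int p)" using x(2) by (simp add: mult.commute)
    have "x + mat p d (- b) (- c) a = mat p (a * d + b * - c) (a * - b + b * a) (c * d + d * - c) (c * - b + d * a)"
      unfolding x(1) using x(2) inv p by (intro mat_add) auto
    also have "\<dots> = mat p 1 0 0 1"
      using x(2) by (intro mat_cong) (simp_all add: algebra_simps)
    finally have "- x = mat p d (- b) (- c) a" by (simp add: mat_zero add_eq_0_iff)
    then show "- x \<in> SL2 p" using inv unfolding SL2_def by blast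
  qed
qed

section \<open>Unipotent and diagonal elements\<close>

definition unip :: "nat \<Rightarrow> bool \<Rightarrow> nat \<Rightarrow> (int \<times> int) bijection" where
  "unip p \<tau> s = (if \<tau> then mat p 1 (int s) 0 1 else mat p 1 0 (int s) 1)"

definition inv_mod :: "nat \<Rightarrow> nat \<Rightarrow> nat" where
  "inv_mod p e = (SOME e'. [e * e' = 1] (mod p))"

definition torus :: "nat \<Rightarrow> nat \<Rightarrow> (int \<times> int) bijection" where
  "torus p a = mat p (int (Suc a)) 0 0 (int (inv_mod p (Suc a)))"

text \<open>Conjugation by \<open>torus p a\<close> raises an upper unipotent element to the inverse
  square of \<open>Suc a\<close> and a lower one to its square.\<close>

definition weight :: "nat \<Rightarrow> bool \<Rightarrow> nat \<Rightarrow> nat" where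
  "weight p \<tau> a = (if \<tau> then (inv_mod p (Suc a))\<^sup>2 else (Suc a)\<^sup>2)"

lemma inv_mod:
  assumes "prime p" "Suc a < p"
  shows "[Suc a * inv_mod p (Suc a) = 1] (mod p)"
proof -
  have "coprime (Suc a) p"
    using assms by (metis coprime_commute nat_dvd_not_less prime_imp_coprime_nat zero_less_Suc)
  then have "\<exists>e'. [Suc a * e' = 1] (mod p)" unfolding One_nat_def by (rule cong_solve_coprime_nat)
  then show ?thesis unfolding inv_mod_def by (rule someI_ex)
qed

text \<open>Squares agree mod \<open>p\<close> only for equal or opposite entries. The numbers
  \<open>1..(p - 1) div 2\<close> contain no opposite pair, which is why only half of the torus is
  enumerated.\<close>

lemma cong_squares_imp_eq:
  assumes p: "prime p" and a: "a < (p - 1) div 2" "b < (p - 1) div 2"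
    and eq: "[(Suc a)\<^sup>2 = (Suc b)\<^sup>2] (mod p)"
  shows "a = b"
proof -
  have "[int (Suc a) ^ 2 = int (Suc b) ^ 2] (mod int p)"
    using eq by (metis cong_int_iff of_nat_power)
  then have "int p dvd (int (Suc a)) ^ 2 - (int (Suc b)) ^ 2" by (simp add: cong_iff_dvd_diff)
  also have "(int (Suc a)) ^ 2 - (int (Suc b)) ^ 2 = (int a - int b) * (int a + int b + 2)"
    by (simp add: power2_eq_square algebra_simps)
  finally have "int p dvd int a - int b \<or> int p dvd int a + int b + 2"
    using p by (simp add: prime_dvd_mult_iff)
  moreover have "\<not> int p dvd int a + int b + 2" using a by (intro zdvd_not_zless) linarith+
  ultimately have "int p dvd int a - int b" by blast
  then show ?thesis
    using a zdvd_imp_le[of "int p" "int a - int b"] zdvd_imp_le[of "int p" "int b - int a"]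
    by (cases a b rule: linorder_cases) (auto simp: dvd_diff_commute)
qed

theorem SL2_mixing_group:
  assumes p: "prime p" "p \<ge> 3"
  shows "mixing_group (SL2 p) p ((p - 1) div 2) (unip p) (torus p) (weight p)"
proof -
  have p1: "p > 1" "p > 0" using p by auto
  interpret finite_add_subgroup "SL2 p" by (rule SL2_subgroup_and_card(1)[OF p(1)])
  have det_u: "[1 * 1 - x * 0 = 1] (mod int p)" "[1 * 1 - 0 * x = 1] (mod int p)" for x by simp_all
  have det_t: "[int (Suc a) * int (inv_mod p (Suc a)) - 0 * 0 = 1] (mod int p)" if "a < (p - 1) div 2" for a
  proof -
    have "[Suc a * inv_mod p (Suc a) = 1] (mod p)" using that by (intro inv_mod p) auto
    then have "[int (Suc a * inv_mod p (Suc a)) = int 1] (mod int p)" by (simp only: cong_int_iff)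
    then show ?thesis by (simp only: of_nat_mult of_nat_1 mult_zero_left diff_zero)
  qed
  show ?thesis
  proof
    show "prime p" "0 < (p - 1) div 2" using p by auto
    show "unip p \<tau> s \<in> SL2 p" for \<tau> s
      using det_u[of "int s"] unfolding unip_def by (cases \<tau>) (auto intro!: SL2I)
    show "unip p \<tau> (s + t) = unip p \<tau> s + unip p \<tau> t" for \<tau> s t
      using p1 det_u by (cases \<tau>) (simp_all add: unip_def mat_add add.commute)
    show "unip p \<tau> p = 0" for \<tau>
      unfolding unip_def mat_zero[of p, symmetric] by (auto intro!: mat_cong simp: unique_euclidean_semiring_class.cong_def)
    show "torus p a \<in> SL2 p" if "a < (p - 1) div 2" for a
      using det_t[OF that] unfolding torus_def by (rule SL2I)
    show "unip p \<tau> s + torus p a = torus p a + unip p \<tau> (weight p \<tau> a * s)" if a: "a < (p - 1) div 2" for a \<tau> s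
    proof -
      define e where "e = int (Suc a)"
      define e' where "e' = int (inv_mod p (Suc a))"
      have det: "[e * e' - 0 * 0 = 1] (mod int p)" using det_t[OF a] by (simp add: e_def e'_def)
      then have ee: "[e * e' = 1] (mod int p)" by simp
      have tor: "torus p a = mat p e 0 0 e'" by (simp only: torus_def e_def e'_def)
      show ?thesis
      proof (cases \<tau>)
        case True
        have w: "int (weight p True a * s) = e'\<^sup>2 * int s" by (simp add: weight_def e'_def)
        have "unip p \<tau> s + torus p a = mat p (1 * e + int s * 0) (1 * 0 + int s * e') (0 * e + 1 * 0) (0 * 0 + 1 * e')"
          using True by (simp only: unip_def if_True tor mat_add[OF p1(2) det_u(1) det])
        moreover have "torus p a + unip p \<tau> (weight p \<tau> a * s)
          = mat p (e * 1 + 0 * 0) (e * (e'\<^sup>2 * int s) + 0 * 1) (0 * 1 + e' * 0) (0 * (e'\<^sup>2 * int s) + e' * 1)"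
          using True by (simp only: unip_def if_True w tor mat_add[OF p1(2) det det_u(1)])
        moreover have "[e * (e'\<^sup>2 * int s) = int s * e'] (mod int p)"
          using cong_mult[OF ee cong_refl[of "e' * int s"]] by (simp add: power2_eq_square mult_ac)
        then have "mat p e (e * (e'\<^sup>2 * int s)) 0 e' = mat p e (int s * e') 0 e'"
          by (intro mat_cong cong_refl)
        ultimately show ?thesis by simp
      next
        case False
        have w: "int (weight p False a * s) = e\<^sup>2 * int s" by (simp add: weight_def e_def)
        have "unip p \<tau> s + torus p a = mat p (1 * e + 0 * 0) (1 * 0 + 0 * e') (int s * e + 1 * 0) (int s * 0 + 1 * e')"
          using False by (simp only: unip_def if_False tor mat_add[OF p1(2) det_u(2) det])
        moreover have "torus p a + unip p \<tau> (weight p \<tau> a * s)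
          = mat p (e * 1 + 0 * (e\<^sup>2 * int s)) (e * 0 + 0 * 1) (0 * 1 + e' * (e\<^sup>2 * int s)) (0 * 0 + e' * 1)"
          using False by (simp only: unip_def if_False w tor mat_add[OF p1(2) det det_u(2)])
        moreover have "[e' * (e\<^sup>2 * int s) = int s * e] (mod int p)"
          using cong_mult[OF ee cong_refl[of "e * int s"]] by (simp add: power2_eq_square mult_ac)
        then have "mat p e 0 (e' * (e\<^sup>2 * int s)) e' = mat p e 0 (int s * e) e'"
          by (intro mat_cong cong_refl)
        ultimately show ?thesis by simp
      qed
    qed
    show "a = b" if ab: "a < (p - 1) div 2" "b < (p - 1) div 2" "[weight p \<tau> a = weight p \<tau> b] (mod p)" for a b \<tau>
    proof (cases \<tau>)
      case True
      define i where "i a = inv_mod p (Suc a)" for a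
      have one: "[(Suc a * i a)\<^sup>2 = 1] (mod p)" "[(Suc b * i b)\<^sup>2 = 1] (mod p)"
        using cong_pow[OF inv_mod[OF p(1), of a], of 2] cong_pow[OF inv_mod[OF p(1), of b], of 2] ab
        by (simp_all add: i_def)
      have "[(Suc b)\<^sup>2 * (Suc a * i a)\<^sup>2 = (Suc b)\<^sup>2 * 1] (mod p)" by (intro cong_mult one cong_refl)
      moreover have "[(Suc a)\<^sup>2 * (Suc b * i b)\<^sup>2 = (Suc a)\<^sup>2 * 1] (mod p)" by (intro cong_mult one cong_refl)
      moreover have "[(Suc b)\<^sup>2 * (Suc a * i a)\<^sup>2 = (Suc a)\<^sup>2 * (Suc b * i b)\<^sup>2] (mod p)"
      proof -
        have "[((Suc a)\<^sup>2 * (Suc b)\<^sup>2) * (i a)\<^sup>2 = ((Suc a)\<^sup>2 * (Suc b)\<^sup>2) * (i b)\<^sup>2] (mod p)"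
          using ab(3) True by (intro cong_mult cong_refl) (simp add: weight_def i_def)
        then show ?thesis by (simp only: power_mult_distrib mult_ac)
      qed
      ultimately have "[(Suc a)\<^sup>2 = (Suc b)\<^sup>2] (mod p)"
        by (metis cong_sym cong_trans mult.right_neutral)
      then show ?thesis using cong_squares_imp_eq[OF p(1) ab(1,2)] by blast
    next
      case False
      then show ?thesis using cong_squares_imp_eq[OF p(1) ab(1,2)] ab(3) by (simp add: weight_def)
    qed
    show "inj_on (\<lambda>(a, b, c). unip p True a + unip p False b + unip p True c) ({..<p} \<times> {1..<p} \<times> {..<p})"
    proof (rule inj_onI)
      fix z z' assume z: "z \<in> {..<p} \<times> {1..<p} \<times> {..<p}" "z' \<in> {..<p} \<times> {1..<p} \<times> {..<p}"
        "(\<lambda>(a, b, c). unip p True a + unip p False b + unip p True c) z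
         = (\<lambda>(a, b, c). unip p True a + unip p False b + unip p True c) z'"
      obtain a b c where z1: "z = (a, b, c)" by (cases z)
      obtain a' b' c' where z2: "z' = (a', b', c')" by (cases z')
      define A B Cc A' B' C' where "A = int a" "B = int b" "Cc = int c" "A' = int a'" "B' = int b'" "C' = int c'"
      note ints = this
      have det3: "[(1 + x * y) * (y * w + 1) - ((1 + x * y) * w + x) * y = 1] (mod int p)" for x y w
        by (simp add: algebra_simps)
      \<comment> \<open>The lower left entry reveals \<open>y\<close>; when \<open>y\<close> is a
        unit mod \<open>p\<close>, the diagonal entries reveal \<open>x\<close> and
        \<open>w\<close>.\<close>
      have prod: "unip p True x + unip p False y + unip p True w
         = mat p (1 + int x * int y) ((1 + int x * int y) * int w + int x) (int y) (int y * int w + 1)" for x y w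
      proof -
        have "unip p True x + unip p False y = mat p (1 + int x * int y) (int x) (int y) 1"
          using p1 det_u by (simp add: unip_def mat_add)
        moreover have "[(1 + int x * int y) * 1 - int x * int y = 1] (mod int p)" by simp
        ultimately show ?thesis
          using p1 det_u by (simp add: unip_def mat_add)
      qed
      have eq: "mat p (1 + A * B) ((1 + A * B) * Cc + A) B (B * Cc + 1) = mat p (1 + A' * B') ((1 + A' * B') * C' + A') B' (B' * C' + 1)"
        using z(3) by (simp only: z1 z2 prod ints case_prod_conv)
      note cong = mat_eq_cong[OF p1(1) det3 det3 eq]
      have "b = b'"
        using cong(3) z by (simp add: z1 z2 ints cong_int_iff) (simp add: unique_euclidean_semiring_class.cong_def)
      have cop: "coprime (int b) (int p)"
      proof -
        have "\<not> p dvd b" using z(1) by (auto simp: z1 dest: dvd_imp_le)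
        then have "coprime b p" using p(1) by (metis coprime_commute prime_imp_coprime_nat)
        then show ?thesis by simp
      qed
      have "[A * B = A' * B] (mod int p)"
        using cong_diff[OF cong(1) cong_refl[of 1]] \<open>b = b'\<close> by (simp add: ints)
      then have "[A = A'] (mod int p)" using cop by (simp add: ints cong_mult_rcancel)
      moreover have "[B * Cc = B * C'] (mod int p)"
        using cong_diff[OF cong(4) cong_refl[of 1]] \<open>b = b'\<close> by (simp add: ints)
      then have "[Cc = C'] (mod int p)" using cop by (simp add: ints cong_mult_lcancel)
      ultimately show "z = z'"
        using z \<open>b = b'\<close> by (simp add: z1 z2 ints cong_int_iff) (simp add: unique_euclidean_semiring_class.cong_def)
    qed
    show "card (SL2 p) \<le> p ^ 3" by (rule SL2_subgroup_and_card(2)[OF p(1)])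
  qed
qed

lemma SL2_apply_outside:
  assumes "p > 0" "g \<in> SL2 p" "z \<notin> {0..<int p} \<times> {0..<int p}"
  shows "apply_bij g z = z"
  using assms by (cases z) (auto simp: SL2_def apply_mat mat_act_def)

lemma SL2_apply_mem:
  assumes "p > 0" "g \<in> SL2 p" "z \<in> {0..<int p} \<times> {0..<int p}"
  shows "apply_bij g z \<in> {0..<int p} \<times> {0..<int p}"
  using assms by (cases z) (auto simp: SL2_def apply_mat mat_act_def)

lemma card_SL2_ge: "prime p \<Longrightarrow> p \<le> card (SL2 p)"
proof -
  assume p: "prime p"
  have p1: "p > 1" using p prime_gt_1_nat by blast
  have det: "[1 * 1 - int s * 0 = 1] (mod int p)" for s by simp
  have "inj_on (\<lambda>s. mat p 1 (int s) 0 1) {..<p}"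
  proof (rule inj_onI)
    fix s t assume st: "s \<in> {..<p}" "t \<in> {..<p}" "mat p 1 (int s) 0 1 = mat p 1 (int t) 0 1"
    show "s = t" using mat_eq_cong(2)[OF p1 det det st(3)] st(1,2) by (simp add: cong_int_iff) (simp add: unique_euclidean_semiring_class.cong_def)
  qed
  moreover have "(\<lambda>s. mat p 1 (int s) 0 1) ` {..<p} \<subseteq> SL2 p"
    using det by (auto intro!: SL2I)
  moreover have "finite (SL2 p)"
    using SL2_subgroup_and_card(1)[OF p] by (simp add: finite_add_subgroup_def)
  ultimately show "p \<le> card (SL2 p)" using card_inj_on_le by fastforce
qed

section \<open>Relabelling trajectories\<close>

lemma funpow_permutes_mem:
  assumes "y permutes S" "v \<in> S"
  shows "(y ^^ i) v \<in> S"
  using assms(2) by (induction i) (simp_all add: permutes_in_image[OF assms(1)])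

text \<open>If the points \<open>y\<^sup>j (s a)\<close> are all distinct, then a tuple of permutations of the labels \<open>a\<close>
  permutes these points, separately for each time \<open>j\<close>.\<close>

locale relabelling = finite_add_subgroup H for H :: "'a bijection set" +
  fixes P :: "'a set" and R n :: nat and s :: "'a \<Rightarrow> nat"
  assumes finite_P: "finite P"
    and H_mem: "h \<in> H \<Longrightarrow> a \<in> P \<Longrightarrow> apply_bij h a \<in> P"
    and H_outside: "h \<in> H \<Longrightarrow> a \<notin> P \<Longrightarrow> apply_bij h a = a"
    and s_mem: "a \<in> P \<Longrightarrow> s a \<in> {1..n}"
begin

definition pos :: "(nat \<Rightarrow> nat) \<Rightarrow> 'a \<times> nat \<Rightarrow> nat" where
  "pos y = (\<lambda>(a, j). (y ^^ j) (s a))"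

definition Dom :: "('a \<times> nat) set" where "Dom = P \<times> {..<R}"

definition good :: "(nat \<Rightarrow> nat) \<Rightarrow> bool" where
  "good y \<longleftrightarrow> y permutes {1..n} \<and> inj_on (pos y) Dom"

lemma good_permutes: "good y \<Longrightarrow> y permutes {1..n}"
  by (simp only: good_def)

lemma good_inj: "good y \<Longrightarrow> inj y"
  using good_permutes permutes_inj by blast

definition relabel :: "(nat \<Rightarrow> nat) \<Rightarrow> (nat \<Rightarrow> 'a bijection) \<Rightarrow> nat \<Rightarrow> nat" where
  "relabel y k v = (if v \<in> pos y ` Dom
     then let (a, j) = inv_into Dom (pos y) v in pos y (apply_bij (k j) a, j) else v)"

abbreviation K :: "(nat \<Rightarrow> 'a bijection) set" where "K \<equiv> hbox {..<R} H"

lemma K_mem: "k \<in> K \<Longrightarrow> k j \<in> H"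
  using zero_mem by (cases "j < R") (auto simp: hbox_def)

lemma K_apply: "k \<in> K \<Longrightarrow> (a, j) \<in> Dom \<Longrightarrow> (apply_bij (k j) a, j) \<in> Dom"
  using K_mem[of k j] H_mem by (auto simp: Dom_def)

lemma relabel_pos: "good y \<Longrightarrow> (a, j) \<in> Dom \<Longrightarrow> relabel y k (pos y (a, j)) = pos y (apply_bij (k j) a, j)"
  by (simp add: relabel_def good_def)

lemma relabel_out: "v \<notin> pos y ` Dom \<Longrightarrow> relabel y k v = v"
  by (simp add: relabel_def)

lemma relabel_add:
  assumes y: "good y" and k: "k' \<in> K"
  shows "relabel y (k + k') = relabel y k \<circ> relabel y k'"
proof
  fix v
  show "relabel y (k + k') v = (relabel y k \<circ> relabel y k') v"
  proof (cases "v \<in> pos y ` Dom")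
    case True
    then obtain a j where aj: "(a, j) \<in> Dom" "v = pos y (a, j)" by auto
    then show ?thesis
      using y K_apply[OF k aj(1)] by (simp add: relabel_pos apply_bij_simps)
  qed (simp add: relabel_out)
qed

lemma relabel_0: "good y \<Longrightarrow> relabel y 0 = id"
proof
  fix v assume y: "good y"
  show "relabel y 0 v = id v"
    using y by (cases "v \<in> pos y ` Dom") (auto simp: relabel_pos relabel_out apply_bij_simps)
qed

lemma uminus_K: "k \<in> K \<Longrightarrow> - k \<in> K"
  by (auto simp: hbox_def uminus_mem)

lemma pos_range: "y permutes {1..n} \<Longrightarrow> (a, j) \<in> Dom \<Longrightarrow> pos y (a, j) \<in> {1..n}"
proof -
  assume y: "y permutes {1..n}" and "(a, j) \<in> Dom"
  then have "a \<in> P" by (simp add: Dom_def)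
  then have "s a \<in> {1..n}" by (rule s_mem)
  then have "(y ^^ j) (s a) \<in> {1..n}" by (rule funpow_permutes_mem[OF y])
  then show "pos y (a, j) \<in> {1..n}" by (simp only: pos_def case_prod_conv)
qed

lemma relabel_permutes:
  assumes y: "good y" and k: "k \<in> K"
  shows "relabel y k permutes {1..n}"
proof -
  have "relabel y k \<circ> relabel y (- k) = id" "relabel y (- k) \<circ> relabel y k = id"
    using relabel_add[OF y uminus_K[OF k], of k] relabel_add[OF y k, of "- k"] relabel_0[OF y] by simp_all
  then have "bij (relabel y k)" by (metis o_bij)
  moreover have "relabel y k v = v" if v: "v \<notin> {1..n}" for v
  proof -
  have "v \<notin> pos y ` Dom"
  proof
    assume "v \<in> pos y ` Dom"
    then obtain a j where "(a, j) \<in> Dom" "v = pos y (a, j)" by auto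
    then show False using v pos_range[of y a j] y by (simp add: good_def)
  qed
  then show ?thesis by (rule relabel_out)
  qed
  ultimately show ?thesis by (simp add: permutes_def bij_iff)
qed

text \<open>\<open>y\<close> carries the points of time \<open>j\<close> to those of time
  \<open>Suc j\<close>. Both ends need care: a point of time 0 may come from outside all
  trajectories, hence \<open>v 0 = 0\<close>, and after the last time nothing moves because
  \<open>v\<close> vanishes from \<open>R\<close> on.\<close>

lemma relabel_shift:
  assumes y: "good y" and v: "v \<in> K" "v 0 = 0"
  shows "relabel y v \<circ> y = y \<circ> relabel y (\<lambda>i. v (Suc i))"
proof
  fix x
  have inj: "inj y" by (rule good_inj[OF y])
  show "(relabel y v \<circ> y) x = (y \<circ> relabel y (\<lambda>i. v (Suc i))) x"
  proof (cases "x \<in> pos y ` Dom")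
    case True
    then obtain a j where aj: "(a, j) \<in> Dom" "x = pos y (a, j)" by auto
    have yx: "y (pos y (b, j)) = pos y (b, Suc j)" for b by (simp add: pos_def)
    have rhs: "(y \<circ> relabel y (\<lambda>i. v (Suc i))) x = pos y (apply_bij (v (Suc j)) a, Suc j)"
      using y aj by (simp add: relabel_pos yx)
    show ?thesis
    proof (cases "Suc j < R")
      case True
      then have "(a, Suc j) \<in> Dom" using aj by (simp add: Dom_def)
      then show ?thesis using y aj rhs by (simp add: yx relabel_pos)
    next
      case False
      then have 0: "v (Suc j) = 0" using v(1) by (simp add: hbox_def)
      \<comment> \<open>The point of time \<open>R\<close> may be the start of some trajectory,
        where \<open>v 0 = 0\<close> helps. It cannot have a positive time: cancelling
        \<open>y\<close> would give two times to the point of time \<open>j\<close>.\<close>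
      have "relabel y v (pos y (a, Suc j)) = pos y (a, Suc j)"
      proof (cases "pos y (a, Suc j) \<in> pos y ` Dom")
        case True
        then obtain b i where bi: "(b, i) \<in> Dom" "pos y (a, Suc j) = pos y (b, i)" by auto
        show ?thesis
        proof (cases i)
          case 0
          then show ?thesis unfolding bi(2) using y bi(1) v(2) by (simp add: relabel_pos apply_bij_simps)
        next
          case (Suc i')
          have "y (pos y (a, j)) = y (pos y (b, i'))" using bi(2) Suc by (simp add: pos_def)
          then have "pos y (a, j) = pos y (b, i')" using inj by (simp add: inj_eq)
          moreover have "(b, i') \<in> Dom" using bi(1) Suc by (simp add: Dom_def)
          ultimately have "j = i'" using y aj(1) by (auto simp: good_def dest: inj_onD)
          then show ?thesis using False bi(1) Suc by (simp add: Dom_def)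
        qed
      qed (rule relabel_out)
      then show ?thesis using rhs 0 aj by (simp add: yx apply_bij_simps)
    qed
  next
    case False
    have "relabel y v (y x) = y x"
    proof (cases "y x \<in> pos y ` Dom")
      case True
      then obtain b i where bi: "(b, i) \<in> Dom" "y x = pos y (b, i)" by auto
      show ?thesis
      proof (cases i)
        case 0
        then show ?thesis unfolding bi(2) using y bi(1) v(2) by (simp add: relabel_pos apply_bij_simps)
      next
        case (Suc i')
        have "y x = y (pos y (b, i'))" using bi(2) Suc by (simp add: pos_def)
        then have "x = pos y (b, i')" using inj by (simp add: inj_eq)
        moreover have "(b, i') \<in> Dom" using bi(1) Suc by (simp add: Dom_def)
        ultimately show ?thesis using False by blast
      qed
    qed (rule relabel_out)
    then show ?thesis using relabel_out[OF False] by simp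
  qed
qed

text \<open>If \<open>Y = y \<circ> relabel y k\<close>, then \<open>X = Y \<circ> relabel y v\<close> and \<open>Z = inv (relabel y v) \<circ> Y\<close> satisfy
  \<open>X \<circ> Z = Y \<circ> Y\<close>.\<close>

lemma relabel_progression:
  assumes y: "good y" and k: "k \<in> K" and v: "v \<in> K" "v \<noteq> 0" "v 0 = 0"
  defines "X \<equiv> y \<circ> relabel y (k + v)" and "Y \<equiv> y \<circ> relabel y k"
    and "Z \<equiv> y \<circ> relabel y (\<lambda>i. - v (Suc i) + k i)"
  shows "X \<circ> Z = Y \<circ> Y" "X \<noteq> Y"
proof -
  define w where "w = (\<lambda>i. v (Suc i))"
  have w: "w \<in> K" using v(1) K_mem[of v] by (auto simp: w_def hbox_def)
  have "(\<lambda>i. - v (Suc i) + k i) = - w + k" by (simp add: w_def fun_eq_iff)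
  then have Z: "Z = y \<circ> (relabel y (- w) \<circ> relabel y k)"
    unfolding Z_def by (simp only: relabel_add[OF y k])
  have X: "X = y \<circ> (relabel y k \<circ> relabel y v)"
    unfolding X_def by (simp only: relabel_add[OF y v(1)])
  have "relabel y v \<circ> y \<circ> relabel y (- w) = y"
  proof -
    have "relabel y v \<circ> y \<circ> relabel y (- w) = y \<circ> (relabel y w \<circ> relabel y (- w))"
      unfolding relabel_shift[OF y v(1,3)] w_def by (simp only: o_assoc)
    also have "relabel y w \<circ> relabel y (- w) = id"
      using relabel_add[OF y uminus_K[OF w], of w] relabel_0[OF y] by simp
    finally show ?thesis by (simp only: comp_id)
  qed
  then have "relabel y v (y (relabel y (- w) x)) = y x" for x by (metis comp_apply)
  then show "X \<circ> Z = Y \<circ> Y" by (simp add: X Z Y_def fun_eq_iff)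
  show "X \<noteq> Y"
  proof
    assume XY: "X = Y"
    have inj: "inj y" "inj (relabel y k)"
      using good_inj[OF y] permutes_inj[OF relabel_permutes[OF y k]] by auto
    have id: "relabel y v x = x" for x
      using fun_cong[OF XY, of x] inj by (simp add: X Y_def inj_eq)
    obtain j where j: "v j \<noteq> 0" using v(2) by (auto simp: fun_eq_iff)
    then have jR: "j < R" using v(1) by (auto simp: hbox_def)
    have "\<exists>a. apply_bij (v j) a \<noteq> a"
    proof (rule ccontr)
      assume "\<nexists>a. apply_bij (v j) a \<noteq> a"
      then have "v j = 0" by (intro bijection_eqI) (simp add: apply_bij_simps)
      then show False using j by simp
    qed
    then obtain a where a: "apply_bij (v j) a \<noteq> a" by blast
    then have "a \<in> P" using H_outside[OF K_mem[OF v(1)]] by blast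
    then have D: "(a, j) \<in> Dom" using jR by (simp add: Dom_def)
    have "pos y (apply_bij (v j) a, j) = pos y (a, j)"
      using id[of "pos y (a, j)"] relabel_pos[OF y D] by simp
    then show False
      using y D K_apply[OF v(1) D] a by (auto simp: good_def dest: inj_onD)
  qed
qed

text \<open>Relabelling \<open>y\<close> changes the trajectories of the starting points only by permuting labels, so
  it is a measure preserving action on the good permutations.\<close>

primrec drift :: "(nat \<Rightarrow> 'a bijection) \<Rightarrow> nat \<Rightarrow> 'a bijection" where
  "drift k 0 = 0"
| "drift k (Suc j) = k j + drift k j"

lemma drift_mem: "k \<in> K \<Longrightarrow> drift k j \<in> H"
  by (induction j) (auto simp: zero_mem add_mem K_mem)

lemma drift_Dom: "k \<in> K \<Longrightarrow> (a, j) \<in> Dom \<Longrightarrow> (apply_bij (drift k j) a, j) \<in> Dom"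
  using drift_mem H_mem by (auto simp: Dom_def)

lemma pos_relabel:
  assumes y: "good y" and k: "k \<in> K" and a: "a \<in> P"
  shows "j < R \<Longrightarrow> pos (y \<circ> relabel y k) (a, j) = pos y (apply_bij (drift k j) a, j)"
proof (induction j)
  case (Suc j)
  have D: "(apply_bij (drift k j) a, j) \<in> Dom"
    using drift_Dom[OF k, of a j] a Suc.prems by (simp add: Dom_def)
  have "pos (y \<circ> relabel y k) (a, Suc j) = (y \<circ> relabel y k) (pos (y \<circ> relabel y k) (a, j))"
    by (simp add: pos_def)
  also have "\<dots> = y (relabel y k (pos y (apply_bij (drift k j) a, j)))"
    by (simp only: comp_apply Suc.IH[OF Suc_lessD[OF Suc.prems]])
  also have "\<dots> = y (pos y (apply_bij (k j) (apply_bij (drift k j) a), j))"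
    using relabel_pos[OF y D] by simp
  also have "\<dots> = pos y (apply_bij (drift k (Suc j)) a, Suc j)"
    by (simp add: pos_def apply_bij_simps)
  finally show ?case .
qed (simp add: pos_def apply_bij_simps)

lemma good_relabel:
  assumes y: "good y" and k: "k \<in> K"
  shows "good (y \<circ> relabel y k)"
  unfolding good_def
proof
  show "y \<circ> relabel y k permutes {1..n}"
    using y relabel_permutes[OF y k] by (simp add: good_def permutes_compose)
  show "inj_on (pos (y \<circ> relabel y k)) Dom"
  proof (rule inj_onI)
    fix z z' assume z: "z \<in> Dom" "z' \<in> Dom" "pos (y \<circ> relabel y k) z = pos (y \<circ> relabel y k) z'"
    obtain a j where aj: "z = (a, j)" by (cases z)
    obtain b i where bi: "z' = (b, i)" by (cases z')
    have "pos y (apply_bij (drift k j) a, j) = pos y (apply_bij (drift k i) b, i)"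
      using z pos_relabel[OF y k] by (simp add: aj bi Dom_def)
    then have eq: "(apply_bij (drift k j) a, j) = (apply_bij (drift k i) b, i)"
      using y drift_Dom[OF k, of a j] drift_Dom[OF k, of b i] z
      by (auto simp: good_def aj bi dest!: inj_onD)
    then have ij: "j = i" "apply_bij (drift k i) a = apply_bij (drift k i) b" by auto
    have "a = b" by (rule injD[OF bij_is_inj[OF bij_apply_bij] ij(2)])
    then show "z = z'" using ij(1) by (simp add: aj bi)
  qed
qed

text \<open>The drift depends only on \<open>k\<close>, so undoing it recovers all positions of
  \<open>y\<close> from its image. The positions determine \<open>relabel y k\<close>, which can be
  cancelled.\<close>

lemma inj_on_relabel:
  assumes k: "k \<in> K"
  shows "inj_on (\<lambda>y. y \<circ> relabel y k) {y. good y}"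
proof (rule inj_onI)
  fix y1 y2 assume y: "y1 \<in> {y. good y}" "y2 \<in> {y. good y}" "y1 \<circ> relabel y1 k = y2 \<circ> relabel y2 k"
  then have good: "good y1" "good y2" by simp_all
  have pos_eq: "pos y1 z = pos y2 z" if z: "z \<in> Dom" for z
  proof -
    obtain a j where aj: "z = (a, j)" "a \<in> P" "j < R" using z by (auto simp: Dom_def)
    define b where "b = apply_bij (- drift k j) a"
    have b: "b \<in> P" "apply_bij (drift k j) b = a"
    proof -
      show "b \<in> P" unfolding b_def using aj by (intro H_mem uminus_mem drift_mem[OF k])
      have "apply_bij (drift k j + - drift k j) a = a" by (simp add: apply_bij_simps)
      then show "apply_bij (drift k j) b = a" by (simp only: b_def apply_bij_simps comp_apply)
    qed
    show ?thesis
      using pos_relabel[OF good(1) k b(1) aj(3)] pos_relabel[OF good(2) k b(1) aj(3)] y(3) b(2)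
      by (simp add: aj(1))
  qed
  have "relabel y1 k v = relabel y2 k v" for v
  proof (cases "v \<in> pos y1 ` Dom")
    case True
    then obtain a j where aj: "(a, j) \<in> Dom" "v = pos y1 (a, j)" by auto
    have "relabel y1 k v = pos y1 (apply_bij (k j) a, j)" using aj relabel_pos[OF good(1)] by simp
    also have "\<dots> = pos y2 (apply_bij (k j) a, j)" by (rule pos_eq[OF K_apply[OF k aj(1)]])
    also have "\<dots> = relabel y2 k v" using aj relabel_pos[OF good(2) aj(1)] pos_eq[OF aj(1)] by simp
    finally show ?thesis .
  next
    case False
    moreover have "pos y1 ` Dom = pos y2 ` Dom" using pos_eq by (intro image_cong) auto
    ultimately show ?thesis by (simp add: relabel_out)
  qed
  then have eq: "relabel y1 k = relabel y2 k" by blast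
  have "surj (relabel y2 k)" using relabel_permutes[OF good(2) k] permutes_surj by blast
  then show "y1 = y2" using y(3) unfolding eq by (metis fun.map_cong0 surj_fun_eq)
qed

lemma finite_good: "finite {y. good y}"
  by (rule finite_subset[of _ "{y. y permutes {1..n}}"]) (auto simp: good_def finite_permutations)

lemma card_good_le: "card {y. good y} \<le> fact n"
proof -
  have "card {y. good y} \<le> card {y. y permutes {1..n}}"
    by (rule card_mono) (auto simp: good_def finite_permutations)
  then show ?thesis by (simp add: card_permutations)
qed

text \<open>Pairs \<open>(y, k)\<close> are counted in two ways. For fixed \<open>k\<close> the
  relabelling permutes the finite set of good permutations, so every \<open>k\<close> contributes
  the number of good elements of \<open>A\<close>, while at most \<open>fact n\<close> values of
  \<open>y\<close> share the total.\<close>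

lemma dense_orbit:
  fixes \<delta> :: real
  assumes "real (card {y \<in> A. good y}) \<ge> \<delta> * fact n" "\<delta> > 0"
  obtains y where "good y" "real (card {k \<in> K. y \<circ> relabel y k \<in> A}) \<ge> \<delta> * card K"
proof -
  define T where "T = {y. good y}"
  have finK: "finite K" by (intro finite_hbox finite_carrier) simp
  have "(\<Sum>y\<in>T. card {k \<in> K. y \<circ> relabel y k \<in> A}) = (\<Sum>k\<in>K. card {y \<in> T. y \<circ> relabel y k \<in> A})"
  proof -
    have "(\<Sum>y\<in>T. card {k \<in> K. y \<circ> relabel y k \<in> A}) = (\<Sum>y\<in>T. \<Sum>k\<in>K. if y \<circ> relabel y k \<in> A then 1 else 0)"
      using finK by (intro sum.cong refl) (simp add: sum.If_cases Int_def)
    also have "\<dots> = (\<Sum>k\<in>K. \<Sum>y\<in>T. if y \<circ> relabel y k \<in> A then 1 else 0)" by (rule sum.swap)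
    also have "\<dots> = (\<Sum>k\<in>K. card {y \<in> T. y \<circ> relabel y k \<in> A})"
      using finite_good by (intro sum.cong refl) (simp add: sum.If_cases Int_def T_def)
    finally show ?thesis .
  qed
  also have "\<dots> = (\<Sum>k\<in>K. card {y \<in> A. good y})"
  proof (rule sum.cong[OF refl])
    fix k assume k: "k \<in> K"
    have "(\<lambda>y. y \<circ> relabel y k) ` T = T"
      using finite_good inj_on_relabel[OF k] good_relabel[OF _ k]
      by (intro endo_inj_surj) (auto simp: T_def)
    moreover have "(\<lambda>y. y \<circ> relabel y k) ` {y \<in> T. y \<circ> relabel y k \<in> A} = (\<lambda>y. y \<circ> relabel y k) ` T \<inter> A"
      by auto
    ultimately have "(\<lambda>y. y \<circ> relabel y k) ` {y \<in> T. y \<circ> relabel y k \<in> A} = {y \<in> A. good y}"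
      by (auto simp: T_def)
    then show "card {y \<in> T. y \<circ> relabel y k \<in> A} = card {y \<in> A. good y}"
      using inj_on_subset[OF inj_on_relabel[OF k], of "{y \<in> T. y \<circ> relabel y k \<in> A}"]
      by (metis (no_types, lifting) T_def card_image mem_Collect_eq subsetI)
  qed
  finally have total: "(\<Sum>y\<in>T. real (card {k \<in> K. y \<circ> relabel y k \<in> A})) = card K * real (card {y \<in> A. good y})"
    by (simp flip: of_nat_sum)
  have "\<exists>y\<in>T. real (card {k \<in> K. y \<circ> relabel y k \<in> A}) \<ge> \<delta> * card K"
  proof (rule ccontr)
    assume neg: "\<not> ?thesis"
    have cK: "card K > 0"
      using finK zero_mem by (auto simp: card_gt_0_iff hbox_def intro!: exI[of _ "\<lambda>_. 0"])
    have "T \<noteq> {}"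
    proof
      assume "T = {}"
      then have "{y \<in> A. good y} = {}" by (auto simp: T_def)
      then have "\<delta> * fact n \<le> 0" using assms(1) by (simp only: card.empty of_nat_0)
      moreover have "\<delta> * fact n > 0" using assms(2) by simp
      ultimately show False by linarith
    qed
    then have "(\<Sum>y\<in>T. real (card {k \<in> K. y \<circ> relabel y k \<in> A})) < (\<Sum>y\<in>T. \<delta> * card K)"
      using neg finite_good by (intro sum_strict_mono) (auto simp: T_def not_le)
    also have "\<dots> \<le> fact n * (\<delta> * card K)"
    proof -
      have "real (card T) \<le> fact n" using card_good_le unfolding T_def by (metis of_nat_fact of_nat_le_iff)
      then show ?thesis using assms(2) by (simp add: mult_right_mono)
    qed
    also have "\<dots> \<le> card K * real (card {y \<in> A. good y})"
      using mult_left_mono[OF assms(1), of "real (card K)"] by (simp add: mult_ac)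
    finally show False using total by simp
  qed
  then show ?thesis using that by (auto simp: T_def)
qed

end

section \<open>Short cycles of random permutations\<close>

definition short_period :: "nat \<Rightarrow> nat \<Rightarrow> (nat \<Rightarrow> nat) \<Rightarrow> nat set" where
  "short_period n R y = {v \<in> {1..n}. \<exists>i. 0 < i \<and> i < R \<and> (y ^^ i) v = v}"

lemma card_permutes_stabilising:
  assumes T: "T \<subseteq> {1..n}"
  shows "card {y. y permutes {1..n} \<and> y ` T = T} \<le> fact (card T) * fact (n - card T)"
proof -
  define on where "on X y = (\<lambda>v. if v \<in> X then y v else v)" for X and y :: "nat \<Rightarrow> nat"
  have fin: "finite T" using T finite_subset by blast
  have on_perm: "on X y permutes X" if "inj y" "y ` X = X" for X y
  proof -
    have "bij_betw (on X y) X X"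
      using that by (auto simp: bij_betw_def on_def inj_on_def cong: image_cong_simp)
    then show ?thesis by (rule bij_imp_permutes) (simp add: on_def)
  qed
  have "card {y. y permutes {1..n} \<and> y ` T = T} \<le> card ({y. y permutes T} \<times> {y. y permutes ({1..n} - T)})"
  proof (rule card_inj_on_le)
    show "inj_on (\<lambda>y. (on T y, on ({1..n} - T) y)) {y. y permutes {1..n} \<and> y ` T = T}"
    proof (rule inj_onI, rule ext)
      fix y z v
      assume yz: "y \<in> {y. y permutes {1..n} \<and> y ` T = T}" "z \<in> {y. y permutes {1..n} \<and> y ` T = T}"
        "(on T y, on ({1..n} - T) y) = (on T z, on ({1..n} - T) z)"
      then have "on T y v = on T z v" "on ({1..n} - T) y v = on ({1..n} - T) z v" by auto
      then show "y v = z v"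
        using yz(1,2) by (cases "v \<in> T"; cases "v \<in> {1..n}") (auto simp: on_def permutes_def)
    qed
    show "(\<lambda>y. (on T y, on ({1..n} - T) y)) ` {y. y permutes {1..n} \<and> y ` T = T}
       \<subseteq> {y. y permutes T} \<times> {y. y permutes ({1..n} - T)}"
    proof (rule image_subsetI)
      fix y assume y: "y \<in> {y. y permutes {1..n} \<and> y ` T = T}"
      then have inj: "inj y" using permutes_inj by blast
      have "y ` ({1..n} - T) = {1..n} - T"
        using y image_set_diff[OF inj, of "{1..n}" T] permutes_image[of y "{1..n}"] by simp
      then show "(on T y, on ({1..n} - T) y) \<in> {y. y permutes T} \<times> {y. y permutes ({1..n} - T)}"
        using y inj on_perm by simp
    qed
    show "finite ({y. y permutes T} \<times> {y. y permutes ({1..n} - T)})"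
      using fin by (simp add: finite_permutations)
  qed
  also have "\<dots> = fact (card T) * fact (n - card T)"
    using T fin by (simp add: card_cartesian_product card_permutations card_Diff_subset)
  finally show ?thesis .
qed

text \<open>At most \<open>fact k * fact (n - k)\<close> permutations preserve a given set of size
  \<open>k\<close>, and there are \<open>n choose k\<close> such sets, so each of the
  \<open>n + 1\<close> sizes contributes at most \<open>fact n\<close>.\<close>

lemma sum_invariant_sets:
  "(\<Sum>y | y permutes {1..n}. card {T. T \<subseteq> {1..n} \<and> y ` T = T}) \<le> (n + 1) * fact n"
proof -
  have "(\<Sum>y | y permutes {1..n}. card {T. T \<subseteq> {1..n} \<and> y ` T = T})
    = (\<Sum>y | y permutes {1..n}. \<Sum>T\<in>Pow {1..n}. if y ` T = T then 1 else 0)"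
    by (intro sum.cong refl) (simp add: sum.If_cases Int_def)
  also have "\<dots> = (\<Sum>T\<in>Pow {1..n}. \<Sum>y | y permutes {1..n}. if y ` T = T then 1 else 0)"
    by (rule sum.swap)
  also have "\<dots> = (\<Sum>T\<in>Pow {1..n}. card {y. y permutes {1..n} \<and> y ` T = T})"
    by (intro sum.cong refl) (simp add: sum.If_cases Int_def finite_permutations)
  also have "\<dots> \<le> (\<Sum>T\<in>Pow {1..n}. fact (card T) * fact (n - card T))"
    by (intro sum_mono card_permutes_stabilising) simp
  also have "\<dots> = (\<Sum>k\<le>n. \<Sum>T | T \<in> Pow {1..n} \<and> card T = k. fact (card T) * fact (n - card T))"
  proof (rule sum.group[symmetric])
    show "card ` Pow {1..n} \<subseteq> {..n}"
      using card_mono[of "{1..n}"] by fastforce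
  qed auto
  also have "\<dots> = (\<Sum>k\<le>n. (n choose k) * (fact k * fact (n - k)))"
  proof (rule sum.cong[OF refl])
    fix k assume "k \<in> {..n}"
    have "(\<Sum>T | T \<in> Pow {1..n} \<and> card T = k. fact (card T) * fact (n - card T))
      = card {T. T \<subseteq> {1..n} \<and> card T = k} * (fact k * fact (n - k))" by simp
    then show "(\<Sum>T | T \<in> Pow {1..n} \<and> card T = k. fact (card T) * fact (n - card T)) = (n choose k) * (fact k * fact (n - k))"
      using n_subsets[of "{1..n}" k] by simp
  qed
  also have "\<dots> = (\<Sum>k\<le>n. fact n)"
  proof (rule sum.cong[OF refl])
    fix k assume "k \<in> {..n}"
    then show "(n choose k) * (fact k * fact (n - k)) = fact n"
      using binomial_fact_lemma[of k n] by (simp add: mult.commute)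
  qed
  finally show ?thesis by simp
qed

text \<open>The orbit of a point of short period has at most \<open>R\<close> elements, so at least
  \<open>m\<close> orbits are needed to cover these points. Orbits are disjoint, hence different
  families of them have different invariant unions.\<close>

lemma many_invariant_sets:
  assumes y: "y permutes {1..n}" and R: "R > 0" "card (short_period n R y) \<ge> m * R"
  shows "2 ^ m \<le> card {T. T \<subseteq> {1..n} \<and> y ` T = T}"
proof -
  define Z where "Z = short_period n R y"
  define orb where "orb v = range (\<lambda>i. (y ^^ i) v)" for v
  have finZ: "finite Z" unfolding Z_def short_period_def by simp
  have inj: "inj y" using permutes_inj[OF y] .
  have per: "(y ^^ (c * i)) v = v" if "(y ^^ i) v = v" for c i v
    using that by (induction c) (simp_all add: funpow_add)
  have orb_small: "orb v \<subseteq> (\<lambda>i. (y ^^ i) v) ` {..<R}" if v: "v \<in> Z" for v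
  proof
    fix w assume "w \<in> orb v"
    then obtain i where i: "w = (y ^^ i) v" by (auto simp: orb_def)
    obtain c where c: "0 < c" "c < R" "(y ^^ c) v = v" using v by (auto simp: Z_def short_period_def)
    have "(y ^^ i) v = (y ^^ (i mod c + (i div c) * c)) v" by simp
    also have "\<dots> = (y ^^ (i mod c)) v" using per[OF c(3)] by (simp only: funpow_add comp_apply)
    finally have "w = (y ^^ (i mod c)) v" using i by simp
    moreover have "i mod c < R" using c by (meson less_trans mod_less_divisor)
    ultimately show "w \<in> (\<lambda>i. (y ^^ i) v) ` {..<R}" by blast
  qed
  have orb_sub: "orb v \<subseteq> orb w" if vw: "v \<in> Z" "orb v \<inter> orb w \<noteq> {}" for v w
  proof -
    obtain i j where ij: "(y ^^ i) v = (y ^^ j) w" using vw(2) by (auto simp: orb_def)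
    obtain c where c: "0 < c" "(y ^^ c) v = v" using vw(1) by (auto simp: Z_def short_period_def)
    have "i \<le> i * c" using c(1) by simp
    then have "(y ^^ (i * c)) v = (y ^^ (i * c - i)) ((y ^^ i) v)"
      by (metis comp_apply funpow_add le_add_diff_inverse2)
    then have v: "v = (y ^^ (i * c - i + j)) w"
      using per[OF c(2), of i] ij by (simp add: funpow_add)
    show ?thesis
    proof
      fix x assume "x \<in> orb v"
      then obtain l where "x = (y ^^ l) v" by (auto simp: orb_def)
      then have "x = (y ^^ (l + (i * c - i + j))) w" using v by (simp only: funpow_add comp_apply)
      then show "x \<in> orb w" by (auto simp: orb_def)
    qed
  qed
  have self: "v \<in> orb v" for v unfolding orb_def by (rule image_eqI[of _ _ 0]) simp_all
  have orb_inv: "y ` orb v = orb v" if "v \<in> Z" for v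
  proof (rule card_subset_eq)
    show fin: "finite (orb v)" by (rule finite_subset[OF orb_small[OF that]]) simp
    show "y ` orb v \<subseteq> orb v" unfolding orb_def by (auto intro: image_eqI[of _ _ "Suc _"])
    show "card (y ` orb v) = card (orb v)" using inj by (intro card_image) (auto simp: inj_on_def)
  qed
  have orb_range: "orb v \<subseteq> {1..n}" if "v \<in> Z" for v
  proof -
    have "v \<in> {1..n}" using that by (simp add: Z_def short_period_def)
    then show ?thesis unfolding orb_def using funpow_permutes_mem[OF y] by blast
  qed
  define Os where "Os = orb ` Z"
  have finOs: "finite Os" by (simp add: Os_def finZ)
  have "Z \<subseteq> \<Union>Os" using self by (auto simp: Os_def)
  then have "card Z \<le> card (\<Union>Os)"
    using orb_range by (intro card_mono finite_subset[of "\<Union>Os" "{1..n}"]) (auto simp: Os_def)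
  also have "\<dots> \<le> (\<Sum>X\<in>Os. card X)" by (rule card_Union_le_sum_card)
  also have "\<dots> \<le> (\<Sum>X\<in>Os. R)"
  proof (rule sum_mono)
    fix X assume "X \<in> Os"
    then obtain v where v: "v \<in> Z" "X = orb v" by (auto simp: Os_def)
    then have "card X \<le> card ((\<lambda>i. (y ^^ i) v) ` {..<R})" using orb_small by (intro card_mono) auto
    also have "\<dots> \<le> R" using card_image_le[of "{..<R}"] by fastforce
    finally show "card X \<le> R" .
  qed
  finally have "card Z \<le> card Os * R" by simp
  then have "m * R \<le> card Os * R" using R(2) unfolding Z_def by (rule order_trans[rotated])
  then have "(2::nat) ^ m \<le> 2 ^ card Os" using R(1) by simp
  also have "\<dots> = card (Pow Os)" by (simp add: card_Pow finOs)
  also have "\<dots> \<le> card {T. T \<subseteq> {1..n} \<and> y ` T = T}"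
  proof (rule card_inj_on_le)
    have mem: "X \<in> \<S> \<longleftrightarrow> X \<subseteq> \<Union>\<S>" if X: "X \<in> Os" "\<S> \<subseteq> Os" for X \<S>
    proof
      assume sub: "X \<subseteq> \<Union>\<S>"
      obtain v where v: "v \<in> Z" "X = orb v" using X(1) by (auto simp: Os_def)
      then obtain Y where Y: "Y \<in> \<S>" "v \<in> Y" using sub self by blast
      then obtain w where w: "w \<in> Z" "Y = orb w" using X(2) by (auto simp: Os_def)
      have "orb v \<inter> orb w \<noteq> {}" using self[of v] Y(2) w(2) by blast
      then have "X = Y" using orb_sub v w by blast
      then show "X \<in> \<S>" using Y(1) by simp
    qed auto
    show "inj_on Union (Pow Os)"
    proof (rule inj_onI)
      fix \<S> \<T> assume sub: "\<S> \<in> Pow Os" "\<T> \<in> Pow Os" "\<Union>\<S> = \<Union>\<T>"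
      have "X \<in> \<S> \<longleftrightarrow> X \<in> \<T>" if "X \<in> Os" for X
        using mem[OF that, of \<S>] mem[OF that, of \<T>] sub by simp
      then show "\<S> = \<T>" using sub(1,2) by blast
    qed
    show "Union ` Pow Os \<subseteq> {T. T \<subseteq> {1..n} \<and> y ` T = T}"
    proof (rule image_subsetI)
      fix \<S> assume "\<S> \<in> Pow Os"
      then have "X \<in> orb ` Z" if "X \<in> \<S>" for X using that by (auto simp: Os_def)
      then have "\<forall>X\<in>\<S>. X \<subseteq> {1..n} \<and> y ` X = X" using orb_inv orb_range by blast
      then show "\<Union>\<S> \<in> {T. T \<subseteq> {1..n} \<and> y ` T = T}" by (simp add: image_Union Sup_le_iff)
    qed
    show "finite {T. T \<subseteq> {1..n} \<and> y ` T = T}"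
      by (rule finite_subset[of _ "Pow {1..n}"]) auto
  qed
  finally show ?thesis .
qed

text \<open>Two times on one trajectory coincide only if its start lies on a cycle shorter than
  \<open>R\<close>. If trajectories of two labels meet at given times, one start is determined by
  the other. Both events restrict one of the \<open>card P\<close> independent starts, whence the
  exponent \<open>card P - 1\<close>.\<close>

lemma card_bad_starts:
  assumes y: "y permutes {1..n}" and P: "finite P"
  shows "card {s \<in> PiE P (\<lambda>_. {1..n}). \<not> inj_on (\<lambda>(a, j). (y ^^ j) (s a)) (P \<times> {..<R})}
    \<le> (card P * card (short_period n R y) + (card P)\<^sup>2 * R\<^sup>2) * n ^ (card P - 1)"
proof -
  define D where "D = {1..n}"
  define S where "S = PiE P (\<lambda>_. D)"
  define Z where "Z = short_period n R y"
  define B1 where "B1 a = {s \<in> S. s a \<in> Z}" for a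
  define B2 where "B2 a b i j = {s \<in> S. (y ^^ i) (s a) = (y ^^ j) (s b)}" for a b i j
  have cD: "card D = n" "finite D" by (simp_all add: D_def)
  have finS: "finite S" using P by (simp add: S_def finite_PiE cD)
  have finZ: "finite Z" by (simp add: Z_def short_period_def)
  have inj: "inj (y ^^ i)" for i by (rule inj_fn[OF permutes_inj[OF y]])
  have B1: "card (B1 a) \<le> card Z * n ^ (card P - 1)" if a: "a \<in> P" for a
  proof -
    have "card (B1 a) \<le> card (Z \<times> PiE (P - {a}) (\<lambda>_. D))"
    proof (rule card_inj_on_le)
      show "inj_on (\<lambda>s. (s a, restrict s (P - {a}))) (B1 a)"
      proof (rule inj_onI)
        fix s t assume st: "s \<in> B1 a" "t \<in> B1 a" "(s a, restrict s (P - {a})) = (t a, restrict t (P - {a}))"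
        show "s = t"
        proof (rule PiE_ext)
          show "s \<in> PiE P (\<lambda>_. D)" "t \<in> PiE P (\<lambda>_. D)" using st by (auto simp: B1_def S_def)
          show "s x = t x" if "x \<in> P" for x
            using st(3) that by (cases "x = a") (auto simp: restrict_def fun_eq_iff split: if_splits)
        qed
      qed
      show "(\<lambda>s. (s a, restrict s (P - {a}))) ` B1 a \<subseteq> Z \<times> PiE (P - {a}) (\<lambda>_. D)"
      proof (rule image_subsetI)
        fix s assume s: "s \<in> B1 a"
        have "s x \<in> D" if "x \<in> P - {a}" for x
          using s that unfolding B1_def S_def by (metis (mono_tags, lifting) DiffE PiE_mem mem_Collect_eq)
        then show "(s a, restrict s (P - {a})) \<in> Z \<times> PiE (P - {a}) (\<lambda>_. D)"
          using s by (simp add: B1_def restrict_PiE_iff)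
      qed
      show "finite (Z \<times> PiE (P - {a}) (\<lambda>_. D))" using P cD finZ by (simp add: finite_PiE)
    qed
    also have "\<dots> = card Z * n ^ (card P - 1)"
      using P a by (simp add: card_cartesian_product card_PiE cD)
    finally show ?thesis .
  qed
  have B2: "card (B2 a b i j) \<le> n ^ (card P - 1)" if ab: "a \<in> P" "b \<in> P" "a \<noteq> b" for a b i j
  proof -
    have "card (B2 a b i j) \<le> card (PiE (P - {b}) (\<lambda>_. D))"
    proof (rule card_inj_on_le)
      show "inj_on (\<lambda>s. restrict s (P - {b})) (B2 a b i j)"
      proof (rule inj_onI)
        fix s t assume st: "s \<in> B2 a b i j" "t \<in> B2 a b i j" "restrict s (P - {b}) = restrict t (P - {b})"
        have eq: "s x = t x" if "x \<in> P" "x \<noteq> b" for x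
          using fun_cong[OF st(3), of x] that by simp
        have "(y ^^ j) (s b) = (y ^^ j) (t b)" using st(1,2) eq[OF ab(1,3)] by (simp add: B2_def)
        then have "s b = t b" using inj by (simp add: inj_eq)
        show "s = t"
        proof (rule PiE_ext)
          show "s \<in> PiE P (\<lambda>_. D)" "t \<in> PiE P (\<lambda>_. D)" using st by (auto simp: B2_def S_def)
          show "s x = t x" if "x \<in> P" for x
            using eq[OF that] \<open>s b = t b\<close> by (cases "x = b") auto
        qed
      qed
      show "(\<lambda>s. restrict s (P - {b})) ` B2 a b i j \<subseteq> PiE (P - {b}) (\<lambda>_. D)"
      proof (rule image_subsetI)
        fix s assume s: "s \<in> B2 a b i j"
        have "s x \<in> D" if "x \<in> P - {b}" for x
          using s that unfolding B2_def S_def by (metis (mono_tags, lifting) DiffE PiE_mem mem_Collect_eq)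
        then show "restrict s (P - {b}) \<in> PiE (P - {b}) (\<lambda>_. D)"
          by (simp add: restrict_PiE_iff)
      qed
      show "finite (PiE (P - {b}) (\<lambda>_. D))" using P cD by (simp add: finite_PiE)
    qed
    also have "\<dots> = n ^ (card P - 1)" using P ab by (simp add: card_PiE cD)
    finally show ?thesis .
  qed
  define I where "I = {(a, b, i, j). a \<in> P \<and> b \<in> P \<and> a \<noteq> b \<and> i < R \<and> j < R}"
  have I_sub: "I \<subseteq> P \<times> P \<times> {..<R} \<times> {..<R}" by (auto simp: I_def)
  have finI: "finite I" by (rule finite_subset[OF I_sub]) (simp add: P)
  have cI: "card I \<le> (card P)\<^sup>2 * R\<^sup>2"
    using card_mono[OF _ I_sub] P by (simp add: card_cartesian_product power2_eq_square mult_ac)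
  have same: "s \<in> B1 a" if s: "s \<in> S" "a \<in> P" "i < j" "j < R" "(y ^^ i) (s a) = (y ^^ j) (s a)" for s a i j
  proof -
    have "(y ^^ j) (s a) = (y ^^ i) ((y ^^ (j - i)) (s a))"
      using s(3) by (metis comp_apply funpow_add le_add_diff_inverse less_imp_le)
    then have "(y ^^ (j - i)) (s a) = s a" using s(5) inj[of i] by (metis inj_eq)
    moreover have "0 < j - i" "j - i < R" using s by auto
    moreover have "s a \<in> {1..n}" using s(1,2) by (auto simp: S_def D_def)
    ultimately show ?thesis unfolding B1_def Z_def short_period_def using s(1) by blast
  qed
  have "{s \<in> S. \<not> inj_on (\<lambda>(a, j). (y ^^ j) (s a)) (P \<times> {..<R})}
     \<subseteq> (\<Union>a\<in>P. B1 a) \<union> (\<Union>(a, b, i, j)\<in>I. B2 a b i j)"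
  proof
    fix s assume s: "s \<in> {s \<in> S. \<not> inj_on (\<lambda>(a, j). (y ^^ j) (s a)) (P \<times> {..<R})}"
    then obtain a i b j where ab: "a \<in> P" "b \<in> P" "i < R" "j < R" "(y ^^ i) (s a) = (y ^^ j) (s b)" "(a, i) \<noteq> (b, j)"
      by (auto simp: inj_on_def)
    show "s \<in> (\<Union>a\<in>P. B1 a) \<union> (\<Union>(a, b, i, j)\<in>I. B2 a b i j)"
    proof (cases "a = b")
      case True
      have "s \<in> B1 a"
      proof (cases "i < j")
        case True
        show ?thesis by (rule same[of s a i j]) (use s ab \<open>a = b\<close> True in auto)
      next
        case False
        then have "j < i" using ab(6) \<open>a = b\<close> by auto
        show ?thesis by (rule same[of s a j i]) (use s ab \<open>a = b\<close> \<open>j < i\<close> in auto)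
      qed
      then show ?thesis using ab(1) by blast
    next
      case False
      then have "(a, b, i, j) \<in> I" "s \<in> B2 a b i j" using ab s by (auto simp: I_def B2_def)
      then show ?thesis by blast
    qed
  qed
  then have "card {s \<in> S. \<not> inj_on (\<lambda>(a, j). (y ^^ j) (s a)) (P \<times> {..<R})}
     \<le> card ((\<Union>a\<in>P. B1 a) \<union> (\<Union>(a, b, i, j)\<in>I. B2 a b i j))"
    by (rule card_mono[rotated])
      (rule finite_subset[OF _ finS], auto simp: B1_def B2_def)
  also have "\<dots> \<le> card (\<Union>a\<in>P. B1 a) + card (\<Union>(a, b, i, j)\<in>I. B2 a b i j)" by (rule card_Un_le)
  also have "\<dots> \<le> (\<Sum>a\<in>P. card (B1 a)) + (\<Sum>z\<in>I. card (case z of (a, b, i, j) \<Rightarrow> B2 a b i j))"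
    by (intro add_mono card_UN_le P finI)
  also have "\<dots> \<le> (\<Sum>a\<in>P. card Z * n ^ (card P - 1)) + (\<Sum>z\<in>I. n ^ (card P - 1))"
    by (intro add_mono sum_mono B1) (auto simp: I_def simp del: One_nat_def intro!: B2)
  also have "\<dots> \<le> (card P * card Z + (card P)\<^sup>2 * R\<^sup>2) * n ^ (card P - 1)"
    using mult_right_mono[OF cI, of "n ^ (card P - 1)"] by (simp add: distrib_right)
  finally show ?thesis by (simp add: S_def D_def Z_def)
qed

text \<open>A permutation fixes \<open>n + 1\<close> sets on average, but at least \<open>2 ^ m\<close> sets, the unions of its short
  cycles, if it has many short cycles.\<close>

lemma card_short_period_perms:
  assumes "R > 0"
  shows "card {y. y permutes {1..n} \<and> m * R \<le> card (short_period n R y)} * 2 ^ m \<le> (n + 1) * fact n"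
proof -
  define B where "B = {y. y permutes {1..n} \<and> m * R \<le> card (short_period n R y)}"
  have "card B * 2 ^ m = (\<Sum>y\<in>B. 2 ^ m)" by simp
  also have "\<dots> \<le> (\<Sum>y\<in>B. card {T. T \<subseteq> {1..n} \<and> y ` T = T})"
    by (intro sum_mono many_invariant_sets[OF _ assms]) (auto simp: B_def)
  also have "\<dots> \<le> (\<Sum>y | y permutes {1..n}. card {T. T \<subseteq> {1..n} \<and> y ` T = T})"
    by (intro sum_mono2) (auto simp: B_def finite_permutations)
  also have "\<dots> \<le> (n + 1) * fact n" by (rule sum_invariant_sets)
  finally show ?thesis by (simp add: B_def)
qed

text \<open>Permutations with many points on short cycles have density at most
  \<open>\<alpha> / 2\<close>. For each remaining element of \<open>A\<close> at least half of the
  choices of starts give distinct points. Averaging over the starts loses a factor 4 in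
  total.\<close>

lemma dense_starts:
  fixes \<alpha> :: real
  assumes A: "A \<subseteq> {y. y permutes {1..n}}" "real (card A) \<ge> \<alpha> * fact n"
    and P: "finite P" "P \<noteq> {}" and R: "R > 0"
    and m: "real (n + 1) \<le> \<alpha> / 2 * 2 ^ m" and n: "2 * (card P * (m * R) + (card P)\<^sup>2 * R\<^sup>2) \<le> n"
  obtains s where "s \<in> PiE P (\<lambda>_. {1..n})"
    "real (card {y \<in> A. y permutes {1..n} \<and> inj_on (\<lambda>(a, j). (y ^^ j) (s a)) (P \<times> {..<R})}) \<ge> \<alpha> / 4 * fact n"
proof -
  define S where "S = PiE P (\<lambda>_. {1..n})"
  define ok where "ok y s \<longleftrightarrow> inj_on (\<lambda>(a, j). (y ^^ j) (s a)) (P \<times> {..<R})" for y :: "nat \<Rightarrow> nat" and s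
  define B where "B = {y. y permutes {1..n} \<and> m * R \<le> card (short_period n R y)}"
  define q where "q = card P"
  have q: "q > 0" using P by (simp add: q_def card_gt_0_iff)
  have cS: "card S = n ^ q" using P by (simp add: S_def q_def card_PiE)
  have finS: "finite S" using P by (simp add: S_def finite_PiE)
  have finA: "finite A" by (rule finite_subset[OF A(1)]) (simp add: finite_permutations)
  have finB: "finite B" by (rule finite_subset[of _ "{y. y permutes {1..n}}"]) (auto simp: B_def finite_permutations)
  have "real (card B) * 2 ^ m \<le> real (n + 1) * fact n"
  proof -
    have "real (card B * 2 ^ m) \<le> real ((n + 1) * fact n)"
      unfolding B_def of_nat_le_iff by (rule card_short_period_perms[OF R])
    then show ?thesis by (simp add: distrib_right)
  qed
  also have "\<dots> \<le> (\<alpha> / 2 * 2 ^ m) * fact n" by (intro mult_right_mono m) simp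
  finally have cB: "real (card B) \<le> \<alpha> / 2 * fact n" by (simp add: mult_ac)
  have good: "real (n ^ q) / 2 \<le> real (card {s \<in> S. ok y s})" if y: "y \<in> A - B" for y
  proof -
    have yp: "y permutes {1..n}" using y A by auto
    have "card (short_period n R y) \<le> m * R" using y yp by (auto simp: B_def)
    then have "2 * (q * card (short_period n R y) + q\<^sup>2 * R\<^sup>2) \<le> 2 * (q * (m * R) + q\<^sup>2 * R\<^sup>2)"
      by (intro mult_left_mono add_mono) auto
    also have "\<dots> \<le> n" using n by (simp add: q_def)
    finally have "2 * (q * card (short_period n R y) + q\<^sup>2 * R\<^sup>2) * n ^ (q - 1) \<le> n * n ^ (q - 1)"
      by (rule mult_right_mono) simp
    also have "\<dots> = n ^ q" using q by (cases q) auto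
    finally have up: "2 * (q * card (short_period n R y) + q\<^sup>2 * R\<^sup>2) * n ^ (q - 1) \<le> n ^ q" .
    have "card {s \<in> S. \<not> ok y s} \<le> (q * card (short_period n R y) + q\<^sup>2 * R\<^sup>2) * n ^ (q - 1)"
      unfolding S_def ok_def q_def by (rule card_bad_starts[OF yp P(1)])
    then have "2 * card {s \<in> S. \<not> ok y s} \<le> n ^ q" using up by linarith
    moreover have "card {s \<in> S. ok y s} + card {s \<in> S. \<not> ok y s} = n ^ q"
      unfolding cS[symmetric] using finS
      by (subst card_Un_disjoint[symmetric]) (auto intro: arg_cong[of _ _ card])
    ultimately have "n ^ q \<le> 2 * card {s \<in> S. ok y s}" by linarith
    then have "real (n ^ q) \<le> real (2 * card {s \<in> S. ok y s})" by (rule of_nat_mono)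
    then show ?thesis by simp
  qed
  have "(\<Sum>s\<in>S. card {y \<in> A. ok y s}) = (\<Sum>y\<in>A. card {s \<in> S. ok y s})"
  proof -
    have "(\<Sum>s\<in>S. card {y \<in> A. ok y s}) = (\<Sum>s\<in>S. \<Sum>y\<in>A. if ok y s then 1 else 0)"
      using finA by (intro sum.cong refl) (simp add: sum.If_cases Int_def)
    also have "\<dots> = (\<Sum>y\<in>A. \<Sum>s\<in>S. if ok y s then 1 else 0)" by (rule sum.swap)
    also have "\<dots> = (\<Sum>y\<in>A. card {s \<in> S. ok y s})"
      using finS by (intro sum.cong refl) (simp add: sum.If_cases Int_def)
    finally show ?thesis .
  qed
  then have total: "(\<Sum>s\<in>S. real (card {y \<in> A. ok y s})) = (\<Sum>y\<in>A. real (card {s \<in> S. ok y s}))"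
    by (simp flip: of_nat_sum)
  have "\<alpha> / 2 * fact n \<le> real (card (A - B))"
  proof -
    have "card A \<le> card (A - B) + card B"
    proof -
      have "card A \<le> card ((A - B) \<union> B)" using finA finB by (intro card_mono) auto
      also have "\<dots> \<le> card (A - B) + card B" by (rule card_Un_le)
      finally show ?thesis .
    qed
    then have "real (card A) \<le> real (card (A - B)) + real (card B)" by linarith
    then show ?thesis using A(2) cB by linarith
  qed
  then have "\<alpha> / 2 * fact n * (real (n ^ q) / 2) \<le> real (card (A - B)) * (real (n ^ q) / 2)"
    by (rule mult_right_mono) simp
  also have "\<dots> = (\<Sum>y\<in>A - B. real (n ^ q) / 2)" by simp
  also have "\<dots> \<le> (\<Sum>y\<in>A - B. real (card {s \<in> S. ok y s}))" by (intro sum_mono good)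
  also have "\<dots> \<le> (\<Sum>y\<in>A. real (card {s \<in> S. ok y s}))" using finA by (intro sum_mono2) auto
  finally have lower: "(\<Sum>s\<in>S. \<alpha> / 4 * fact n) \<le> (\<Sum>s\<in>S. real (card {y \<in> A. ok y s}))"
    by (simp add: total cS mult_ac)
  have "\<exists>s\<in>S. \<alpha> / 4 * fact n \<le> real (card {y \<in> A. ok y s})"
  proof (rule ccontr)
    assume neg: "\<not> ?thesis"
    have "n > 0"
    proof (rule ccontr)
      assume "\<not> n > 0"
      then have "q = 0 \<or> R = 0" using n by (simp add: q_def)
      then show False using q R by simp
    qed
    then have "card S > 0" by (simp add: cS)
    then have "S \<noteq> {}" by auto
    then have "(\<Sum>s\<in>S. real (card {y \<in> A. ok y s})) < (\<Sum>s\<in>S. \<alpha> / 4 * fact n)"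
      using finS neg by (intro sum_strict_mono) (auto simp: not_le)
    then show False using lower by linarith
  qed
  then obtain s where s: "s \<in> S" "\<alpha> / 4 * fact n \<le> real (card {y \<in> A. ok y s})" by blast
  have "{y \<in> A. y permutes {1..n} \<and> ok y s} = {y \<in> A. ok y s}" using A(1) by auto
  then show ?thesis using that[of s] s by (simp add: S_def ok_def)
qed

section \<open>A weak form of Bertrand's postulate\<close>

text \<open>The entries of Leibniz's harmonic triangle are differences of entries with smaller second index, so
  by induction their denominators divide the least common multiple.\<close>

lemma leibniz_dvd_Lcm: "k < n \<Longrightarrow> n * (n - 1 choose k) dvd Lcm {1..n}"
proof (induction k arbitrary: n)
  case 0
  then show ?case by (auto intro: dvd_Lcm)
next
  case (Suc j)
  then obtain m where n: "n = Suc m" and jm: "j < m" by (cases n) auto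
  define l where "l = Lcm {1..n}"
  define A where "A = int (n * (m choose Suc j))"
  define B where "B = int (m * (m - 1 choose j))"
  define D where "D = int (n * (m choose j))"
  have "m * (m - 1 choose j) dvd Lcm {1..m}" using Suc.IH[OF jm] .
  also have "Lcm {1..m} dvd l" unfolding l_def by (intro Lcm_subset) (auto simp: n)
  finally obtain x where x: "int l = B * x" by (metis B_def dvdE of_nat_dvd_iff)
  have "n * (m choose j) dvd l" using Suc.IH[of n] jm by (simp add: n l_def)
  then obtain y where y: "int l = D * y" by (metis D_def dvdE of_nat_dvd_iff)
  have B1: "B = int (Suc j) * int (m choose Suc j)"
    by (simp only: B_def binomial_absorption[symmetric] of_nat_mult)
  have B2: "B = (int m - int j) * int (m choose j)"
    using jm by (simp only: B_def binomial_absorb_comp[symmetric] of_nat_mult of_nat_diff less_imp_le)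
  have "D - B = int (Suc j) * int (m choose j)"
    unfolding B2 D_def by (simp add: n algebra_simps)
  then have "A * (D - B) = int n * int (m choose j) * (int (Suc j) * int (m choose Suc j))"
    by (simp add: A_def)
  also have "\<dots> = D * B" by (simp add: B1 D_def)
  finally have id: "A * (D - B) = D * B" .
  have "A * (x - y) * (D * B) = A * (D * (B * x) - B * (D * y))" by (simp add: algebra_simps)
  also have "\<dots> = A * (D - B) * int l" by (simp add: x[symmetric] y[symmetric] algebra_simps)
  also have "\<dots> = int l * (D * B)" by (simp add: id)
  finally have eq: "A * (x - y) * (D * B) = int l * (D * B)" .
  have "m choose j > 0" "(m - 1) choose j > 0" using jm by (auto intro!: zero_less_binomial)
  then have "D \<noteq> 0" "B \<noteq> 0"
    using jm n unfolding D_def B_def of_nat_eq_0_iff mult_eq_0_iff by simp_all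
  then have "D * B \<noteq> 0" by simp
  then have "int l = A * (x - y)" using eq by simp
  then have "A dvd int l" by (rule dvdI)
  then have "n * (m choose Suc j) dvd l" unfolding A_def of_nat_dvd_iff .
  then show ?case by (simp only: l_def n diff_Suc_1)
qed

lemma Lcm_range_nonzero: "Lcm {1..n} \<noteq> (0::nat)"
proof
  assume "Lcm {1..n} = (0::nat)"
  moreover have "Lcm {1..n} dvd fact n" by (rule Lcm_least) (auto intro: dvd_fact)
  ultimately show False by simp
qed

text \<open>The central binomial coefficient is the largest of the \<open>2 * m + 1\<close> terms
  that add up to \<open>4 ^ m\<close>, and \<open>2 * m + 1\<close> times it divides the least
  common multiple.\<close>

lemma four_power_le_Lcm: "4 ^ m \<le> Lcm {1..2 * m + 1}"
proof -
  have "(2::nat) ^ (2 * m) = (\<Sum>k\<le>2 * m. (2 * m) choose k)" by (simp add: choose_row_sum)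
  also have "\<dots> \<le> (\<Sum>k\<le>2 * m. (2 * m) choose m)"
    using binomial_maximum'[of m] by (intro sum_mono)
  also have "\<dots> = (2 * m + 1) * ((2 * m + 1) - 1 choose m)" by simp
  also have "\<dots> \<le> Lcm {1..2 * m + 1}"
  proof (rule dvd_imp_le[OF leibniz_dvd_Lcm])
    show "0 < Lcm {1..2 * m + 1}" using Lcm_range_nonzero[of "2 * m + 1"] by (simp only: neq0_conv)
  qed simp
  finally show ?thesis by (simp add: power_mult)
qed

lemma prime_power_dvd_Lcm:
  fixes A :: "nat set"
  assumes "finite A" "prime p" "0 \<notin> A" "e > 0" "p ^ e dvd Lcm A"
  shows "\<exists>a\<in>A. p ^ e dvd a"
  using assms
proof (induction A rule: finite_induct)
  case empty
  then show ?case using prime_gt_1_nat[of p] by (auto simp: power_eq_1_iff)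
next
  case (insert a A)
  have nz: "a \<noteq> 0" "Lcm A \<noteq> 0" using insert by (auto simp: Lcm_0_iff)
  have np: "\<not> is_unit p" using insert.prems(1) not_prime_unit by blast
  have "e \<le> multiplicity p (lcm a (Lcm A))"
    using insert.prems nz np by (subst (asm) power_dvd_iff_le_multiplicity) (auto simp: lcm_eq_0_iff)
  then have "e \<le> multiplicity p a \<or> e \<le> multiplicity p (Lcm A)"
    using multiplicity_lcm[OF nz, of p] insert.prems(1) by (auto simp: max_def split: if_splits)
  then have "p ^ e dvd a \<or> p ^ e dvd Lcm A" using nz np by (auto simp: power_dvd_iff_le_multiplicity)
  then show ?case using insert by auto
qed

text \<open>The full power of a prime in the least common multiple already divides one of the
  numbers \<open>1..n\<close>, so it is at most \<open>n\<close>.\<close>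

lemma Lcm_le_power_card_primes:
  fixes n :: nat
  assumes "n > 0"
  shows "Lcm {1..n} \<le> n ^ card {p. prime p \<and> p \<le> n}"
proof -
  define l where "l = Lcm {1..n}"
  have nz: "l \<noteq> 0" unfolding l_def by (rule Lcm_range_nonzero)
  have le: "p ^ multiplicity p l \<le> n" "p \<le> n" if p: "p \<in> prime_factors l" for p
  proof -
    have pp: "prime p" "p dvd l" using p by (auto simp: in_prime_factors_iff)
    have "multiplicity p l > 0" using pp nz by (simp add: prime_multiplicity_gt_zero_iff)
    then obtain a where a: "a \<in> {1..n}" "p ^ multiplicity p l dvd a"
      using prime_power_dvd_Lcm[of "{1..n}" p "multiplicity p l"] pp multiplicity_dvd[of p l] by (auto simp: l_def)
    then show "p ^ multiplicity p l \<le> n" by (auto dest!: dvd_imp_le)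
    then show "p \<le> n" using \<open>multiplicity p l > 0\<close> pp(1)
      by (metis le_trans prime_ge_1_nat self_le_power)
  qed
  have fin: "finite {p::nat. prime p \<and> p \<le> n}" by (rule finite_subset[of _ "{..n}"]) auto
  have "l = (\<Prod>p\<in>prime_factors l. p ^ multiplicity p l)"
    using nz by (simp add: prime_factorization_nat)
  also have "\<dots> \<le> (\<Prod>p\<in>prime_factors l. n)" by (intro prod_mono) (use le in auto)
  also have "\<dots> = n ^ card (prime_factors l)" by simp
  also have "\<dots> \<le> n ^ card {p. prime p \<and> p \<le> n}"
    using le assms by (intro power_increasing card_mono fin) (auto simp: in_prime_factors_iff)
  finally show ?thesis by (simp add: l_def)
qed

text \<open>With \<open>n = 2 * X\<^sup>2 + 1\<close> and no prime in the range, at most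
  \<open>X\<close> primes lie below \<open>n\<close>, so \<open>4 ^ (X\<^sup>2) \<le> n ^ X\<close>,
  that is \<open>4 ^ X \<le> n\<close>. The generous cubic upper end is harmless, as only the order
  of magnitude of \<open>ln p\<close> matters.\<close>

lemma prime_between:
  assumes X: "X \<ge> 3"
  obtains p :: nat where "prime p" "X \<le> p" "p \<le> X ^ 3"
proof -
  define n where "n = 2 * X\<^sup>2 + 1"
  have nX: "n \<le> X ^ 3"
  proof -
    have "n \<le> 3 * X\<^sup>2" using X by (simp add: n_def power2_eq_square)
    also have "\<dots> \<le> X * X\<^sup>2" using X by (intro mult_right_mono) auto
    finally show ?thesis by (simp add: power3_eq_cube power2_eq_square)
  qed
  have small: "2 * X\<^sup>2 + 1 < 4 ^ X"
    using X
  proof (induction X rule: nat_induct_at_least)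
    case (Suc k)
    have "k * 1 \<le> k * k" using Suc.hyps by (intro mult_le_mono) auto
    moreover have "2 * (Suc k)\<^sup>2 + 1 = 2 * (k * k) + 4 * k + 3" "4 * (2 * k\<^sup>2 + 1) = 8 * (k * k) + 4"
      by (simp_all add: power2_eq_square algebra_simps)
    ultimately have "2 * (Suc k)\<^sup>2 + 1 \<le> 4 * (2 * k\<^sup>2 + 1)" by linarith
    also have "\<dots> < 4 * 4 ^ k" using Suc by simp
    finally show ?case by simp
  qed simp
  have "\<exists>p. prime p \<and> X \<le> p \<and> p \<le> n"
  proof (rule ccontr)
    assume "\<not> ?thesis"
    then have "{p. prime p \<and> p \<le> n} \<subseteq> {..<X}" by (auto simp: not_le)
    then have "card {p. prime p \<and> p \<le> n} \<le> X" using card_mono[of "{..<X}"] by fastforce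
    then have "n ^ card {p. prime p \<and> p \<le> n} \<le> n ^ X"
      by (intro power_increasing) (auto simp: n_def)
    moreover have "4 ^ (X\<^sup>2) \<le> Lcm {1..n}" unfolding n_def by (rule four_power_le_Lcm)
    moreover have "Lcm {1..n} \<le> n ^ card {p. prime p \<and> p \<le> n}"
      by (rule Lcm_le_power_card_primes) (simp add: n_def)
    ultimately have "(4 ^ X) ^ X \<le> n ^ X"
      by (simp add: power_mult[symmetric] power2_eq_square)
    then have "4 ^ X \<le> n" using X by (simp add: power_mono_iff)
    then show False using small by (simp add: n_def)
  qed
  then show ?thesis using that nX by (metis le_trans)
qed

section \<open>Sparsity of progression-free sets\<close>

text \<open>The labels are the \<open>p ^ 2\<close> points of the plane, so \<open>n\<close> must
  leave room for \<open>p ^ 2\<close> trajectories of length \<open>11 * b\<close>. Density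
  \<open>4 * \<delta>\<close> in the symmetric group becomes density \<open>\<delta>\<close> in a
  family of relabellings of one good permutation.\<close>

lemma dense_set_not_three_AP_free:
  fixes C \<delta> \<tau> :: real
  assumes p: "prime p" "p \<ge> 3" and b: "b > 0"
    and A: "A \<subseteq> carrier (sym_group n)" "real (card A) \<ge> 4 * \<delta> * fact n"
    and C: "C > 0" and \<delta>: "\<delta> \<ge> (real b / 4) powr - C" "\<delta>\<^sup>2 * real p ^ b > 32"
    and \<tau>: "\<tau> \<ge> 16 * (3 / sqrt (real ((p - 1) div 2)) + 2 / real p) * 35 powr (3 / 2 * C) * real p powr (3 / 20)"
      "(1 + \<tau>) ^ (11 * b) \<le> 3 / 2"
    and m: "real (n + 1) \<le> 2 * \<delta> * 2 ^ m"
    and n: "2 * (p\<^sup>2 * (m * (11 * b)) + (p\<^sup>2)\<^sup>2 * (11 * b)\<^sup>2) \<le> n"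
  shows "\<not> three_AP_free (sym_group n) A"
proof -
  define P where "P = {0..<int p} \<times> {0..<int p}"
  define R where "R = 11 * b"
  have cP: "card P = p\<^sup>2" "finite P" "P \<noteq> {}"
    using p by (auto simp: P_def card_cartesian_product power2_eq_square)
  have A': "A \<subseteq> {y. y permutes {1..n}}" using A(1) by (auto simp: sym_group_def)
  obtain s where s: "s \<in> PiE P (\<lambda>_. {1..n})"
    "real (card {y \<in> A. y permutes {1..n} \<and> inj_on (\<lambda>(a, j). (y ^^ j) (s a)) (P \<times> {..<R})}) \<ge> 4 * \<delta> / 4 * fact n"
  proof (rule dense_starts[OF A' A(2) cP(2,3)])
    show "R > 0" using b by (simp add: R_def)
    show "real (n + 1) \<le> 4 * \<delta> / 2 * 2 ^ m" using m by simp
    show "2 * (card P * (m * R) + (card P)\<^sup>2 * R\<^sup>2) \<le> n" using n unfolding cP R_def .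
  qed blast
  interpret mixing_group "SL2 p" p "(p - 1) div 2" "unip p" "torus p" "weight p"
    by (rule SL2_mixing_group[OF p])
  interpret relabelling "SL2 p" P R n s
  proof
    show "apply_bij h a \<in> P" if "h \<in> SL2 p" "a \<in> P" for h a
      using SL2_apply_mem[of p h a] that p by (simp add: P_def)
    show "apply_bij h a = a" if "h \<in> SL2 p" "a \<notin> P" for h a
      using SL2_apply_outside[of p h a] that p by (simp add: P_def)
    show "s a \<in> {1..n}" if "a \<in> P" for a using PiE_mem[OF s(1) that] .
  qed (rule cP(2))
  have \<delta>0: "\<delta> > 0" using \<delta>(1) b by (intro less_le_trans[OF _ \<delta>(1)]) simp
  have "real (card {y \<in> A. good y}) \<ge> \<delta> * fact n"
    using s(2) by (simp add: good_def pos_def[abs_def] Dom_def)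
  then obtain y where y: "good y" "real (card {k \<in> K. y \<circ> relabel y k \<in> A}) \<ge> \<delta> * card K"
    by (rule dense_orbit[OF _ \<delta>0])
  define S where "S = {k \<in> K. y \<circ> relabel y k \<in> A}"
  have cK: "card K = card (SL2 p) ^ (11 * b)" by (simp add: card_hbox R_def)
  have pH: "real p \<le> real (card (SL2 p))" using card_SL2_ge[OF p(1)] by simp
  have "real (card (SL2 p)) powr (1 / 20) \<le> (real p ^ 3) powr (1 / 20)"
    using SL2_subgroup_and_card(2)[OF p(1)] by (intro powr_mono2) (simp_all flip: of_nat_power)
  also have "real p ^ 3 = real p powr 3" using p by simp
  also have "(real p powr 3) powr (1 / 20) = real p powr (3 / 20)" by (simp only: powr_powr) simp
  finally have H20: "real (card (SL2 p)) powr (1 / 20) \<le> real p powr (3 / 20)" .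
  obtain k v where kv: "k \<in> S" "v \<in> hbox {..<11 * b} (SL2 p)" "v \<noteq> 0" "v 0 = 0"
    "k + v \<in> S" "(\<lambda>i. - v (Suc i) + k i) \<in> S"
  proof (rule chain_solution[of S b C \<delta> \<tau>])
    show "S \<subseteq> hbox {..<11 * b} (SL2 p)" by (auto simp: S_def R_def)
    show "\<delta> * real (card (SL2 p) ^ (11 * b)) \<le> real (card S)" using y(2) unfolding S_def cK .
    have "\<delta>\<^sup>2 * real p ^ b \<le> \<delta>\<^sup>2 * real (card (SL2 p)) ^ b"
      by (intro mult_left_mono power_mono pH) simp_all
    then show "32 < \<delta>\<^sup>2 * real (card (SL2 p)) ^ b" using \<delta>(2) by linarith
    have "16 * lam * 35 powr (3 / 2 * C) * real (card (SL2 p)) powr (1 / 20)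
      \<le> 16 * lam * 35 powr (3 / 2 * C) * real p powr (3 / 20)"
      unfolding lam_def by (intro mult_left_mono H20) simp
    also have "\<dots> \<le> \<tau>" using \<tau>(1) unfolding lam_def .
    finally show "16 * lam * 35 powr (3 / 2 * C) * real (card (SL2 p)) powr (1 / 20) \<le> \<tau>" .
  qed (rule C b \<delta>(1) \<tau>(2); assumption)+
  have kK: "k \<in> K" "v \<in> K" using kv by (simp_all add: S_def R_def)
  define X Y Z where XYZ: "X = y \<circ> relabel y (k + v)" "Y = y \<circ> relabel y k"
    "Z = y \<circ> relabel y (\<lambda>i. - v (Suc i) + k i)"
  have in_A: "X \<in> A" "Y \<in> A" "Z \<in> A" using kv by (simp_all add: S_def XYZ)
  have "X \<circ> Z = Y \<circ> Y" "X \<noteq> Y"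
    unfolding XYZ by (rule relabel_progression[OF y(1) kK(1) kK(2) kv(3,4)])+
  then have "nontrivial_three_AP (sym_group n) X Y Z"
    using A(1) in_A group.is_monoid[OF sym_group_is_group[of n]]
   
    by (auto simp: nontrivial_three_AP_def three_AP_def sym_group_def numeral_2_eq_2)
  then show ?thesis using in_A by (auto simp: three_AP_free_def)
qed

section \<open>Choice of the parameters\<close>

lemma mixing_parameter_le:
  assumes "prime p" "p \<ge> 3"
  shows "3 / sqrt (real ((p - 1) div 2)) + 2 / real p \<le> 8 / sqrt (real p)"
proof -
  define N where "N = (p - 1) div 2"
  have "odd p" using assms prime_odd_nat by simp
  then have pN: "real p \<le> 3 * real N" "real N > 0" using assms(2) by (auto simp: N_def elim!: oddE)
  have "sqrt (real p) \<le> sqrt (4 * real N)" using pN by (intro real_sqrt_le_mono) linarith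
  then have "sqrt (real p) \<le> 2 * sqrt (real N)" by (simp add: real_sqrt_mult)
  then have "3 / sqrt (real N) \<le> 6 / sqrt (real p)" using pN assms by (simp add: field_simps)
  moreover have "sqrt (real p) \<le> real p" using assms(2) by (intro real_le_lsqrt) (simp_all add: power2_eq_square)
  then have "2 / real p \<le> 2 / sqrt (real p)" using assms(2) by (intro divide_left_mono) auto
  ultimately show ?thesis by (simp add: N_def add_divide_distrib[symmetric])
qed

lemma exp_nat_ge: "(5 / 2 :: real) ^ k \<le> exp (real k)"
proof -
  have "(5 / 2 :: real) \<le> exp 1" using exp_lower_Taylor_quadratic[of 1] by simp
  then have "(5 / 2 :: real) ^ k \<le> exp 1 ^ k" by (intro power_mono) simp_all
  also have "\<dots> = exp (real k)" by (simp flip: exp_of_nat_mult)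
  finally show ?thesis .
qed

text \<open>The choice \<open>C = L / 120\<close> makes the density threshold \<open>(b / 4) powr - C\<close> decay like
  \<open>exp (- const * (ln n)\<^sup>2)\<close>, while the loss \<open>35 powr (3 / 2 * C) \<le> X powr (1 / 20)\<close> is still smaller than
  the mixing gain.\<close>

lemma three_AP_free_sparse:
  fixes n X :: nat
  defines "x \<equiv> real n" and "L \<equiv> ln (real X)" and "Y \<equiv> real X powr (1 / 10)"
  assumes n: "n \<ge> 2" and X3: "X \<ge> 3" and Xx: "real X \<le> x powr (1 / 100)" "x powr (1 / 200) \<le> real X"
    and E1: "11 * Y * (128 * real X powr - (3 / 10)) \<le> 1 / 3"
    and E2: "(Y - 1) * L - L\<^sup>2 / 600 > 5" and Y: "Y > 5"
    and E3: "2 - L / 120 * ln ((Y - 1) / 4) \<le> - L\<^sup>2 / 2400"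
    and E4: "ln (x + 1) + (ln x)\<^sup>2 \<le> sqrt x / 2"
    and E5: "22 * x powr (6 / 100) * (sqrt x + 1) * x powr (1 / 100) + 242 * x powr (12 / 100) * x powr (2 / 100) \<le> x"
    and A: "A \<subseteq> carrier (sym_group n)" "three_AP_free (sym_group n) A"
  shows "sym_density n A < x powr (- (1 / 96000000) * ln x)"
proof -
  obtain p where p: "prime p" "X \<le> p" "p \<le> X ^ 3" using prime_between[OF X3] .
  have p3: "p \<ge> 3" using p X3 by simp
  \<comment> \<open>A power of \<open>X\<close>, so that \<open>ln b\<close> is comparable with
    \<open>L\<close>, and small enough that the error \<open>\<tau>\<close> per coordinate stays
    bounded when summed over \<open>11 * b\<close> coordinates.\<close>
  define b where "b = nat \<lfloor>Y\<rfloor>"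
  have bY: "real b \<le> Y" "Y - 1 \<le> real b" using Y unfolding b_def by linarith+
  have b: "b > 0" "real b > 4" using bY Y by linarith+
  have L: "L > 0" using X3 by (simp add: L_def)
  have x: "x \<ge> 2" using n by (simp add: x_def)
  have X0: "real X > 0" using X3 by simp
  have Yexp: "Y = exp (L / 10)" using X0 by (simp add: Y_def L_def powr_def)
  have Lx: "L \<le> ln x"
  proof -
    have "L \<le> ln (x powr (1 / 100))" unfolding L_def using Xx(1) X0 by (rule ln_mono)
    also have "\<dots> = ln x / 100" using x by (simp add: ln_powr)
    also have "\<dots> \<le> ln x" using x by simp
    finally show ?thesis .
  qed
  have xL: "ln x / 200 \<le> L"
  proof -
    have "ln (x powr (1 / 200)) \<le> L" unfolding L_def using Xx(2) x by (intro ln_mono) (use X0 x in auto)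
    then show ?thesis using x by (simp add: ln_powr)
  qed
  define C where "C = L / 120"
  define \<delta> where "\<delta> = (real b / 4) powr - C"
  have C: "C > 0" using L by (simp add: C_def)
  have \<delta>exp: "\<delta> = exp (- C * ln (real b / 4))" using b by (simp add: \<delta>_def powr_def)
  have \<delta>_ge: "exp (- L\<^sup>2 / 1200) \<le> \<delta>"
  proof -
    have "ln (real b / 4) \<le> ln Y" using b bY(1) Y by (intro ln_mono) auto
    then have "C * ln (real b / 4) \<le> C * (L / 10)" using C by (intro mult_left_mono) (simp_all add: Yexp)
    then show ?thesis by (simp add: \<delta>exp C_def power2_eq_square)
  qed
  have \<delta>_le: "4 * \<delta> \<le> exp (- L\<^sup>2 / 2400)"
  proof -
    have "ln ((Y - 1) / 4) \<le> ln (real b / 4)" using b bY(2) Y by (intro ln_mono) auto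
    then have "C * ln ((Y - 1) / 4) \<le> C * ln (real b / 4)" using C by (intro mult_left_mono) simp_all
    then have le: "2 - C * ln (real b / 4) \<le> - L\<^sup>2 / 2400" using E3 by (simp add: C_def)
    have "(4::real) \<le> exp 2" using exp_nat_ge[of 2] by (simp add: power2_eq_square)
    then have "4 * \<delta> \<le> exp 2 * \<delta>" by (rule mult_right_mono) (simp add: \<delta>_def)
    also have "\<dots> = exp (2 - C * ln (real b / 4))" unfolding \<delta>exp exp_add[symmetric] by simp
    also have "\<dots> \<le> exp (- L\<^sup>2 / 2400)" using le by simp
    finally show ?thesis .
  qed
  have two: "\<delta>\<^sup>2 * real p ^ b > 32"
  proof -
    have "32 < exp (5 :: real)" using exp_nat_ge[of 5] by (simp add: power_divide)
    also have "\<dots> \<le> exp ((Y - 1) * L - L\<^sup>2 / 600)" using E2 by simp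
    also have "\<dots> \<le> exp (real b * L - L\<^sup>2 / 600)" using bY(2) L by (simp add: mult_right_mono)
    also have "\<dots> = (exp (- L\<^sup>2 / 1200))\<^sup>2 * exp L ^ b"
      by (simp flip: exp_of_nat_mult exp_add)
    also have "\<dots> \<le> \<delta>\<^sup>2 * real p ^ b"
      using \<delta>_ge p(2) X0 by (intro mult_mono power_mono) (simp_all add: L_def)
    finally show ?thesis .
  qed
  \<comment> \<open>The constant is \<open>16 * 8\<close>. The exponent is \<open>1 / 20\<close>
    from the spread factor plus \<open>3 / 20 - 1 / 2\<close> from \<open>card H\<close> and the
    mixing gain, with \<open>p\<close> replaced by its lower bound \<open>X\<close>.\<close>
  define \<tau> where "\<tau> = 128 * real X powr - (3 / 10)"
  have \<tau>0: "\<tau> \<ge> 0" by (simp add: \<tau>_def)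
  have tau: "16 * (3 / sqrt (real ((p - 1) div 2)) + 2 / real p) * 35 powr (3 / 2 * C) * real p powr (3 / 20) \<le> \<tau>"
  proof -
    have "ln (35 :: real) \<le> ln (exp 4)" using exp_nat_ge[of 4] by (intro ln_mono) (simp_all add: power_divide)
    then have "3 / 2 * C * ln 35 \<le> 3 / 2 * C * 4" using C by (intro mult_left_mono) simp_all
    then have "exp (3 / 2 * C * ln 35) \<le> exp (L / 20)" by (simp add: C_def)
    then have t35: "35 powr (3 / 2 * C) \<le> real X powr (1 / 20)" using X0 by (simp add: powr_def L_def)
    have "16 * (3 / sqrt (real ((p - 1) div 2)) + 2 / real p) * 35 powr (3 / 2 * C) * real p powr (3 / 20)
      \<le> 16 * (8 / sqrt (real p)) * real X powr (1 / 20) * real p powr (3 / 20)"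
      by (intro mult_right_mono mult_mono t35 mult_left_mono mixing_parameter_le[OF p(1) p3]) simp_all
    also have "\<dots> = 128 * real X powr (1 / 20) * (real p powr (3 / 20) / real p powr (1 / 2))"
      by (simp add: powr_half_sqrt)
    also have "real p powr (3 / 20) / real p powr (1 / 2) = real p powr - (7 / 20)"
      by (simp flip: powr_diff)
    also have "128 * real X powr (1 / 20) * real p powr - (7 / 20)
      \<le> 128 * real X powr (1 / 20) * real X powr - (7 / 20)"
      using p(2) X0 by (intro mult_left_mono powr_mono2') simp_all
    also have "\<dots> = 128 * (real X powr (1 / 20) * real X powr - (7 / 20))" by simp
    also have "\<dots> = \<tau>" unfolding powr_add[symmetric] \<tau>_def by simp
    finally show ?thesis .
  qed
  have pw: "(1 + \<tau>) ^ (11 * b) \<le> 3 / 2"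
  proof -
    have "(1 + \<tau>) ^ (11 * b) \<le> exp \<tau> ^ (11 * b)" using \<tau>0 by (intro power_mono exp_ge_add_one_self) simp
    also have "\<dots> = exp (11 * real b * \<tau>)" by (simp flip: exp_of_nat_mult)
    also have "\<dots> \<le> exp (1 / 3)"
    proof -
      have "11 * real b * \<tau> \<le> 11 * Y * \<tau>" using bY(1) \<tau>0 by (intro mult_right_mono) simp_all
      then show ?thesis using E1 by (simp add: \<tau>_def)
    qed
    also have "\<dots> \<le> 3 / 2" using exp_bound[of "1 / 3"] by (simp add: power2_eq_square)
    finally show ?thesis .
  qed
  \<comment> \<open>Then \<open>2 ^ m\<close> exceeds \<open>(n + 1) / \<delta>\<close>, which is
    only \<open>exp\<close> of a multiple of the squared logarithm, while
    \<open>p\<^sup>2 * m * b\<close> still stays below \<open>n\<close>.\<close>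
  define m where "m = nat \<lceil>sqrt x\<rceil>"
  have m: "sqrt x \<le> real m" "real m \<le> sqrt x + 1"
    using x real_sqrt_ge_zero[of x] unfolding m_def by linarith+
  have big: "real (n + 1) \<le> 2 * \<delta> * 2 ^ m"
  proof -
    have "L\<^sup>2 \<le> (ln x)\<^sup>2" using L Lx by (intro power_mono) simp_all
    then have "L\<^sup>2 / 1200 \<le> (ln x)\<^sup>2" using zero_le_power2[of "ln x"] by linarith
    moreover have "(1 / 2 :: real) \<le> ln 2" using ln_le_minus_one[of "1 / 2"] by (simp add: ln_div)
    then have "sqrt x * (1 / 2) \<le> real m * ln 2" using x by (intro mult_mono m(1)) simp_all
    ultimately have "ln (x + 1) \<le> - L\<^sup>2 / 1200 + real m * ln 2" using E4 by simp
    then have "exp (ln (x + 1)) \<le> exp (- L\<^sup>2 / 1200) * exp (real m * ln 2)"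
      by (simp flip: exp_add)
    also have "exp (real m * ln 2) = 2 ^ m" by (simp add: exp_of_nat_mult)
    also have "exp (- L\<^sup>2 / 1200) * 2 ^ m \<le> \<delta> * 2 ^ m" using \<delta>_ge by simp
    also have "\<dots> \<le> 2 * \<delta> * 2 ^ m" by (simp add: \<delta>_def)
    finally show ?thesis using x by (simp add: x_def)
  qed
  have room: "2 * (p\<^sup>2 * (m * (11 * b)) + (p\<^sup>2)\<^sup>2 * (11 * b)\<^sup>2) \<le> n"
  proof -
    have "real p \<le> real X ^ 3" using p(3) by (simp flip: of_nat_power)
    also have "\<dots> \<le> (x powr (1 / 100)) ^ 3" using Xx by (intro power_mono) simp_all
    finally have px: "real p \<le> (x powr (1 / 100)) ^ 3" .
    have "Y \<le> real X powr 1" unfolding Y_def using X3 by (intro powr_mono) simp_all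
    then have bx: "real b \<le> x powr (1 / 100)" using bY Xx X0 by simp
    have pow: "(x powr (1 / 100)) ^ k = x powr (real k / 100)" for k
      using x by (simp add: powr_realpow[symmetric] powr_powr)
    have p2: "real p ^ 2 \<le> x powr (6 / 100)"
      using power_mono[OF px, of 2] pow[of 6] by (simp flip: power_mult)
    have p4: "real p ^ 4 \<le> x powr (12 / 100)"
      using power_mono[OF px, of 4] pow[of 12] by (simp flip: power_mult)
    have b2: "real b ^ 2 \<le> x powr (2 / 100)"
      using power_mono[OF bx, of 2] pow[of 2] by simp
    have "real (2 * (p\<^sup>2 * (m * (11 * b)) + (p\<^sup>2)\<^sup>2 * (11 * b)\<^sup>2))
      = 22 * real p ^ 2 * real m * real b + 242 * real p ^ 4 * real b ^ 2"
      by (simp add: power_mult_distrib flip: power_mult)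
    also have "\<dots> \<le> 22 * x powr (6 / 100) * (sqrt x + 1) * x powr (1 / 100) + 242 * x powr (12 / 100) * x powr (2 / 100)"
      using x by (intro add_mono mult_mono mult_left_mono p2 p4 b2 bx m) simp_all
    also have "\<dots> \<le> real n" using E5 by (simp only: x_def)
    finally show ?thesis by (simp only: of_nat_le_iff)
  qed
  have "\<not> real (card A) \<ge> 4 * \<delta> * fact n"
    using dense_set_not_three_AP_free[OF p(1) p3 b(1) A(1) _ C _ two tau pw big room] A(2) by (auto simp: \<delta>_def)
  then have "sym_density n A < 4 * \<delta>" by (simp add: sym_density_def field_simps)
  also have "\<dots> \<le> exp (- L\<^sup>2 / 2400)" by (rule \<delta>_le)
  \<comment> \<open>From \<open>L \<ge> ln x / 200\<close>:
    \<open>96000000 = 2400 * 200\<^sup>2\<close>.\<close>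
  also have "\<dots> \<le> exp (- (ln x)\<^sup>2 / 96000000)"
    using power_mono[OF xL, of 2] x by (simp add: power_divide)
  also have "\<dots> = x powr (- (1 / 96000000) * ln x)"
    using x by (simp add: powr_def power2_eq_square)
  finally show ?thesis .
qed

lemma eventually_three_AP_free_sparse:
  "eventually (\<lambda>n. \<forall>A \<subseteq> carrier (sym_group n). three_AP_free (sym_group n) A
     \<longrightarrow> sym_density n A < real n powr (- (1 / 96000000) * ln (real n))) sequentially"
proof -
  have "eventually (\<lambda>X::nat. 11 * real X powr (1 / 10) * (128 * real X powr - (3 / 10)) \<le> 1 / 3) sequentially"
    by real_asymp
  moreover have "eventually (\<lambda>X::nat. (real X powr (1 / 10) - 1) * ln (real X) - (ln (real X))\<^sup>2 / 600 > 5) sequentially"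
    by real_asymp
  moreover have "eventually (\<lambda>X::nat. real X powr (1 / 10) > 5) sequentially"
    by real_asymp
  moreover have "eventually (\<lambda>X::nat. X \<ge> 3) sequentially"
    by (rule eventually_ge_at_top)
  moreover have "eventually (\<lambda>X::nat. 2 - ln (real X) / 120 * ln ((real X powr (1 / 10) - 1) / 4) \<le> - (ln (real X))\<^sup>2 / 2400) sequentially"
    by real_asymp
  ultimately have "eventually (\<lambda>X::nat. X \<ge> 3 \<and> 11 * real X powr (1 / 10) * (128 * real X powr - (3 / 10)) \<le> 1 / 3
    \<and> (real X powr (1 / 10) - 1) * ln (real X) - (ln (real X))\<^sup>2 / 600 > 5 \<and> real X powr (1 / 10) > 5
    \<and> 2 - ln (real X) / 120 * ln ((real X powr (1 / 10) - 1) / 4) \<le> - (ln (real X))\<^sup>2 / 2400) sequentially"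
    (is "eventually ?large _") by eventually_elim blast
  then obtain M where M: "?large X" if "X \<ge> M" for X unfolding eventually_sequentially by blast
  have "eventually (\<lambda>n::nat. real M \<le> real n powr (1 / 100)) sequentially"
    by real_asymp
  moreover have "eventually (\<lambda>n::nat. real n powr (1 / 200) \<le> real n powr (1 / 100) - 1) sequentially"
    by real_asymp
  moreover have "eventually (\<lambda>n::nat. ln (real n + 1) + (ln (real n))\<^sup>2 \<le> sqrt (real n) / 2) sequentially"
    by real_asymp
  moreover have "eventually (\<lambda>n::nat. 22 * real n powr (6 / 100) * (sqrt (real n) + 1) * real n powr (1 / 100)
       + 242 * real n powr (12 / 100) * real n powr (2 / 100) \<le> real n) sequentially"
    by real_asymp
  ultimately show ?thesis using eventually_ge_at_top[of 2]
  proof eventually_elim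
    fix n :: nat
    assume n: "real M \<le> real n powr (1 / 100)" "real n powr (1 / 200) \<le> real n powr (1 / 100) - 1"
      "ln (real n + 1) + (ln (real n))\<^sup>2 \<le> sqrt (real n) / 2"
      "22 * real n powr (6 / 100) * (sqrt (real n) + 1) * real n powr (1 / 100)
       + 242 * real n powr (12 / 100) * real n powr (2 / 100) \<le> real n" "2 \<le> n"
    \<comment> \<open>This tends to infinity with \<open>n\<close>, so the conditions on
      \<open>X\<close> alone hold eventually too; the gap between the exponents
      \<open>1 / 200\<close> and \<open>1 / 100\<close> makes up for rounding down.\<close>
    define X where "X = nat \<lfloor>real n powr (1 / 100)\<rfloor>"
    have "int M \<le> \<lfloor>real n powr (1 / 100)\<rfloor>" using n(1) by (simp add: le_floor_iff)
    then have "M \<le> X" by (simp add: X_def)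
    have X: "real X \<le> real n powr (1 / 100)" "real n powr (1 / 200) \<le> real X"
      using n(2) by (simp_all add: X_def) linarith
    show "\<forall>A \<subseteq> carrier (sym_group n). three_AP_free (sym_group n) A
     \<longrightarrow> sym_density n A < real n powr (- (1 / 96000000) * ln (real n))"
      using three_AP_free_sparse[OF n(5) _ X _ _ _ _ n(3,4)] M[OF \<open>M \<le> X\<close>] by blast
  qed
qed

text \<open>A transposition \<open>t\<close> yields the progression \<open>t, id, t\<close>, so
  \<open>A\<close> misses some permutation. This trivial bound handles the small values of
  \<open>n\<close>.\<close>

lemma sym_density_three_AP_free_le:
  assumes n: "n \<ge> 2" and A: "A \<subseteq> carrier (sym_group n)" "three_AP_free (sym_group n) A"
  shows "sym_density n A \<le> 1 - 1 / fact n"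
proof -
  define G where "G = {y. y permutes {1..n}}"
  have G: "finite G" "card G = fact n" by (simp_all add: G_def finite_permutations card_permutations)
  have AG: "A \<subseteq> G" using A(1) by (auto simp: sym_group_def G_def)
  define t where "t = transpose (1::nat) 2"
  have "t permutes {1..n}" using n unfolding t_def by (intro permutes_swap_id) auto
  moreover have "id permutes {1..n}" by (rule permutes_id)
  moreover have "t \<circ> t = id \<circ> id" by (simp add: t_def)
  moreover have "t 1 \<noteq> id 1" by (simp add: t_def)
  then have "t \<noteq> id" by blast
  ultimately have "nontrivial_three_AP (sym_group n) t id t"
    by (auto simp: nontrivial_three_AP_def three_AP_def sym_group_def numeral_2_eq_2)
  then have "A \<noteq> G"
    using A(2) \<open>t permutes {1..n}\<close> \<open>id permutes {1..n}\<close> by (auto simp: three_AP_free_def G_def)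
  then have "card A < fact n" using AG G psubset_card_mono[of G A] by auto
  then have "real (card A) + 1 \<le> real (fact n)" by linarith
  then show ?thesis by (simp add: sym_density_def field_simps)
qed

theorem theorem1p5:
  shows "\<exists>c::real. c > 0 \<and>
    (\<forall>n::nat. n \<ge> 2 \<longrightarrow>
      (\<forall>A. A \<subseteq> carrier (sym_group n) \<and> three_AP_free (sym_group n) A \<longrightarrow>
        sym_density n A < real n powr (- c * ln (real n))))"
proof -
  obtain M where M: "\<And>n A. n \<ge> M \<Longrightarrow> A \<subseteq> carrier (sym_group n) \<Longrightarrow> three_AP_free (sym_group n) A
     \<Longrightarrow> sym_density n A < real n powr (- (1 / 96000000) * ln (real n))"
    using eventually_three_AP_free_sparse unfolding eventually_sequentially by blast
  \<comment> \<open>Makes \<open>c * (ln n)\<^sup>2 < 1 / fact n\<close> for all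
    \<open>2 \<le> n < M\<close>. The inequality \<open>exp (- z) \<ge> 1 - z\<close> then places
    the target above the trivial bound \<open>1 - 1 / fact n\<close>.\<close>
  define D where "D = 2 * fact M * (real M)\<^sup>2 + 1"
  have D: "D > 0" by (simp add: D_def add_nonneg_pos)
  define c where "c = min (1 / 96000000) (1 / D)"
  have c: "c > 0" "c \<le> 1 / 96000000" "c \<le> 1 / D" using D by (simp_all add: c_def)
  have "sym_density n A < real n powr (- c * ln (real n))"
    if n: "n \<ge> 2" and A: "A \<subseteq> carrier (sym_group n)" "three_AP_free (sym_group n) A" for n A
  proof (cases "n \<ge> M")
    case True
    have "c * ln (real n) \<le> 1 / 96000000 * ln (real n)" using c(2) n by (intro mult_right_mono) simp_all
    then have "real n powr (- (1 / 96000000) * ln (real n)) \<le> real n powr (- c * ln (real n))"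
      using n by (intro powr_mono) simp_all
    then show ?thesis using M[OF True A] by linarith
  next
    case False
    have ln_le: "(ln (real n))\<^sup>2 \<le> (real M)\<^sup>2"
      using False n ln_le_minus_one[of "real n"] by (intro power_mono) simp_all
    have "c * (ln (real n))\<^sup>2 \<le> 1 / D * (real M)\<^sup>2"
      using c ln_le D by (intro mult_mono) simp_all
    also have "\<dots> < 1 / fact M"
    proof -
      have "fact M * (real M)\<^sup>2 < D" by (simp add: D_def add_strict_increasing2)
      then show ?thesis using D by (simp add: field_simps)
    qed
    also have "\<dots> \<le> 1 / fact n" using False by (intro divide_left_mono fact_mono) simp_all
    finally have "1 - 1 / fact n < 1 + (- (c * (ln (real n))\<^sup>2))" by simp
    also have "\<dots> \<le> exp (- (c * (ln (real n))\<^sup>2))" by (rule exp_ge_add_one_self)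
    also have "\<dots> = real n powr (- c * ln (real n))" using n by (simp add: powr_def power2_eq_square)
    finally show ?thesis using sym_density_three_AP_free_le[OF n A] by linarith
  qed
  then show ?thesis using c(1) by blast
qed

end
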